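(* Let $\mathbf H=\mathbf H_{t,c}$ be a rational Cherednik algebra and let $M$ be an $\mathbf H$-module such that $D^2$ acts semisimply on $M\otimes S$. Then there are injective $\widetilde W$-module homomorphisms $$H_D(M)\hookrightarrow H^\bullet(\mathfrak h^*,M)\otimes\chi,\qquad H_D(M)\hookrightarrow H_\bullet(\mathfrak h,M)\otimes\chi .$$
   Context: **Rational Cherednik algebra.** $\mathfrak h$ is a finite-dimensional complex vector space, $n=\dim\mathfrak h$, $W\subset GL(\mathfrak h)$ a finite complex reflection group, $\mathcal R\subset W$ its set of (pseudo-)reflections, $\langle\ ,\ \rangle$ the natural pairing between $\mathfrak h$ and $\mathfrak h^*$. For $s\in\mathcal R$, $\alpha_s\in\mathfrak h^*$ is a nonzero vector vanishing on the hyperplane of $\mathfrak h$ fixed by $s$, $\alpha_s^\vee\in\mathfrak h$ a nonzero vector vanishing on the hyperplane of $\mathfrak h^*$ fixed by $s$, and $\lambda_s=\det_{\mathfrak h}(s)$. Let $t\in\mathbb C$ and $c:\mathcal R\to\mathbb C$ be conjugation-invariant. $\mathbf H_{t,c}$ is the quotient of $T(\mathfrak h\oplus\mathfrak h^* )\rtimes\mathbb C[W]$ by the relations $[x,x']=0$, $[y,y']=0$, $[y,x]=t\langle y,x\rangle-\sum_{s\in\mathcal R}c(s)\frac{\langle y,\alpha_s\rangle\langle\alpha_s^\vee,x\rangle}{\langle\alpha_s^\vee,\alpha_s\rangle}s$ for $x,x'\in\mathfrak h^*$, $y,y'\in\mathfrak h$. Fix a basis $y_1,\dots,y_n$ of $\mathfrak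 h$ with dual basis $x_1,\dots,x_n$ of $\mathfrak h^*$. **Clifford algebra, spinors, $\widetilde W$, $\chi$.** $V=\mathfrak h\oplus\mathfrak h^*$. $C(V)$ is the tensor algebra of $V$ modulo $x_ix_j+x_jx_i=0=y_iy_j+y_jy_i$, $x_iy_j+y_jx_i=-2\delta_{ij}$. The spinor module is $S=\wedge^\bullet\mathfrak h$, where $y\in\mathfrak h$ acts by $y\wedge\cdot$ and $x\in\mathfrak h^*$ by $x(y_{i_1}\wedge\dots\wedge y_{i_p})=2\sum_j(-1)^j\langle x,y_{i_j}\rangle y_{i_1}\wedge\dots\widehat{y_{i_j}}\dots\wedge y_{i_p}$. $\widetilde W\subset C(V)^\times$ is the group generated by the elements $\pm\mu_s$, $s\in\mathcal R$, where $\mu_s=\frac{\sqrt{\lambda_s}-1/\sqrt{\lambda_s}}{2\langle\alpha_s^\vee,\alpha_s\rangle}\alpha_s\alpha_s^\vee+\sqrt{\lambda_s}$; it is a double cover $p:\widetilde W\to W$ with kernel $\{\pm1\}$ and $p(\pm\mu_s)=s$. $\chi:\widetilde W\to\mathbb C^\times$ is the character by which $\widetilde W$ acts on $\wedge^0\mathfrak h\subset S$; it is genuine ($\chi(-1)=-1$) and $\chi^2=\det_{\mathfrak h^*}\circ p$. $\widetilde W$ acts on $M\otimes S$ by $\widetilde w\mapsto p(\widetilde w)\otimes\widetilde w$. **(Co)homology.** $H^\bullet(\mathfrak h^*,M)=\bigoplus_pH^p(\mathfrak h^*,M)$ is the cohomology of $M\otimes\wedge^\bullet\mathfrak h$ with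 $d(m\otimes\omega)=\sum_jx_jm\otimes y_j\wedge\omega$. $H_\bullet(\mathfrak h,M)=\bigoplus_pH_p(\mathfrak h,M)$ is the homology of $M\otimes\wedge^\bullet\mathfrak h$ with $\partial(m\otimes y_{i_1}\wedge\dots\wedge y_{i_p})=\sum_k(-1)^ky_{i_k}m\otimes y_{i_1}\wedge\dots\widehat{y_{i_k}}\dots\wedge y_{i_p}$. Both are $W$-modules via the diagonal action, regarded as $\widetilde W$-modules through $p$. **Dirac operator.** $D_x=\sum_ix_i\otimes y_i$, $D_y=\sum_iy_i\otimes x_i$, $D=D_x+D_y$ in $\mathbf H\otimes C(V)$, acting on $M\otimes S$ and commuting with $\widetilde W$. The Dirac cohomology is the $\widetilde W$-module $H_D(M)=\ker D/(\ker D\cap\mathrm{im}\,D)$, for $D$ acting on $M\otimes S$. "$D^2$ acts semisimply" means that $M\otimes S$ is the direct sum of the eigenspaces of $D^2$. *)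

theory Defs
  imports
    "HOL-Library.Poly_Mapping"
    "HOL-Library.Function_Algebras"
    "HOL-Algebra.Algebra"
    "Jordan_Normal_Form.Determinant"
begin

section \<open>Complex algebras given by generators and relations\<close>

text \<open>Words with concatenation, written additively so that \<open>'g word \<Rightarrow>\<^sub>0 complex\<close> with its
  convolution product is the free associative algebra on \<open>'g\<close>.\<close>

datatype 'g word = Word (letters: "'g list")

instantiation word :: (type) monoid_add
begin
definition "0 = Word []"
definition "u + v = Word (letters u @ letters v)"
instance by standard (auto simp: zero_word_def plus_word_def)
end

type_synonym 'g free = "'g word \<Rightarrow>\<^sub>0 complex"

definition free_algebra :: "'g set \<Rightarrow> 'g free ring" where
  "free_algebra G = \<lparr>carrier = {f. \<forall>w \<in> Poly_Mapping.keys f. set (letters w) \<subseteq> G},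
     monoid.mult = (*), one = 1, ring.zero = 0, ring.add = (+)\<rparr>"

definition letter :: "'g \<Rightarrow> 'g free" where
  "letter g = Poly_Mapping.single (Word [g]) 1"

definition scal :: "complex \<Rightarrow> 'g free" where
  "scal a = Poly_Mapping.single 0 a"

definition presented_algebra :: "'g set \<Rightarrow> 'g free set \<Rightarrow> 'g free set ring" where
  "presented_algebra G R = free_algebra G Quot (Idl\<^bsub>free_algebra G\<^esub> R)"

definition presented_class :: "'g set \<Rightarrow> 'g free set \<Rightarrow> 'g free \<Rightarrow> 'g free set" where
  "presented_class G R f = (Idl\<^bsub>free_algebra G\<^esub> R) +>\<^bsub>free_algebra G\<^esub> f"


section \<open>Data defining a rational Cherednik algebra\<close>

text \<open>The space \<open>\<hh>\<close> is the type \<open>'v\<close> with scalar multiplication \<open>h_scale\<close>; its dual consists of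
  the linear functionals, so that the pairing of \<open>y\<close> and \<open>\<xi>\<close> is \<open>\<xi> y\<close>. The bases \<open>y_basis\<close> and
  \<open>x_basis\<close> are indexed by \<open>{..<dim_h}\<close>.\<close>

record 'v cherednik =
  h_scale :: "complex \<Rightarrow> 'v \<Rightarrow> 'v"
  dim_h :: nat
  y_basis :: "nat \<Rightarrow> 'v"
  x_basis :: "nat \<Rightarrow> 'v \<Rightarrow> complex"
  refl_group :: "('v \<Rightarrow> 'v) set"
  root :: "('v \<Rightarrow> 'v) \<Rightarrow> 'v \<Rightarrow> complex"
  coroot :: "('v \<Rightarrow> 'v) \<Rightarrow> 'v"
  t_param :: complex
  c_param :: "('v \<Rightarrow> 'v) \<Rightarrow> complex"

definition dual :: "'v::ab_group_add cherednik \<Rightarrow> ('v \<Rightarrow> complex) set" where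
  "dual d = {\<xi>. Vector_Spaces.linear (h_scale d) (*) \<xi>}"

definition dual_action :: "('v \<Rightarrow> 'v) \<Rightarrow> ('v \<Rightarrow> complex) \<Rightarrow> ('v \<Rightarrow> complex)" where
  "dual_action w \<xi> = \<xi> \<circ> inv_into UNIV w"

definition GL :: "'v::ab_group_add cherednik \<Rightarrow> ('v \<Rightarrow> 'v) monoid" where
  "GL d = \<lparr>carrier = {g. Vector_Spaces.linear (h_scale d) (h_scale d) g \<and> bij g},
     monoid.mult = (\<circ>), one = id\<rparr>"

definition reflections :: "'v::ab_group_add cherednik \<Rightarrow> ('v \<Rightarrow> 'v) set" where
  "reflections d = {s \<in> refl_group d. vector_space.dim (h_scale d) {v. s v = v} + 1 = dim_h d}"

definition det_h :: "'v cherednik \<Rightarrow> ('v \<Rightarrow> 'v) \<Rightarrow> complex" where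
  "det_h d g = Determinant.det
     (Matrix.mat (dim_h d) (dim_h d) (\<lambda>(i, j). x_basis d i (g (y_basis d j))))"

locale cherednik_data = vector_space "h_scale d" for d :: "'v::ab_group_add cherednik" +
  assumes y_inj: "inj_on (y_basis d) {..<dim_h d}"
    and y_independent: "independent (y_basis d ` {..<dim_h d})"
    and y_span: "span (y_basis d ` {..<dim_h d}) = UNIV"
    and x_dual: "i < dim_h d \<Longrightarrow> x_basis d i \<in> dual d"
    and x_y: "i < dim_h d \<Longrightarrow> j < dim_h d \<Longrightarrow> x_basis d i (y_basis d j) = (if i = j then 1 else 0)"
    and W_subgroup: "subgroup (refl_group d) (GL d)"
    and W_finite: "finite (refl_group d)"
    and W_generated: "generate (GL d) (reflections d) = refl_group d"
    and root_dual: "s \<in> reflections d \<Longrightarrow> root d s \<in> dual d"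
    and root_nonzero: "s \<in> reflections d \<Longrightarrow> root d s \<noteq> (\<lambda>_. 0)"
    and root_vanishes: "s \<in> reflections d \<Longrightarrow> s v = v \<Longrightarrow> root d s v = 0"
    and coroot_nonzero: "s \<in> reflections d \<Longrightarrow> coroot d s \<noteq> 0"
    and coroot_vanishes:
      "s \<in> reflections d \<Longrightarrow> \<xi> \<in> dual d \<Longrightarrow> dual_action s \<xi> = \<xi> \<Longrightarrow> \<xi> (coroot d s) = 0"
    and c_invariant: "s \<in> reflections d \<Longrightarrow> w \<in> refl_group d \<Longrightarrow>
      c_param d (w \<circ> s \<circ> inv_into UNIV w) = c_param d s"


section \<open>The tensor algebra relations on \<open>V = \<hh> \<oplus> \<hh>\<^sup>*\<close>\<close>

type_synonym 'v vdual = "'v \<times> ('v \<Rightarrow> complex)"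

definition in_h :: "'v \<Rightarrow> 'v vdual" where
  "in_h y = (y, \<lambda>_. 0)"

definition in_dual :: "('v \<Rightarrow> complex) \<Rightarrow> 'v::zero vdual" where
  "in_dual \<xi> = (0, \<xi>)"

definition V_space :: "'v::ab_group_add cherednik \<Rightarrow> 'v vdual set" where
  "V_space d = UNIV \<times> dual d"

text \<open>The tensor algebra \<open>T(V)\<close> is the free algebra on the letters \<open>[v]\<close> (\<open>v \<in> V\<close>) modulo linearity
  of \<open>v \<mapsto> [v]\<close>; the map \<open>j\<close> embeds \<open>V\<close> into a possibly larger alphabet.\<close>

definition linear_relations :: "'v::ab_group_add cherednik \<Rightarrow> ('v vdual \<Rightarrow> 'g) \<Rightarrow> 'g free set" where
  "linear_relations d j =
     {letter (j (h_scale d a u + h_scale d b v, \<lambda>z. a * \<xi> z + b * \<eta> z))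
        - scal a * letter (j (u, \<xi>)) - scal b * letter (j (v, \<eta>))
      | a b u v \<xi> \<eta>. \<xi> \<in> dual d \<and> \<eta> \<in> dual d}"


section \<open>The rational Cherednik algebra and its modules\<close>

text \<open>Letters \<open>Inl v\<close> stand for \<open>v \<in> V\<close> and letters \<open>Inr w\<close> for \<open>w \<in> W\<close>. The linearity relations
  together with \<open>smash_relations\<close> present \<open>T(V) \<rtimes> \<complex>[W]\<close>.\<close>

type_synonym 'v cher_letter = "'v vdual + ('v \<Rightarrow> 'v)"

definition cher_alphabet :: "'v::ab_group_add cherednik \<Rightarrow> 'v cher_letter set" where
  "cher_alphabet d = Inl ` V_space d \<union> Inr ` refl_group d"

abbreviation Yl :: "'v \<Rightarrow> 'v cher_letter free" where
  "Yl y \<equiv> letter (Inl (in_h y))"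
abbreviation Xl :: "('v::zero \<Rightarrow> complex) \<Rightarrow> 'v cher_letter free" where
  "Xl \<xi> \<equiv> letter (Inl (in_dual \<xi>))"
abbreviation Wl :: "('v \<Rightarrow> 'v) \<Rightarrow> 'v cher_letter free" where
  "Wl w \<equiv> letter (Inr w)"

definition smash_relations :: "'v::ab_group_add cherednik \<Rightarrow> 'v cher_letter free set" where
  "smash_relations d =
     {Wl id - 1}
     \<union> {Wl w * Wl w' - Wl (w \<circ> w') | w w'. w \<in> refl_group d \<and> w' \<in> refl_group d}
     \<union> {Wl w * letter (Inl (y, \<xi>)) - letter (Inl (w y, dual_action w \<xi>)) * Wl w
        | w y \<xi>. w \<in> refl_group d \<and> \<xi> \<in> dual d}"

definition commutator_relations :: "'v::ab_group_add cherednik \<Rightarrow> 'v cher_letter free set" where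
  "commutator_relations d =
     {Xl \<xi> * Xl \<eta> - Xl \<eta> * Xl \<xi> | \<xi> \<eta>. \<xi> \<in> dual d \<and> \<eta> \<in> dual d}
     \<union> {Yl y * Yl z - Yl z * Yl y | y z. True}
     \<union> {Yl y * Xl \<xi> - Xl \<xi> * Yl y
          - (scal (t_param d * \<xi> y)
             - (\<Sum>s\<in>reflections d.
                  scal (c_param d s * (root d s y * \<xi> (coroot d s) / root d s (coroot d s))) * Wl s))
        | y \<xi>. \<xi> \<in> dual d}"

definition cherednik_relations :: "'v::ab_group_add cherednik \<Rightarrow> 'v cher_letter free set" where
  "cherednik_relations d = linear_relations d Inl \<union> smash_relations d \<union> commutator_relations d"

definition cherednik_algebra :: "'v::ab_group_add cherednik \<Rightarrow> 'v cher_letter free set ring" where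
  "cherednik_algebra d = presented_algebra (cher_alphabet d) (cherednik_relations d)"

definition cher_class ::
    "'v::ab_group_add cherednik \<Rightarrow> 'v cher_letter free \<Rightarrow> 'v cher_letter free set" where
  "cher_class d = presented_class (cher_alphabet d) (cherednik_relations d)"

definition End_ring :: "(complex \<Rightarrow> 'm \<Rightarrow> 'm) \<Rightarrow> ('m::ab_group_add \<Rightarrow> 'm) ring" where
  "End_ring sM = \<lparr>carrier = {A. Vector_Spaces.linear sM sM A},
     monoid.mult = (\<circ>), one = id, ring.zero = (\<lambda>_. 0), ring.add = (\<lambda>A B m. A m + B m)\<rparr>"

locale cherednik_module = cherednik_data d + M: vector_space sM
  for d :: "'v::ab_group_add cherednik" and sM :: "complex \<Rightarrow> 'm::ab_group_add \<Rightarrow> 'm" +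
  fixes act :: "'v cher_letter free set \<Rightarrow> 'm \<Rightarrow> 'm"
  assumes act_hom: "act \<in> Ring.ring_hom (cherednik_algebra d) (End_ring sM)"
    and act_scal: "act (cher_class d (scal a)) = sM a"


section \<open>Exterior algebra, tensor products and spinors\<close>

text \<open>With \<open>n = dim \<hh>\<close>, the exterior algebra has the basis \<open>y\<^sub>I\<close>, \<open>I \<subseteq> {..<n}\<close>, where
  \<open>y\<^sub>I = y\<^sub>i\<^sub>1 \<and> \<dots> \<and> y\<^sub>i\<^sub>p\<close> for \<open>I = {i\<^sub>1 < \<dots> < i\<^sub>p}\<close>. An element of the tensor product of \<open>M\<close> with it is
  represented by its coefficient family \<open>u\<close>, i.e. \<open>u\<close> stands for the sum of all \<open>u I \<otimes> y\<^sub>I\<close>.\<close>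

definition tensor_space :: "nat \<Rightarrow> (nat set \<Rightarrow> 'm::zero) set" where
  "tensor_space n = {u. \<forall>I. \<not> I \<subseteq> {..<n} \<longrightarrow> u I = 0}"

definition tscale :: "(complex \<Rightarrow> 'm \<Rightarrow> 'm) \<Rightarrow> complex \<Rightarrow> (nat set \<Rightarrow> 'm) \<Rightarrow> (nat set \<Rightarrow> 'm)" where
  "tscale sM a u = (\<lambda>I. sM a (u I))"

definition ext_basis :: "nat set \<Rightarrow> nat set \<Rightarrow> complex" where
  "ext_basis I = (\<lambda>J. if J = I then 1 else 0)"

definition pure_tensor ::
    "(complex \<Rightarrow> 'm \<Rightarrow> 'm) \<Rightarrow> 'm \<Rightarrow> (nat set \<Rightarrow> complex) \<Rightarrow> (nat set \<Rightarrow> 'm)" where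
  "pure_tensor sM m s = (\<lambda>J. sM (s J) m)"

text \<open>The operator \<open>A \<otimes> B\<close>, that is \<open>m \<otimes> s \<mapsto> A m \<otimes> B s\<close>.\<close>

definition tensor_op :: "nat \<Rightarrow> (complex \<Rightarrow> 'm::ab_group_add \<Rightarrow> 'm) \<Rightarrow> ('m \<Rightarrow> 'm) \<Rightarrow>
    ((nat set \<Rightarrow> complex) \<Rightarrow> (nat set \<Rightarrow> complex)) \<Rightarrow> (nat set \<Rightarrow> 'm) \<Rightarrow> (nat set \<Rightarrow> 'm)" where
  "tensor_op n sM A B u = (\<Sum>I\<in>Pow {..<n}. pure_tensor sM (A (u I)) (B (ext_basis I)))"

definition linear_extension ::
    "nat \<Rightarrow> (nat set \<Rightarrow> nat set \<Rightarrow> complex) \<Rightarrow> (nat set \<Rightarrow> complex) \<Rightarrow> (nat set \<Rightarrow> complex)" where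
  "linear_extension n b s = (\<Sum>I\<in>Pow {..<n}. tscale (*) (s I) (b I))"

definition wedge :: "'v cherednik \<Rightarrow> 'v \<Rightarrow> (nat set \<Rightarrow> complex) \<Rightarrow> (nat set \<Rightarrow> complex)" where
  "wedge d v = linear_extension (dim_h d) (\<lambda>I. \<Sum>i\<in>{..<dim_h d} - I.
     tscale (*) (x_basis d i v * (-1) ^ card {j \<in> I. j < i}) (ext_basis (insert i I)))"

text \<open>The number of \<open>j \<in> I\<close> with \<open>j \<le> i\<close> is the position, counted from \<open>1\<close>, of \<open>i\<close> in \<open>I\<close>.\<close>

definition contraction ::
    "'v cherednik \<Rightarrow> ('v \<Rightarrow> complex) \<Rightarrow> (nat set \<Rightarrow> complex) \<Rightarrow> (nat set \<Rightarrow> complex)" where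
  "contraction d \<xi> = linear_extension (dim_h d) (\<lambda>I. \<Sum>i\<in>I.
     tscale (*) ((-1) ^ card {j \<in> I. j \<le> i} * \<xi> (y_basis d i)) (ext_basis (I - {i})))"

definition exterior_map ::
    "'v cherednik \<Rightarrow> ('v \<Rightarrow> 'v) \<Rightarrow> (nat set \<Rightarrow> complex) \<Rightarrow> (nat set \<Rightarrow> complex)" where
  "exterior_map d w = linear_extension (dim_h d) (\<lambda>I.
     foldr (\<lambda>i. wedge d (w (y_basis d i))) (sorted_list_of_set I) (ext_basis {}))"


section \<open>Clifford algebra, spinor module, the double cover and its character\<close>

abbreviation Yc :: "'v \<Rightarrow> 'v vdual free" where
  "Yc y \<equiv> letter (in_h y)"
abbreviation Xc :: "('v::zero \<Rightarrow> complex) \<Rightarrow> 'v vdual free" where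
  "Xc \<xi> \<equiv> letter (in_dual \<xi>)"

definition clifford_relations :: "'v::ab_group_add cherednik \<Rightarrow> 'v vdual free set" where
  "clifford_relations d = linear_relations d id
     \<union> {Xc (x_basis d i) * Xc (x_basis d j) + Xc (x_basis d j) * Xc (x_basis d i)
        | i j. i < dim_h d \<and> j < dim_h d}
     \<union> {Yc (y_basis d i) * Yc (y_basis d j) + Yc (y_basis d j) * Yc (y_basis d i)
        | i j. i < dim_h d \<and> j < dim_h d}
     \<union> {Xc (x_basis d i) * Yc (y_basis d j) + Yc (y_basis d j) * Xc (x_basis d i)
          + scal (if i = j then 2 else 0)
        | i j. i < dim_h d \<and> j < dim_h d}"

definition clifford_algebra :: "'v::ab_group_add cherednik \<Rightarrow> 'v vdual free set ring" where
  "clifford_algebra d = presented_algebra (V_space d) (clifford_relations d)"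

definition cliff_class :: "'v::ab_group_add cherednik \<Rightarrow> 'v vdual free \<Rightarrow> 'v vdual free set" where
  "cliff_class d = presented_class (V_space d) (clifford_relations d)"

definition spin_letter ::
    "'v cherednik \<Rightarrow> 'v vdual \<Rightarrow> (nat set \<Rightarrow> complex) \<Rightarrow> (nat set \<Rightarrow> complex)" where
  "spin_letter d p s = wedge d (fst p) s + tscale (*) 2 (contraction d (snd p) s)"

definition spin_free ::
    "'v cherednik \<Rightarrow> 'v vdual free \<Rightarrow> (nat set \<Rightarrow> complex) \<Rightarrow> (nat set \<Rightarrow> complex)" where
  "spin_free d f s = (\<Sum>w\<in>Poly_Mapping.keys f.
     tscale (*) (Poly_Mapping.lookup f w) (foldr (spin_letter d) (letters w) s))"

text \<open>Elements of the Clifford algebra are cosets; on spinors the action does not depend on the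
  chosen representative.\<close>

definition spin ::
    "'v cherednik \<Rightarrow> 'v vdual free set \<Rightarrow> (nat set \<Rightarrow> complex) \<Rightarrow> (nat set \<Rightarrow> complex)" where
  "spin d a = spin_free d (SOME f. f \<in> a)"

text \<open>Replacing the principal square root by the other one replaces \<open>\<mu>\<^sub>s\<close> by \<open>-\<mu>\<^sub>s\<close>.\<close>

definition mu_rep :: "'v::ab_group_add cherednik \<Rightarrow> ('v \<Rightarrow> 'v) \<Rightarrow> 'v vdual free" where
  "mu_rep d s = (let q = csqrt (det_h d s) in
     scal ((q - 1 / q) / (2 * root d s (coroot d s))) * Xc (root d s) * Yc (coroot d s) + scal q)"

definition W_tilde :: "'v::ab_group_add cherednik \<Rightarrow> 'v vdual free set monoid" where
  "W_tilde d = subgroup_generated (units_of (clifford_algebra d))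
     (\<Union>s\<in>reflections d. {cliff_class d (mu_rep d s), cliff_class d (- mu_rep d s)})"

definition cover :: "'v::ab_group_add cherednik \<Rightarrow> 'v vdual free set \<Rightarrow> ('v \<Rightarrow> 'v)" where
  "cover d = (THE p. p \<in> hom (W_tilde d) (GL d\<lparr>carrier := refl_group d\<rparr>)
     \<and> p \<in> extensional (carrier (W_tilde d))
     \<and> (\<forall>s\<in>reflections d. p (cliff_class d (mu_rep d s)) = s \<and> p (cliff_class d (- mu_rep d s)) = s))"

definition chi :: "'v cherednik \<Rightarrow> 'v vdual free set \<Rightarrow> complex" where
  "chi d g = spin d g (ext_basis {}) {}"


section \<open>Linear representations of a group and their homomorphisms\<close>

record ('g, 'a) rep =
  rspace :: "'a set"
  radd :: "'a \<Rightarrow> 'a \<Rightarrow> 'a"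
  rscale :: "complex \<Rightarrow> 'a \<Rightarrow> 'a"
  ract :: "'g \<Rightarrow> 'a \<Rightarrow> 'a"

text \<open>The representation on \<open>Z / B\<close> for stable subspaces \<open>B \<subseteq> Z\<close>; its elements are the cosets \<open>z + B\<close>.
  Adding \<open>B\<close> after each operation matters for \<open>0 \<cdot> (z + B) = B\<close>.\<close>

definition quotient_rep :: "(complex \<Rightarrow> 'a \<Rightarrow> 'a) \<Rightarrow> ('g \<Rightarrow> 'a \<Rightarrow> 'a) \<Rightarrow>
    'a::ab_group_add set \<Rightarrow> 'a set \<Rightarrow> ('g, 'a set) rep" where
  "quotient_rep sc ac Z B = \<lparr>
     rspace = {{z + b | b. b \<in> B} | z. z \<in> Z},
     radd = (\<lambda>P Q. {u + v | u v. u \<in> P \<and> v \<in> Q}),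
     rscale = (\<lambda>a P. {sc a u + b | u b. u \<in> P \<and> b \<in> B}),
     ract = (\<lambda>g P. {ac g u + b | u b. u \<in> P \<and> b \<in> B})\<rparr>"

definition twist :: "('g \<Rightarrow> complex) \<Rightarrow> ('g, 'a) rep \<Rightarrow> ('g, 'a) rep" where
  "twist \<chi> P = P\<lparr>ract := (\<lambda>g u. rscale P (\<chi> g) (ract P g u))\<rparr>"

definition injective_rep_hom ::
    "('g, 'k) monoid_scheme \<Rightarrow> ('g, 'a) rep \<Rightarrow> ('g, 'b) rep \<Rightarrow> ('a \<Rightarrow> 'b) \<Rightarrow> bool" where
  "injective_rep_hom G P Q f \<longleftrightarrow>
     f \<in> rspace P \<rightarrow> rspace Q \<and> inj_on f (rspace P)
     \<and> (\<forall>u\<in>rspace P. \<forall>v\<in>rspace P. f (radd P u v) = radd Q (f u) (f v))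
     \<and> (\<forall>a. \<forall>u\<in>rspace P. f (rscale P a u) = rscale Q a (f u))
     \<and> (\<forall>g\<in>carrier G. \<forall>u\<in>rspace P. f (ract P g u) = ract Q g (f u))"


section \<open>Dirac operator, Dirac cohomology, and the two Koszul complexes\<close>

definition kernel_on :: "'a set \<Rightarrow> ('a \<Rightarrow> 'b::zero) \<Rightarrow> 'a set" where
  "kernel_on U T = {u \<in> U. T u = 0}"

definition x_act :: "'v::ab_group_add cherednik \<Rightarrow> ('v cher_letter free set \<Rightarrow> 'm \<Rightarrow> 'm) \<Rightarrow> nat \<Rightarrow> 'm \<Rightarrow> 'm" where
  "x_act d act i = act (cher_class d (Xl (x_basis d i)))"

definition y_act :: "'v::ab_group_add cherednik \<Rightarrow> ('v cher_letter free set \<Rightarrow> 'm \<Rightarrow> 'm) \<Rightarrow> nat \<Rightarrow> 'm \<Rightarrow> 'm" where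
  "y_act d act i = act (cher_class d (Yl (y_basis d i)))"

definition w_act :: "'v::ab_group_add cherednik \<Rightarrow> ('v cher_letter free set \<Rightarrow> 'm \<Rightarrow> 'm) \<Rightarrow> ('v \<Rightarrow> 'v) \<Rightarrow> 'm \<Rightarrow> 'm" where
  "w_act d act w = act (cher_class d (Wl w))"

definition dirac_x :: "'v::ab_group_add cherednik \<Rightarrow> (complex \<Rightarrow> 'm::ab_group_add \<Rightarrow> 'm) \<Rightarrow>
    ('v cher_letter free set \<Rightarrow> 'm \<Rightarrow> 'm) \<Rightarrow> (nat set \<Rightarrow> 'm) \<Rightarrow> (nat set \<Rightarrow> 'm)" where
  "dirac_x d sM act u = (\<Sum>i<dim_h d.
     tensor_op (dim_h d) sM (x_act d act i) (spin d (cliff_class d (Yc (y_basis d i)))) u)"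

definition dirac_y :: "'v::ab_group_add cherednik \<Rightarrow> (complex \<Rightarrow> 'm::ab_group_add \<Rightarrow> 'm) \<Rightarrow>
    ('v cher_letter free set \<Rightarrow> 'm \<Rightarrow> 'm) \<Rightarrow> (nat set \<Rightarrow> 'm) \<Rightarrow> (nat set \<Rightarrow> 'm)" where
  "dirac_y d sM act u = (\<Sum>i<dim_h d.
     tensor_op (dim_h d) sM (y_act d act i) (spin d (cliff_class d (Xc (x_basis d i)))) u)"

definition dirac :: "'v::ab_group_add cherednik \<Rightarrow> (complex \<Rightarrow> 'm::ab_group_add \<Rightarrow> 'm) \<Rightarrow>
    ('v cher_letter free set \<Rightarrow> 'm \<Rightarrow> 'm) \<Rightarrow> (nat set \<Rightarrow> 'm) \<Rightarrow> (nat set \<Rightarrow> 'm)" where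
  "dirac d sM act u = dirac_x d sM act u + dirac_y d sM act u"

definition dirac_cohomology :: "'v::ab_group_add cherednik \<Rightarrow> (complex \<Rightarrow> 'm::ab_group_add \<Rightarrow> 'm) \<Rightarrow>
    ('v cher_letter free set \<Rightarrow> 'm \<Rightarrow> 'm) \<Rightarrow> ('v vdual free set, (nat set \<Rightarrow> 'm) set) rep" where
  "dirac_cohomology d sM act =
     (let U = tensor_space (dim_h d); D = dirac d sM act
      in quotient_rep (tscale sM)
           (\<lambda>g. tensor_op (dim_h d) sM (w_act d act (cover d g)) (spin d g))
           (kernel_on U D) (kernel_on U D \<inter> D ` U))"

definition coh_diff :: "'v::ab_group_add cherednik \<Rightarrow> (complex \<Rightarrow> 'm::ab_group_add \<Rightarrow> 'm) \<Rightarrow>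
    ('v cher_letter free set \<Rightarrow> 'm \<Rightarrow> 'm) \<Rightarrow> (nat set \<Rightarrow> 'm) \<Rightarrow> (nat set \<Rightarrow> 'm)" where
  "coh_diff d sM act u =
     (\<Sum>j<dim_h d. tensor_op (dim_h d) sM (x_act d act j) (wedge d (y_basis d j)) u)"

definition hom_diff :: "'v::ab_group_add cherednik \<Rightarrow> (complex \<Rightarrow> 'm::ab_group_add \<Rightarrow> 'm) \<Rightarrow>
    ('v cher_letter free set \<Rightarrow> 'm \<Rightarrow> 'm) \<Rightarrow> (nat set \<Rightarrow> 'm) \<Rightarrow> (nat set \<Rightarrow> 'm)" where
  "hom_diff d sM act u =
     (\<Sum>j<dim_h d. tensor_op (dim_h d) sM (y_act d act j) (contraction d (x_basis d j)) u)"

text \<open>The differentials are homogeneous, so kernel modulo image on all of \<open>M \<otimes> \<And>\<hh>\<close> is the direct sum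
  of the (co)homology groups in the individual degrees.\<close>

definition total_homology ::
    "('v::ab_group_add cherednik \<Rightarrow> (complex \<Rightarrow> 'm::ab_group_add \<Rightarrow> 'm) \<Rightarrow>
      ('v cher_letter free set \<Rightarrow> 'm \<Rightarrow> 'm) \<Rightarrow> (nat set \<Rightarrow> 'm) \<Rightarrow> (nat set \<Rightarrow> 'm)) \<Rightarrow>
     'v cherednik \<Rightarrow> (complex \<Rightarrow> 'm \<Rightarrow> 'm) \<Rightarrow> ('v cher_letter free set \<Rightarrow> 'm \<Rightarrow> 'm) \<Rightarrow>
     ('v vdual free set, (nat set \<Rightarrow> 'm) set) rep" where
  "total_homology \<delta> d sM act =
     (let U = tensor_space (dim_h d)
      in quotient_rep (tscale sM)
           (\<lambda>g. tensor_op (dim_h d) sM (w_act d act (cover d g)) (exterior_map d (cover d g)))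
           (kernel_on U (\<delta> d sM act)) (\<delta> d sM act ` U))"

abbreviation "cohomology_dual \<equiv> total_homology coh_diff"
abbreviation "homology_h \<equiv> total_homology hom_diff"


section \<open>Semisimple operators\<close>

definition eigenspace_on ::
    "'a set \<Rightarrow> (complex \<Rightarrow> 'a \<Rightarrow> 'a) \<Rightarrow> ('a \<Rightarrow> 'a) \<Rightarrow> complex \<Rightarrow> 'a set" where
  "eigenspace_on U sc T z = {u \<in> U. T u = sc z u}"

definition acts_semisimply ::
    "'a::ab_group_add set \<Rightarrow> (complex \<Rightarrow> 'a \<Rightarrow> 'a) \<Rightarrow> ('a \<Rightarrow> 'a) \<Rightarrow> bool" where
  "acts_semisimply U sc T \<longleftrightarrow>
     (\<forall>u\<in>U. \<exists>!v. (\<forall>z. v z \<in> eigenspace_on U sc T z) \<and> finite {z. v z \<noteq> 0}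
        \<and> u = (\<Sum>z | v z \<noteq> 0. v z))"

end

theory Submission
  imports Defs
begin

text \<open>Write \<open>D = A + B\<close> with \<open>A\<^sup>2 = B\<^sup>2 = 0\<close>, where \<open>A\<close> raises and \<open>B\<close> lowers the exterior degree (or
  conversely, with the degree reversed). If \<open>z\<close> is a \<open>D\<close>-cycle of degree at most \<open>k\<close>, its component
  \<open>z\<^sub>k\<close> is \<open>A\<close>-closed. If \<open>z\<^sub>k = A w\<close>, semisimplicity of \<open>D\<^sup>2\<close> allows one to choose \<open>w\<close> homogeneous
  of degree \<open>k - 1\<close> and killed by \<open>D\<^sup>2\<close>, so that \<open>D w\<close> is a cycle and \<open>z - D w\<close> has smaller degree.
  Hence taking leading components embeds the graded pieces of the Dirac cohomology into the homology
  of \<open>A\<close>, and by Maschke's theorem for the finite group \<open>W\<close> these embeddings are assembled into an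
  equivariant one.

  The action of the double cover is reduced to that of \<open>W\<close> by showing that the spin action of \<open>g\<close> is
  \<open>\<chi>(g)\<close> times the exterior power of \<open>p(g)\<close>; for a reflection \<open>s v = v + b \<alpha>(v) \<alpha>\<^sup>\<or>\<close> the
  exterior power acts on \<open>\<omega>\<close> by \<open>\<omega> \<mapsto> \<omega> - b \<alpha>\<^sup>\<or> \<and> \<iota>\<^sub>\<alpha> \<omega>\<close>, a multiple of the action of \<open>\<mu>\<^sub>s\<close>.\<close>

text \<open>The obstacle is that taking a leading component is linear only for a fixed degree bound
  and depends on the representative of a Dirac class; moreover \<open>D\<^sup>2\<close> need not
  vanish, so only the part of the image of \<open>D\<close> inside its kernel is divided out. The
  induction therefore carries one linear map \<phi> on cycles of bounded degree plus boundaries. It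
  vanishes on boundaries, has \<open>A\<close>-closed values of degree at most \<open>k\<close>, and
  takes an \<open>A\<close>-exact value only on boundaries. To pass from \<open>k - 1\<close> to
  \<open>k\<close>, an equivariant map \<sigma> selects a genuine cycle of degree at most
  \<open>k\<close> modulo the previous step, and \<phi> is replaced by
  \<open>\<phi> (z - \<sigma> z) + P k (\<sigma> z)\<close>. The old summand has no component in
  degree \<open>k\<close>, so it cannot hide the new one. Averaging needs a finite group, so all
  maps are made equivariant for \<open>W\<close>; the scalar \<chi> then passes through them by
  linearity. Both embeddings come from one theorem with \<open>A\<close> and \<open>B\<close>
  exchanged.\<close>

section \<open>Sums of a raising and a lowering differential\<close>

text \<open>The composite of the quotient map from \<open>C + Y\<close> to
  \<open>(C + Y) / Y\<close> with a linear section landing in \<open>C\<close>; thus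
  \<open>C\<close> and \<open>Y\<close> may intersect. It is built on a basis of \<open>Y\<close>
  enlarged by vectors of \<open>C\<close>: the first part goes to 0, the added vectors to
  themselves.\<close>

lemma (in vector_space) sum_retraction_exists:
  assumes C: "subspace C" and Y: "subspace Y"
  shows "\<exists>\<sigma>. Vector_Spaces.linear scale scale \<sigma> \<and> range \<sigma> \<subseteq> C \<and> (\<forall>y\<in>Y. \<sigma> y = 0)
    \<and> (\<forall>x\<in>C. \<forall>y\<in>Y. (x + y) - \<sigma> (x + y) \<in> Y)"
proof -
  interpret vp: vector_space_pair scale scale ..
  obtain BY where BY: "BY \<subseteq> Y" "independent BY" "Y \<subseteq> span BY"
    using maximal_independent_subset_extend[of "{}" Y] by (auto simp: independent_empty)
  obtain B where B: "BY \<subseteq> B" "B \<subseteq> BY \<union> C" "independent B" "BY \<union> C \<subseteq> span B"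
    using maximal_independent_subset_extend[of BY "BY \<union> C"] BY by auto
  define f where "f b = (if b \<in> BY then 0 else b)" for b
  define \<sigma> where "\<sigma> = vp.construct B f"
  have lin: "Vector_Spaces.linear scale scale \<sigma>"
    unfolding \<sigma>_def using B(3) by (rule vp.linear_construct)
  interpret s: Vector_Spaces.linear scale scale \<sigma> by (rule lin)
  have \<sigma>b: "\<sigma> b = f b" if "b \<in> B" for b
    unfolding \<sigma>_def using B(3) that by (rule vp.construct_basis)
  have "range \<sigma> = span (f ` B)"
    unfolding \<sigma>_def using B(3) by (rule vp.range_construct_eq_span)
  moreover have "f ` B \<subseteq> C"
    using B(2) subspace_0[OF C] by (auto simp: f_def)
  ultimately have range: "range \<sigma> \<subseteq> C"
    using span_minimal[OF _ C] by auto
  have Y0: "\<sigma> y = 0" if "y \<in> Y" for y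
  proof -
    have "y \<in> span BY" using that BY by auto
    then show ?thesis
    proof (induction rule: span_induct_alt)
      case base then show ?case by (simp add: s.zero)
    next
      case (step c b y)
      have "\<sigma> b = 0" using step B \<sigma>b by (auto simp: f_def)
      then show ?case using step by (simp add: s.add s.scale)
    qed
  qed
  have "z - \<sigma> z \<in> Y" if "z \<in> span B" for z
    using that
  proof (induction rule: span_induct_alt)
    case base then show ?case by (simp add: s.zero subspace_0[OF Y])
  next
    case (step c b y)
    have "b - \<sigma> b \<in> Y" using step B \<sigma>b BY subspace_0[OF Y] by (auto simp: f_def)
    then have "c *s (b - \<sigma> b) + (y - \<sigma> y) \<in> Y"
      using step by (intro subspace_add[OF Y] subspace_scale[OF Y])
    then show ?case by (simp add: s.add s.scale algebra_simps)
  qed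
  moreover have "x + y \<in> span B" if "x \<in> C" "y \<in> Y" for x y
  proof (rule span_add)
    show "x \<in> span B" using that B by auto
    show "y \<in> span B" using that BY(3) span_mono[OF B(1)] by auto
  qed
  ultimately show ?thesis using lin range Y0 by blast
qed

text \<open>The operators are linear on the whole type, but the group laws hold only on
  \<open>U\<close>: a coefficient family is a function on all sets of naturals, and a tensor
  operator discards what lies outside the subsets of \<open>{..<n}\<close>.\<close>

locale finite_group_rep = vector_space sc + grp: group G
  for sc :: "complex \<Rightarrow> 'b::ab_group_add \<Rightarrow> 'b" and G :: "('g, 'k) monoid_scheme" +
  fixes U :: "'b set" and \<rho> :: "'g \<Rightarrow> 'b \<Rightarrow> 'b"
  assumes finite_G: "finite (carrier G)"
    and U: "subspace U"
    and \<rho>_linear: "g \<in> carrier G \<Longrightarrow> Vector_Spaces.linear sc sc (\<rho> g)"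
    and \<rho>_U: "g \<in> carrier G \<Longrightarrow> u \<in> U \<Longrightarrow> \<rho> g u \<in> U"
    and \<rho>_one: "u \<in> U \<Longrightarrow> \<rho> \<one>\<^bsub>G\<^esub> u = u"
    and \<rho>_mult: "g \<in> carrier G \<Longrightarrow> h \<in> carrier G \<Longrightarrow> u \<in> U \<Longrightarrow> \<rho> (g \<otimes>\<^bsub>G\<^esub> h) u = \<rho> g (\<rho> h u)"
begin

definition stable :: "'b set \<Rightarrow> bool" where
  "stable C \<longleftrightarrow> subspace C \<and> C \<subseteq> U \<and> (\<forall>g\<in>carrier G. \<forall>x\<in>C. \<rho> g x \<in> C)"

text \<open>Maschke's averaging argument.\<close>

lemma equivariant_sum_retraction:
  assumes C: "stable C" and Y: "stable Y"
  shows "\<exists>\<sigma>. Vector_Spaces.linear sc sc \<sigma> \<and> range \<sigma> \<subseteq> C \<and> (\<forall>y\<in>Y. \<sigma> y = 0)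
    \<and> (\<forall>x\<in>C. \<forall>y\<in>Y. (x + y) - \<sigma> (x + y) \<in> Y)
    \<and> (\<forall>g\<in>carrier G. \<forall>u\<in>U. \<sigma> (\<rho> g u) = \<rho> g (\<sigma> u))"
proof -
  have sX: "subspace C" and sY: "subspace Y" and XU: "C \<subseteq> U" and YU: "Y \<subseteq> U"
    using C Y by (auto simp: stable_def)
  obtain \<tau> where lin: "Vector_Spaces.linear sc sc \<tau>" and range: "range \<tau> \<subseteq> C"
    and Y0: "\<forall>y\<in>Y. \<tau> y = 0" and diff: "\<forall>x\<in>C. \<forall>y\<in>Y. (x + y) - \<tau> (x + y) \<in> Y"
    using sum_retraction_exists[OF sX sY] by blast
  interpret t: Vector_Spaces.linear sc sc \<tau> by (rule lin)
  define N where "N = complex_of_nat (card (carrier G))"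
  have N: "N \<noteq> 0" using finite_G grp.one_closed by (auto simp: N_def)
  define \<sigma> where "\<sigma> z = sc (1 / N) (\<Sum>g\<in>carrier G. \<rho> g (\<tau> (\<rho> (inv\<^bsub>G\<^esub> g) z)))" for z
  have lin': "Vector_Spaces.linear sc sc (\<lambda>z. \<rho> g (\<tau> (\<rho> (inv\<^bsub>G\<^esub> g) z)))" if "g \<in> carrier G" for g
  proof -
    have "Vector_Spaces.linear sc sc (\<rho> g \<circ> (\<tau> \<circ> \<rho> (inv\<^bsub>G\<^esub> g)))"
      using that by (intro Vector_Spaces.linear_compose[OF _ \<rho>_linear] Vector_Spaces.linear_compose[OF _ lin] \<rho>_linear) auto
    then show ?thesis by (simp add: o_def)
  qed
  interpret vp: vector_space_pair sc sc ..
  have "Vector_Spaces.linear sc sc \<sigma>"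
    unfolding \<sigma>_def
    using lin' by (intro vp.linear_compose_scale_right vp.linear_compose_sum) auto
  moreover have "range \<sigma> \<subseteq> C"
    unfolding \<sigma>_def using C range
    by (auto simp: stable_def intro!: subspace_scale[OF sX] subspace_sum[OF sX])
  moreover have "\<sigma> y = 0" if "y \<in> Y" for y
  proof -
    have "\<rho> g (\<tau> (\<rho> (inv\<^bsub>G\<^esub> g) y)) = 0" if "g \<in> carrier G" for g
    proof -
      interpret r: Vector_Spaces.linear sc sc "\<rho> g" using that by (rule \<rho>_linear)
      have "\<rho> (inv\<^bsub>G\<^esub> g) y \<in> Y" using \<open>y \<in> Y\<close> that Y by (auto simp: stable_def)
      then show ?thesis using Y0 by (simp add: r.zero)
    qed
    then show ?thesis by (simp add: \<sigma>_def)
  qed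
  moreover have "z - \<sigma> z \<in> Y" if "x \<in> C" "y \<in> Y" and z: "z = x + y" for x y z
  proof -
    have zU: "z \<in> U" using that XU YU subspace_add[OF U] by auto
    \<comment> \<open>Each conjugate of \<tau> has the property on its own, because \<open>C\<close>
      and \<open>Y\<close> are stable; the average then inherits it.\<close>
    have *: "z - \<rho> g (\<tau> (\<rho> (inv\<^bsub>G\<^esub> g) z)) \<in> Y" if g: "g \<in> carrier G" for g
    proof -
      interpret r: Vector_Spaces.linear sc sc "\<rho> g" using that by (rule \<rho>_linear)
      interpret r': Vector_Spaces.linear sc sc "\<rho> (inv\<^bsub>G\<^esub> g)" using that by (intro \<rho>_linear) auto
      define v where "v = \<rho> (inv\<^bsub>G\<^esub> g) z"
      have "v = \<rho> (inv\<^bsub>G\<^esub> g) x + \<rho> (inv\<^bsub>G\<^esub> g) y" by (simp add: v_def z r'.add)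
      then have "v - \<tau> v \<in> Y" using diff that \<open>x \<in> C\<close> \<open>y \<in> Y\<close> C Y by (auto simp: stable_def)
      then have "\<rho> g (v - \<tau> v) \<in> Y" using g Y by (auto simp: stable_def)
      moreover have "\<rho> g v = z"
        using g zU by (simp add: v_def \<rho>_mult[symmetric] \<rho>_one)
      ultimately show ?thesis by (simp add: r.diff v_def)
    qed
    have "z - \<sigma> z = sc (1 / N) (\<Sum>g\<in>carrier G. z - \<rho> g (\<tau> (\<rho> (inv\<^bsub>G\<^esub> g) z)))"
      using N by (simp add: sum_subtractf \<sigma>_def scale_right_diff_distrib sum_constant_scale N_def)
    also have "\<dots> \<in> Y" using * by (intro subspace_scale[OF sY] subspace_sum[OF sY]) auto
    finally show ?thesis .
  qed
  moreover have "\<sigma> (\<rho> h u) = \<rho> h (\<sigma> u)" if h: "h \<in> carrier G" and u: "u \<in> U" for h u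
  proof -
    interpret r: Vector_Spaces.linear sc sc "\<rho> h" using h by (rule \<rho>_linear)
    \<comment> \<open>The sum is reindexed by \<open>g = h k\<close>; then
      \<open>g\<^sup>-\<^sup>1 h = k\<^sup>-\<^sup>1\<close>, and a factor \<open>\<rho> h\<close>
      comes out in front.\<close>
    have "(\<Sum>g\<in>carrier G. \<rho> g (\<tau> (\<rho> (inv\<^bsub>G\<^esub> g) (\<rho> h u))))
        = (\<Sum>k\<in>carrier G. \<rho> (h \<otimes>\<^bsub>G\<^esub> k) (\<tau> (\<rho> (inv\<^bsub>G\<^esub> (h \<otimes>\<^bsub>G\<^esub> k)) (\<rho> h u))))"
      by (rule sum.reindex_bij_witness[where i = "\<lambda>k. h \<otimes>\<^bsub>G\<^esub> k" and j = "\<lambda>g. inv\<^bsub>G\<^esub> h \<otimes>\<^bsub>G\<^esub> g"])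
        (use h in \<open>auto simp: grp.m_assoc[symmetric]\<close>)
    also have "\<dots> = (\<Sum>k\<in>carrier G. \<rho> h (\<rho> k (\<tau> (\<rho> (inv\<^bsub>G\<^esub> k) u))))"
    proof (rule sum.cong[OF refl])
      fix k assume k: "k \<in> carrier G"
      have "\<rho> (inv\<^bsub>G\<^esub> (h \<otimes>\<^bsub>G\<^esub> k)) (\<rho> h u) = \<rho> (inv\<^bsub>G\<^esub> (h \<otimes>\<^bsub>G\<^esub> k) \<otimes>\<^bsub>G\<^esub> h) u"
        using h k u by (simp add: \<rho>_mult)
      also have "inv\<^bsub>G\<^esub> (h \<otimes>\<^bsub>G\<^esub> k) \<otimes>\<^bsub>G\<^esub> h = inv\<^bsub>G\<^esub> k"
        using h k by (simp add: grp.inv_mult_group grp.m_assoc)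
      finally show "\<rho> (h \<otimes>\<^bsub>G\<^esub> k) (\<tau> (\<rho> (inv\<^bsub>G\<^esub> (h \<otimes>\<^bsub>G\<^esub> k)) (\<rho> h u)))
          = \<rho> h (\<rho> k (\<tau> (\<rho> (inv\<^bsub>G\<^esub> k) u)))"
        \<comment> \<open>\<open>\<rho>_mult\<close> is available only on \<open>U\<close>, and
          \<tau> takes its values in \<open>C\<close>, which lies in \<open>U\<close>.\<close>
        using h k range XU by (simp add: \<rho>_mult image_subset_iff subset_iff)
    qed
    finally show ?thesis by (simp add: \<sigma>_def r.sum r.scale)
  qed
  ultimately show ?thesis by blast
qed

end

text \<open>The grading is by the integers so that a differential of degree \<open>-1\<close> can be treated by
  reversing it; \<open>P k\<close> is the projection to degree \<open>k\<close>.\<close>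

locale graded_dirac = finite_group_rep sc G U \<rho>
  for sc :: "complex \<Rightarrow> 'b::ab_group_add \<Rightarrow> 'b" and G :: "('g, 'k) monoid_scheme" and U \<rho> +
  fixes A B :: "'b \<Rightarrow> 'b" and P :: "int \<Rightarrow> 'b \<Rightarrow> 'b" and lo :: int and N :: nat
  assumes A_linear: "Vector_Spaces.linear sc sc A" and B_linear: "Vector_Spaces.linear sc sc B"
    and P_linear: "Vector_Spaces.linear sc sc (P k)"
    and A_U: "u \<in> U \<Longrightarrow> A u \<in> U" and B_U: "u \<in> U \<Longrightarrow> B u \<in> U" and P_U: "u \<in> U \<Longrightarrow> P k u \<in> U"
    and A_A: "u \<in> U \<Longrightarrow> A (A u) = 0" and B_B: "u \<in> U \<Longrightarrow> B (B u) = 0"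
    and P_P: "P k (P l u) = (if k = l then P k u else 0)"
    and P_A: "u \<in> U \<Longrightarrow> P (k + 1) (A u) = A (P k u)" and P_B: "u \<in> U \<Longrightarrow> P k (B u) = B (P (k + 1) u)"
    and P_eqI: "u \<in> U \<Longrightarrow> (\<And>k. P k u = 0) \<Longrightarrow> u = 0"
    and P_bounded: "u \<in> U \<Longrightarrow> k \<le> lo \<or> k > lo + int N \<Longrightarrow> P k u = 0"
    and \<rho>_A: "g \<in> carrier G \<Longrightarrow> u \<in> U \<Longrightarrow> \<rho> g (A u) = A (\<rho> g u)"
    and \<rho>_B: "g \<in> carrier G \<Longrightarrow> u \<in> U \<Longrightarrow> \<rho> g (B u) = B (\<rho> g u)"
    and \<rho>_P: "g \<in> carrier G \<Longrightarrow> u \<in> U \<Longrightarrow> \<rho> g (P k u) = P k (\<rho> g u)"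
    and semisimple: "acts_semisimply U sc ((\<lambda>u. A u + B u) \<circ> (\<lambda>u. A u + B u))"
begin

definition D where "D u = A u + B u"

sublocale A: Vector_Spaces.linear sc sc A by (rule A_linear)
sublocale B: Vector_Spaces.linear sc sc B by (rule B_linear)
sublocale P: Vector_Spaces.linear sc sc "P k" for k by (rule P_linear)

lemma D_linear: "Vector_Spaces.linear sc sc D"
proof -
  interpret vp: vector_space_pair sc sc ..
  show ?thesis unfolding D_def using A_linear B_linear by (rule vp.linear_compose_add)
qed

sublocale D: Vector_Spaces.linear sc sc D by (rule D_linear)

lemma D_U: "u \<in> U \<Longrightarrow> D u \<in> U"
  by (simp add: D_def A_U B_U subspace_add[OF U])

lemma D_D: "u \<in> U \<Longrightarrow> D (D u) = A (B u) + B (A u)"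
  by (simp add: D_def A.add B.add A_A B_B)

lemma A_D_D: "u \<in> U \<Longrightarrow> A (D (D u)) = D (D (A u))"
  by (simp add: D_D A_U B_U A.add A_A A.zero B.zero)

text \<open>\<open>D\<^sup>2 = A B + B A\<close>, and both products preserve the degree. This is
  what allows a preimage under \<open>A\<close> to be cut down to a single degree.\<close>

lemma P_D_D:
  assumes "u \<in> U" shows "P k (D (D u)) = D (D (P k u))"
proof -
  have "P k (A (B u)) = A (B (P k u))"
    using P_A[of "B u" "k - 1"] P_B[of u "k - 1"] assms by (simp add: B_U)
  moreover have "P k (B (A u)) = B (A (P k u))"
    using P_B[of "A u" k] P_A[of u "k"] assms by (simp add: A_U)
  ultimately show ?thesis using assms by (simp add: D_D P_U P.add)
qed

text \<open>The component of \<open>w\<close> in the \<open>0\<close>-eigenspace of \<open>D\<^sup>2\<close> has the required property.\<close>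

lemma A_preimage_in_kernel:
  assumes w: "w \<in> U" and zero: "D (D (A w)) = 0"
  shows "\<exists>w'\<in>U. D (D w') = 0 \<and> A w' = A w"
proof -
  let ?E = "\<lambda>z. eigenspace_on U sc (D \<circ> D) z"
  have ss: "acts_semisimply U sc (D \<circ> D)"
  proof -
    have "D \<circ> D = (\<lambda>u. A u + B u) \<circ> (\<lambda>u. A u + B u)" by (auto simp: D_def)
    then show ?thesis using semisimple by simp
  qed
  obtain v where v: "\<And>z. v z \<in> ?E z" "finite {z. v z \<noteq> 0}" "w = (\<Sum>z | v z \<noteq> 0. v z)"
    using ss w unfolding acts_semisimply_def by blast
  \<comment> \<open>Two eigenvector decompositions of \<open>A w\<close> are compared: the image
    under \<open>A\<close> of that of \<open>w\<close>, as \<open>A\<close> commutes with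
    \<open>D\<^sup>2\<close>, and the one concentrated at eigenvalue 0. Uniqueness identifies them
    at 0.\<close>
  define a where "a z = A (v z)" for z
  define b where "b z = (if z = 0 then A w else 0)" for z :: complex
  have Aw: "A w \<in> U" using w by (rule A_U)
  have aE: "a z \<in> ?E z" for z
  proof -
    have "v z \<in> U" "D (D (v z)) = sc z (v z)" using v(1)[of z] by (auto simp: eigenspace_on_def)
    then show ?thesis
      using A_D_D[of "v z"] by (auto simp: a_def eigenspace_on_def A_U A.scale)
  qed
  have bE: "b z \<in> ?E z" for z
    using Aw zero by (auto simp: b_def eigenspace_on_def subspace_0[OF U] D.zero)
  have sub: "{z. a z \<noteq> 0} \<subseteq> {z. v z \<noteq> 0}"
    by (auto simp: a_def A.zero)
  have "A w = (\<Sum>z | v z \<noteq> 0. a z)"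
    unfolding a_def by (subst v(3)) (rule A.sum)
  also have "\<dots> = (\<Sum>z | a z \<noteq> 0. a z)"
    using sub v(2) by (intro sum.mono_neutral_right) auto
  finally have a_sum: "A w = (\<Sum>z | a z \<noteq> 0. a z)" .
  have "{z. b z \<noteq> 0} = (if A w = 0 then {} else {0})" by (auto simp: b_def)
  then have b_sum: "A w = (\<Sum>z | b z \<noteq> 0. b z)" and b_fin: "finite {z. b z \<noteq> 0}"
    by (auto simp: b_def)
  have "\<exists>!v. (\<forall>z. v z \<in> ?E z) \<and> finite {z. v z \<noteq> 0} \<and> A w = (\<Sum>z | v z \<noteq> 0. v z)"
    using ss Aw unfolding acts_semisimply_def by blast
  then have "a = b"
    using aE bE a_sum b_sum b_fin finite_subset[OF sub v(2)] by blast
  then have "A (v 0) = A w" by (metis a_def b_def)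
  moreover have "v 0 \<in> U" "D (D (v 0)) = 0" using v(1)[of 0] by (auto simp: eigenspace_on_def)
  ultimately show ?thesis by blast
qed

section \<open>The degree filtration on cycles and the induction along it\<close>

definition cycles where "cycles = {u \<in> U. D u = 0}"
definition bounds where "bounds = cycles \<inter> D ` U"
definition cycles_upto :: "int \<Rightarrow> 'b set" where
  "cycles_upto k = {u \<in> cycles. \<forall>j>k. P j u = 0}"
text \<open>The cycles whose Dirac class has a representative of degree at most \<open>k\<close>;
  dividing by \<open>bounds\<close> gives the degree filtration of Dirac cohomology.\<close>

definition filtration :: "int \<Rightarrow> 'b set" where
  "filtration k = {x + y | x y. x \<in> cycles_upto k \<and> y \<in> bounds}"

lemma \<rho>_D: "g \<in> carrier G \<Longrightarrow> u \<in> U \<Longrightarrow> \<rho> g (D u) = D (\<rho> g u)"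
  by (simp add: D_def \<rho>_A \<rho>_B module_hom.add[OF \<rho>_linear[unfolded module_hom_iff_linear[symmetric]]])

lemma \<rho>_zero: "g \<in> carrier G \<Longrightarrow> \<rho> g 0 = 0"
  by (simp add: module_hom.zero[OF \<rho>_linear[unfolded module_hom_iff_linear[symmetric]]])

lemma \<rho>_add: "g \<in> carrier G \<Longrightarrow> \<rho> g (u + v) = \<rho> g u + \<rho> g v"
  by (simp add: module_hom.add[OF \<rho>_linear[unfolded module_hom_iff_linear[symmetric]]])

lemma stable_cycles_upto: "stable (cycles_upto k)"
  unfolding stable_def
proof (intro conjI ballI)
  show "subspace (cycles_upto k)"
    by (rule subspaceI) (auto simp: cycles_upto_def cycles_def D.zero D.add D.scale P.zero P.add P.scale
        subspace_0[OF U] subspace_add[OF U] subspace_scale[OF U])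
  show "cycles_upto k \<subseteq> U" by (auto simp: cycles_upto_def cycles_def)
  show "\<rho> g x \<in> cycles_upto k" if "g \<in> carrier G" "x \<in> cycles_upto k" for g x
    using that by (auto simp: cycles_upto_def cycles_def \<rho>_U \<rho>_D[symmetric] \<rho>_P[symmetric] \<rho>_zero)
qed

text \<open>With the preimage named and restricted to the kernel of \<open>D\<^sup>2\<close>,
  closure properties of boundaries follow from linearity and equivariance of
  \<open>D\<close>.\<close>

lemma bounds_eq: "bounds = {D u | u. u \<in> U \<and> D (D u) = 0}"
  by (auto simp: bounds_def cycles_def D_U)

lemma stable_bounds: "stable bounds"
  unfolding stable_def
proof (intro conjI ballI)
  show "subspace bounds"
  proof (rule subspaceI)
    show "0 \<in> bounds"
      using D.zero subspace_0[OF U] unfolding bounds_eq by force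
    show "x + y \<in> bounds" if xy: "x \<in> bounds" "y \<in> bounds" for x y
    proof -
      obtain u v where "x = D u" "y = D v" "u \<in> U" "v \<in> U" "D (D u) = 0" "D (D v) = 0"
        using xy unfolding bounds_eq by auto
      then have "x + y = D (u + v)" "u + v \<in> U" "D (D (u + v)) = 0"
        using subspace_add[OF U] by (auto simp: D.add)
      then show ?thesis unfolding bounds_eq by blast
    qed
    show "sc c x \<in> bounds" if x: "x \<in> bounds" for c x
    proof -
      obtain u where "x = D u" "u \<in> U" "D (D u) = 0" using x unfolding bounds_eq by auto
      then have "sc c x = D (sc c u)" "sc c u \<in> U" "D (D (sc c u)) = 0"
        using subspace_scale[OF U] by (auto simp: D.scale)
      then show ?thesis unfolding bounds_eq by blast
    qed
  qed
  show "bounds \<subseteq> U" by (auto simp: bounds_def cycles_def)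
  show "\<rho> g x \<in> bounds" if gx: "g \<in> carrier G" "x \<in> bounds" for g x
  proof -
    obtain u where u: "x = D u" "u \<in> U" "D (D u) = 0" using gx unfolding bounds_eq by auto
    then have "\<rho> g x = D (\<rho> g u)" "\<rho> g u \<in> U" "D (D (\<rho> g u)) = 0"
      using gx \<rho>_D[of g "D u"] \<rho>_D[of g u] \<rho>_zero by (auto simp: \<rho>_U D_U)
    then show ?thesis unfolding bounds_eq by blast
  qed
qed

lemma stable_filtration: "stable (filtration k)"
  unfolding stable_def
proof (intro conjI ballI)
  note Z = stable_cycles_upto[of k, unfolded stable_def]
  note B = stable_bounds[unfolded stable_def]
  show "subspace (filtration k)"
    unfolding filtration_def using Z B by (intro subspace_sums) auto
  show "filtration k \<subseteq> U"
    using Z B subspace_add[OF U] unfolding filtration_def by blast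
  show "\<rho> g x \<in> filtration k" if "g \<in> carrier G" "x \<in> filtration k" for g x
    using that Z B by (auto simp: filtration_def \<rho>_add) blast
qed

text \<open>The induction invariant: \<phi> induces an equivariant injection of
  \<open>filtration k\<close> modulo \<open>bounds\<close> into the homology of \<open>A\<close>.
  Vanishing on \<open>bounds\<close> makes the induced map well defined, the clause on the image of
  \<open>A\<close> makes it injective, and the degree bound lets the next step separate its leading
  term from \<phi>.\<close>

definition good :: "int \<Rightarrow> ('b \<Rightarrow> 'b) \<Rightarrow> bool" where
  "good k \<phi> \<longleftrightarrow> Vector_Spaces.linear sc sc \<phi>
     \<and> (\<forall>z\<in>filtration k. \<phi> z \<in> U \<and> A (\<phi> z) = 0 \<and> (\<forall>j>k. P j (\<phi> z) = 0)
          \<and> (\<phi> z \<in> A ` U \<longrightarrow> z \<in> bounds) \<and> (\<forall>g\<in>carrier G. \<phi> (\<rho> g z) = \<rho> g (\<phi> z)))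
     \<and> (\<forall>z\<in>bounds. \<phi> z = 0)"

text \<open>\<open>A\<close> shifts degrees by one, so its image is a graded subspace and exactness
  can be tested on the top component.\<close>

lemma A_image_P: "x \<in> A ` U \<Longrightarrow> P k x \<in> A ` U"
  using P_A[of _ "k - 1"] P_U by (auto simp: image_iff)

text \<open>In degree \<open>k + 1\<close> the equation \<open>D z = 0\<close> involves only
  \<open>A\<close> of the component in degree \<open>k\<close> and \<open>B\<close> of the component
  in degree \<open>k + 2\<close>; the latter is zero by the degree bound.\<close>

lemma leading_closed:
  assumes "z \<in> cycles_upto k" shows "A (P k z) = 0"
proof -
  have z: "z \<in> U" "D z = 0" "P (k + 2) z = 0" using assms by (auto simp: cycles_upto_def cycles_def)
  have "P (k + 1) (D z) = A (P k z) + B (P (k + 2) z)"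
    using z(1) P_B[OF z(1), of "k + 1"] by (simp add: D_def P.add P_A add.assoc)
  then show ?thesis using z by (simp add: P.zero B.zero)
qed

lemma leading_exact:
  assumes z: "z \<in> cycles_upto k" and ex: "P k z \<in> A ` U"
  shows "z \<in> filtration (k - 1)"
proof -
  have zU: "z \<in> U" and Dz: "D z = 0" and Pz: "\<And>j. j > k \<Longrightarrow> P j z = 0"
    using z by (auto simp: cycles_upto_def cycles_def)
  obtain w where w: "w \<in> U" "P k z = A w" using ex by auto
  have "D (D (A w)) = 0"
    using P_D_D[OF zU, of k] w Dz by (simp add: D.zero P.zero)
  then obtain w' where w': "w' \<in> U" "D (D w') = 0" "A w' = A w"
    using A_preimage_in_kernel[OF w(1)] by blast
  \<comment> \<open>Cutting \<open>w'\<close> down to degree \<open>k - 1\<close> keeps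
    \<open>D (D v) = 0\<close> and \<open>A v = P k z\<close>, and leaves \<open>D v\<close> with
    components in degrees \<open>k\<close> and \<open>k - 2\<close> only.\<close>
  define v where "v = P (k - 1) w'"
  have v: "v \<in> U" "D (D v) = 0"
    using w' by (auto simp: v_def P_U P_D_D[symmetric] P.zero)
  have Av: "A v = P k z"
    using P_A[OF w'(1), of "k - 1"] w w' P_P[of k k z] by (simp add: v_def)
  have "P j (z - D v) = 0" if "j > k - 1" for j
  proof -
    have "P j (D v) = A (P (j - 1) v) + B (P (j + 1) v)"
      using v P_A[of v "j - 1"] by (simp add: D_def P.add P_B)
    also have "\<dots> = (if j = k then P k z else 0)"
      using that Av by (auto simp: v_def P_P A.zero B.zero)
    finally show ?thesis using that Pz by (auto simp: P.diff)
  qed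
  then have "z - D v \<in> cycles_upto (k - 1)"
    using zU v Dz by (auto simp: cycles_upto_def cycles_def D.diff D_U subspace_diff[OF U])
  moreover have "D v \<in> bounds" using v unfolding bounds_eq by blast
  moreover have "z = (z - D v) + D v" by simp
  ultimately show ?thesis unfolding filtration_def by blast
qed

lemma cycles_upto_subset_filtration: "cycles_upto k \<subseteq> filtration k"
  using subspace_0[of bounds] stable_bounds unfolding filtration_def stable_def by force

lemma good_step:
  assumes "good (k - 1) \<phi>" shows "\<exists>\<psi>. good k \<psi>"
proof -
  let ?F = "filtration (k - 1)"
  obtain \<sigma> where \<sigma>: "Vector_Spaces.linear sc sc \<sigma>" "range \<sigma> \<subseteq> cycles_upto k"
    and \<sigma>': "\<forall>y\<in>?F. \<sigma> y = 0"
      "\<forall>x\<in>cycles_upto k. \<forall>y\<in>?F. (x + y) - \<sigma> (x + y) \<in> ?F"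
      "\<forall>g\<in>carrier G. \<forall>u\<in>U. \<sigma> (\<rho> g u) = \<rho> g (\<sigma> u)"
    using equivariant_sum_retraction[OF stable_cycles_upto stable_filtration, of k "k - 1"] by blast
  note \<sigma>0 = \<sigma>'(1)[rule_format] and \<sigma>d = \<sigma>'(2)[rule_format] and \<sigma>\<rho> = \<sigma>'(3)[rule_format]
  have \<phi>: "Vector_Spaces.linear sc sc \<phi>"
    and \<phi>b: "\<And>z. z \<in> bounds \<Longrightarrow> \<phi> z = 0"
    and \<phi>F: "\<And>z. z \<in> ?F \<Longrightarrow> \<phi> z \<in> U \<and> A (\<phi> z) = 0 \<and> (\<forall>j>k - 1. P j (\<phi> z) = 0)
          \<and> (\<phi> z \<in> A ` U \<longrightarrow> z \<in> bounds)"
    and \<phi>\<rho>: "\<And>z g. z \<in> ?F \<Longrightarrow> g \<in> carrier G \<Longrightarrow> \<phi> (\<rho> g z) = \<rho> g (\<phi> z)"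
    using assms unfolding good_def by - (elim conjE, (assumption | drule (1) bspec | elim conjE | intro conjI)+)
  interpret s: Vector_Spaces.linear sc sc \<sigma> by (rule \<sigma>(1))
  interpret f: Vector_Spaces.linear sc sc \<phi> by (rule \<phi>)
  have bF: "bounds \<subseteq> ?F"
    using stable_cycles_upto subspace_0[of "cycles_upto (k - 1)"]
    by (force simp: filtration_def stable_def)
  have F: "subspace ?F" "?F \<subseteq> U" using stable_filtration by (auto simp: stable_def)
  have Z: "subspace (cycles_upto k)" "cycles_upto k \<subseteq> U" using stable_cycles_upto by (auto simp: stable_def)
  have \<sigma>Z: "\<sigma> z \<in> cycles_upto k" for z using \<sigma>(2) by auto
  have \<sigma>F: "z - \<sigma> z \<in> ?F" if "z \<in> filtration k" for z
  proof -
    obtain x y where "x \<in> cycles_upto k" "y \<in> bounds" "z = x + y"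
      using \<open>z \<in> filtration k\<close> by (auto simp: filtration_def)
    then show ?thesis using \<sigma>d bF by blast
  qed
  \<comment> \<open>\<open>\<sigma> z\<close> is a cycle of degree at most \<open>k\<close>, so its
    component in degree \<open>k\<close> is closed; \<open>z - \<sigma> z\<close> lies in the
    previous step, where \<phi> is controlled.\<close>
  define \<psi> where "\<psi> z = \<phi> (z - \<sigma> z) + P k (\<sigma> z)" for z
  have "Vector_Spaces.linear sc sc \<psi>"
    by unfold_locales (auto simp: \<psi>_def f.add f.diff f.scale s.add s.scale P.add P.scale scale_right_distrib
        scale_right_diff_distrib)
  moreover have "\<psi> z = 0" if "z \<in> bounds" for z
    using that \<phi>b \<sigma>0 bF by (auto simp: \<psi>_def P.zero)
  moreover have "\<psi> z \<in> U \<and> A (\<psi> z) = 0 \<and> (\<forall>j>k. P j (\<psi> z) = 0)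
          \<and> (\<psi> z \<in> A ` U \<longrightarrow> z \<in> bounds) \<and> (\<forall>g\<in>carrier G. \<psi> (\<rho> g z) = \<rho> g (\<psi> z))"
    if z: "z \<in> filtration k" for z
  proof (intro conjI impI allI ballI)
    have zU: "z \<in> U" using z stable_filtration by (auto simp: stable_def)
    have sU: "\<sigma> z \<in> U" using \<sigma>Z Z by auto
    note 1 = \<phi>F[OF \<sigma>F[OF z]]
    show "\<psi> z \<in> U" using 1 sU by (simp add: \<psi>_def subspace_add[OF U] P_U)
    show "A (\<psi> z) = 0" using 1 leading_closed[OF \<sigma>Z] by (simp add: \<psi>_def A.add)
    show "P j (\<psi> z) = 0" if "j > k" for j
      using 1 that by (simp add: \<psi>_def P.add P_P)
    show "\<psi> (\<rho> g z) = \<rho> g (\<psi> z)" if "g \<in> carrier G" for g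
    proof -
      have "\<rho> g z - \<rho> g (\<sigma> z) = \<rho> g (z - \<sigma> z)"
        by (simp add: module_hom.diff[OF \<rho>_linear[unfolded module_hom_iff_linear[symmetric]]] that)
      then show ?thesis
        using that zU sU \<sigma>F[OF z] by (simp add: \<psi>_def \<sigma>\<rho> \<rho>_add \<phi>\<rho> \<rho>_P)
    qed
    show "z \<in> bounds" if ex: "\<psi> z \<in> A ` U"
    proof -
      \<comment> \<open>\<phi> contributes nothing in degree \<open>k\<close>, so exactness of
        \<open>\<psi> z\<close> forces exactness of the leading component of
        \<open>\<sigma> z\<close>. Then \<open>leading_exact\<close> puts \<open>z\<close> into the
        previous step, where \<sigma> vanishes and \<psi> agrees with \<phi>.\<close>
      have "P k (\<psi> z) = P k (\<sigma> z)"
        using 1 by (simp add: \<psi>_def P.add P_P)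
      then have "P k (\<sigma> z) \<in> A ` U" using A_image_P[OF ex, of k] by simp
      then have "\<sigma> z \<in> ?F" using leading_exact[OF \<sigma>Z] by blast
      then have zF: "z \<in> ?F" using \<sigma>F[OF z] subspace_add[OF F(1)] by fastforce
      then have "\<psi> z = \<phi> z" by (simp add: \<psi>_def \<sigma>0 P.zero)
      then show ?thesis using ex \<phi>F[OF zF] by simp
    qed
  qed
  ultimately have "good k \<psi>" unfolding good_def by blast
  then show ?thesis by blast
qed

lemma good_exists: "\<exists>\<phi>. good (lo + int m) \<phi>"
proof (induction m)
  case 0
  \<comment> \<open>Degrees start above \<open>lo\<close>, so a cycle without components above
    \<open>lo\<close> is zero. The filtration begins at \<open>bounds\<close>, where the zero map
    satisfies the invariant.\<close>
  have "cycles_upto lo \<subseteq> {0}"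
  proof
    fix u assume u: "u \<in> cycles_upto lo"
    have "P k u = 0" for k
      using u P_bounded[of u k] by (cases "k \<le> lo") (auto simp: cycles_upto_def cycles_def)
    then show "u \<in> {0}" using u P_eqI by (auto simp: cycles_upto_def cycles_def)
  qed
  then have *: "filtration lo \<subseteq> bounds"
    by (auto simp: filtration_def)
  have "good lo (\<lambda>_. 0)"
    unfolding good_def
  proof (intro conjI)
    show "Vector_Spaces.linear sc sc (\<lambda>_. 0)" by unfold_locales auto
  qed (use * subspace_0[OF U] in \<open>auto simp: A.zero P.zero \<rho>_zero\<close>)
  then show ?case by auto
next
  case (Suc m)
  then show ?case using good_step[of "lo + int (Suc m)"] by auto
qed

text \<open>In degree \<open>lo + N\<close> the filtration exhausts the cycles, so the invariant
  there concerns all of Dirac cohomology.\<close>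

theorem dirac_embedding:
  "\<exists>\<phi>. Vector_Spaces.linear sc sc \<phi>
     \<and> (\<forall>z\<in>cycles. \<phi> z \<in> U \<and> A (\<phi> z) = 0 \<and> (\<phi> z \<in> A ` U \<longleftrightarrow> z \<in> bounds)
          \<and> (\<forall>g\<in>carrier G. \<phi> (\<rho> g z) = \<rho> g (\<phi> z)))"
proof -
  obtain \<phi> where \<phi>: "good (lo + int N) \<phi>" using good_exists by blast
  have "cycles \<subseteq> cycles_upto (lo + int N)"
    using P_bounded by (auto simp: cycles_upto_def cycles_def)
  then have "cycles \<subseteq> filtration (lo + int N)"
    using cycles_upto_subset_filtration by blast
  moreover have "0 \<in> A ` U" using subspace_0[OF U] A.zero by (metis imageI)
  ultimately show ?thesis using \<phi> unfolding good_def by (intro exI[of _ \<phi>]) auto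
qed

end

section \<open>Quotient representations\<close>

definition coset_of :: "'b::ab_group_add set \<Rightarrow> 'b \<Rightarrow> 'b set" where
  "coset_of B z = {z + b | b. b \<in> B}"

context vector_space
begin

lemma coset_of_eq_iff:
  assumes "subspace B" shows "coset_of B y = coset_of B z \<longleftrightarrow> y - z \<in> B"
proof
  assume "coset_of B y = coset_of B z"
  moreover have "y \<in> coset_of B y" using subspace_0[OF assms] by (force simp: coset_of_def)
  ultimately show "y - z \<in> B" by (auto simp: coset_of_def)
next
  have sub: "coset_of B u \<subseteq> coset_of B v" if "u - v \<in> B" for u v
  proof
    fix x assume "x \<in> coset_of B u"
    then obtain b where "b \<in> B" "x = u + b" by (auto simp: coset_of_def)
    then have "x = v + ((u - v) + b)" "(u - v) + b \<in> B" using that subspace_add[OF assms] by auto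
    then show "x \<in> coset_of B v" unfolding coset_of_def by blast
  qed
  assume "y - z \<in> B"
  moreover from this have "z - y \<in> B" using subspace_neg[OF assms] by fastforce
  ultimately show "coset_of B y = coset_of B z" using sub by blast
qed

text \<open>One computation serves \<open>rscale\<close> and \<open>ract\<close>. The summand from
  \<open>B\<close> fills up the coset when \<open>h\<close> does not map \<open>B\<close> onto
  itself, for instance when \<open>h\<close> is multiplication by 0.\<close>

lemma coset_of_image:
  assumes B: "subspace B" and add: "\<And>u v. h (u + v) = h u + h v" and h: "\<And>b. b \<in> B \<Longrightarrow> h b \<in> B"
  shows "{h u + b | u b. u \<in> coset_of B z \<and> b \<in> B} = coset_of B (h z)"
proof (intro equalityI subsetI)
  fix x assume "x \<in> {h u + b | u b. u \<in> coset_of B z \<and> b \<in> B}"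
  then obtain b b' where "b \<in> B" "b' \<in> B" "x = h z + (h b' + b)"
    by (auto simp: coset_of_def add add.assoc)
  then show "x \<in> coset_of B (h z)" using h subspace_add[OF B] by (auto simp: coset_of_def)
next
  fix x assume "x \<in> coset_of B (h z)"
  moreover have "z \<in> coset_of B z" using subspace_0[OF B] by (force simp: coset_of_def)
  ultimately show "x \<in> {h u + b | u b. u \<in> coset_of B z \<and> b \<in> B}"
    unfolding coset_of_def[of B "h z"] by blast
qed

lemma coset_of_add:
  assumes B: "subspace B"
  shows "{u + v | u v. u \<in> coset_of B y \<and> v \<in> coset_of B z} = coset_of B (y + z)"
proof (intro equalityI subsetI)
  fix x assume "x \<in> {u + v | u v. u \<in> coset_of B y \<and> v \<in> coset_of B z}"
  then obtain b b' where "b \<in> B" "b' \<in> B" "x = (y + z) + (b + b')"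
    by (auto simp: coset_of_def algebra_simps)
  then show "x \<in> coset_of B (y + z)" using subspace_add[OF B] by (auto simp: coset_of_def)
next
  fix x assume "x \<in> coset_of B (y + z)"
  then obtain b where "b \<in> B" "x = (y + b) + (z + 0)" by (auto simp: coset_of_def algebra_simps)
  then show "x \<in> {u + v | u v. u \<in> coset_of B y \<and> v \<in> coset_of B z}"
    using subspace_0[OF B] unfolding coset_of_def by blast
qed

end

text \<open>The equivalence \<open>\<phi>B\<close>, applied to differences of elements of
  \<open>Z\<close>, says both that the induced map on cosets is well defined and that it is
  injective.\<close>

lemma quotient_rep_embedding:
  fixes sc :: "complex \<Rightarrow> 'a::ab_group_add \<Rightarrow> 'a"
  assumes "vector_space sc"
    and Z: "module.subspace sc Z" and B: "module.subspace sc B" and B': "module.subspace sc B'"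
    and \<phi>: "Vector_Spaces.linear sc sc \<phi>"
    and \<phi>Z: "\<And>z. z \<in> Z \<Longrightarrow> \<phi> z \<in> Z'" and \<phi>B: "\<And>z. z \<in> Z \<Longrightarrow> \<phi> z \<in> B' \<longleftrightarrow> z \<in> B"
    and ac: "\<And>g. g \<in> carrier G \<Longrightarrow> Vector_Spaces.linear sc sc (ac g)"
      "\<And>g. g \<in> carrier G \<Longrightarrow> Vector_Spaces.linear sc sc (ac' g)"
    and acZ: "\<And>g z. g \<in> carrier G \<Longrightarrow> z \<in> Z \<Longrightarrow> ac g z \<in> Z"
    and acB: "\<And>g z. g \<in> carrier G \<Longrightarrow> z \<in> B \<Longrightarrow> ac g z \<in> B"
    and acB': "\<And>g z. g \<in> carrier G \<Longrightarrow> z \<in> B' \<Longrightarrow> ac' g z \<in> B'"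
    and eqv: "\<And>g z. g \<in> carrier G \<Longrightarrow> z \<in> Z \<Longrightarrow> \<phi> (ac g z) = sc (\<chi> g) (ac' g (\<phi> z))"
  shows "\<exists>f. injective_rep_hom G (quotient_rep sc ac Z B) (twist \<chi> (quotient_rep sc ac' Z' B')) f"
proof -
  interpret vector_space sc by fact
  interpret f: Vector_Spaces.linear sc sc \<phi> by fact
  define f where "f S = coset_of B' (\<phi> (SOME z. z \<in> Z \<and> S = coset_of B z))" for S
  have f: "f (coset_of B z) = coset_of B' (\<phi> z)" if z: "z \<in> Z" for z
  proof -
    define y where "y = (SOME y. y \<in> Z \<and> coset_of B z = coset_of B y)"
    have y: "y \<in> Z" "coset_of B z = coset_of B y"
      unfolding y_def using someI[of "\<lambda>y. y \<in> Z \<and> coset_of B z = coset_of B y" z] z by auto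
    then have "y - z \<in> B" by (metis coset_of_eq_iff[OF B])
    then have "\<phi> (y - z) \<in> B'" using \<phi>B[of "y - z"] subspace_diff[OF Z] y z by simp
    then show ?thesis unfolding f_def y_def[symmetric] by (simp add: coset_of_eq_iff[OF B'] f.diff)
  qed
  have sp: "rspace (quotient_rep sc ac Z B) = coset_of B ` Z" for ac Z B
    by (auto simp: quotient_rep_def coset_of_def)
  have add: "radd (quotient_rep sc ac Z B) (coset_of B u) (coset_of B v) = coset_of B (u + v)"
    if "subspace B" for ac Z B u v
    using coset_of_add[OF that] by (simp add: quotient_rep_def)
  have scl: "rscale (quotient_rep sc ac Z B) a (coset_of B u) = coset_of B (sc a u)"
    if "subspace B" for ac Z B u a
    using coset_of_image[OF that, of "sc a"] subspace_scale[OF that]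
    by (simp add: quotient_rep_def scale_right_distrib)
  have act: "ract (quotient_rep sc ac Z B) g (coset_of B u) = coset_of B (ac g u)"
    if "subspace B" "\<And>z. z \<in> B \<Longrightarrow> ac g z \<in> B" "Vector_Spaces.linear sc sc (ac g)" for ac Z B u g
  proof -
    interpret a: Vector_Spaces.linear sc sc "ac g" by fact
    show ?thesis using coset_of_image[OF that(1), of "ac g"] that(2) by (simp add: quotient_rep_def a.add)
  qed
  have "injective_rep_hom G (quotient_rep sc ac Z B) (twist \<chi> (quotient_rep sc ac' Z' B')) f"
    unfolding injective_rep_hom_def
  proof (intro conjI ballI allI)
    show "f \<in> rspace (quotient_rep sc ac Z B) \<rightarrow> rspace (twist \<chi> (quotient_rep sc ac' Z' B'))"
      using \<phi>Z by (auto simp: twist_def sp f)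
    show "inj_on f (rspace (quotient_rep sc ac Z B))"
    proof (rule inj_onI)
      fix S T assume "S \<in> rspace (quotient_rep sc ac Z B)" "T \<in> rspace (quotient_rep sc ac Z B)"
      then obtain y z where yz: "y \<in> Z" "z \<in> Z" "S = coset_of B y" "T = coset_of B z" by (auto simp: sp)
      assume "f S = f T"
      then have "\<phi> (y - z) \<in> B'" using yz by (simp add: f coset_of_eq_iff[OF B'] f.diff)
      then show "S = T" using yz \<phi>B[of "y - z"] subspace_diff[OF Z] by (simp add: coset_of_eq_iff[OF B])
    qed
  next
    fix S T assume "S \<in> rspace (quotient_rep sc ac Z B)" "T \<in> rspace (quotient_rep sc ac Z B)"
    then obtain y z where yz: "y \<in> Z" "z \<in> Z" "S = coset_of B y" "T = coset_of B z" by (auto simp: sp)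
    show "f (radd (quotient_rep sc ac Z B) S T) = radd (twist \<chi> (quotient_rep sc ac' Z' B')) (f S) (f T)"
      using yz B B' by (simp add: twist_def f add f.add subspace_add[OF Z])
  next
    fix S a assume "S \<in> rspace (quotient_rep sc ac Z B)"
    then obtain y where yz: "y \<in> Z" "S = coset_of B y" by (auto simp: sp)
    show "f (rscale (quotient_rep sc ac Z B) a S) = rscale (twist \<chi> (quotient_rep sc ac' Z' B')) a (f S)"
      using yz B B' by (simp add: twist_def f scl f.scale subspace_scale[OF Z])
  next
    fix g S assume g: "g \<in> carrier G" and "S \<in> rspace (quotient_rep sc ac Z B)"
    then obtain y where yz: "y \<in> Z" "S = coset_of B y" by (auto simp: sp)
    show "f (ract (quotient_rep sc ac Z B) g S) = ract (twist \<chi> (quotient_rep sc ac' Z' B')) g (f S)"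
      using yz g B B' by (simp add: twist_def f act acB acB' ac acZ eqv scl)
  qed
  then show ?thesis by blast
qed

context graded_dirac
begin

lemma stable_cycles: "stable cycles"
proof -
  have "cycles = cycles_upto (lo + int N)"
    using P_bounded by (auto simp: cycles_upto_def cycles_def)
  then show ?thesis using stable_cycles_upto by simp
qed

lemma stable_A_image: "stable (A ` U)"
  unfolding stable_def
proof (intro conjI ballI)
  show "subspace (A ` U)" by (rule A.subspace_image[OF U])
  show "A ` U \<subseteq> U" using A_U by blast
  show "\<rho> g x \<in> A ` U" if "g \<in> carrier G" "x \<in> A ` U" for g x
    using that \<rho>_A \<rho>_U by auto
qed

text \<open>Averaging has been done over \<open>G\<close>. Since \<open>H\<close> acts through
  \<open>p\<close> up to the scalar \<chi>, equivariance for \<open>G\<close> and linearity give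
  compatibility with the twisted action. In the application \<open>H\<close> is the double cover and
  \<open>G\<close> is \<open>W\<close>.\<close>

theorem quotient_embedding:
  assumes p: "\<And>h. h \<in> carrier H \<Longrightarrow> p h \<in> carrier G"
    and ac: "\<And>h u. h \<in> carrier H \<Longrightarrow> ac h u = sc (\<chi> h) (\<rho> (p h) u)"
  shows "\<exists>f. injective_rep_hom H (quotient_rep sc ac cycles bounds)
    (twist \<chi> (quotient_rep sc (\<lambda>h. \<rho> (p h)) {u \<in> U. A u = 0} (A ` U))) f"
proof -
  interpret vp: vector_space_pair sc sc ..
  obtain \<phi> where \<phi>: "Vector_Spaces.linear sc sc \<phi>"
    and \<phi>c: "\<forall>z\<in>cycles. \<phi> z \<in> U \<and> A (\<phi> z) = 0 \<and> (\<phi> z \<in> A ` U \<longleftrightarrow> z \<in> bounds)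
          \<and> (\<forall>g\<in>carrier G. \<phi> (\<rho> g z) = \<rho> g (\<phi> z))"
    using dirac_embedding by blast
  interpret f: Vector_Spaces.linear sc sc \<phi> by (rule \<phi>)
  have Z: "subspace cycles" and B: "subspace bounds" and B': "subspace (A ` U)"
    using stable_cycles stable_bounds stable_A_image by (auto simp: stable_def)
  show ?thesis
  proof (rule quotient_rep_embedding[OF vector_space_axioms Z B B' \<phi>])
    show "\<phi> z \<in> {u \<in> U. A u = 0}" if "z \<in> cycles" for z using \<phi>c that by blast
    show "\<phi> z \<in> A ` U \<longleftrightarrow> z \<in> bounds" if "z \<in> cycles" for z using \<phi>c that by blast
    fix h assume h: "h \<in> carrier H"
    show "Vector_Spaces.linear sc sc (ac h)"
      using vp.linear_compose_scale_right[OF \<rho>_linear[OF p[OF h]], of "\<chi> h"] by (simp add: ac[OF h, abs_def])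
    show "Vector_Spaces.linear sc sc (\<rho> (p h))" by (rule \<rho>_linear[OF p[OF h]])
    show "ac h z \<in> cycles" if "z \<in> cycles" for z
      using stable_cycles that p[OF h] subspace_scale[OF Z] by (simp add: ac[OF h] stable_def)
    show "ac h z \<in> bounds" if "z \<in> bounds" for z
      using stable_bounds that p[OF h] subspace_scale[OF B] by (simp add: ac[OF h] stable_def)
    show "\<rho> (p h) z \<in> A ` U" if "z \<in> A ` U" for z
      using stable_A_image that p[OF h] unfolding stable_def by blast
    show "\<phi> (ac h z) = sc (\<chi> h) (\<rho> (p h) (\<phi> z))" if "z \<in> cycles" for z
      using \<phi>c that p[OF h] by (simp add: ac[OF h] f.scale)
  qed
qed

end

section \<open>Algebras given by generators and relations\<close>

lemma carrier_free_algebra: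
  "f \<in> carrier (free_algebra G) \<longleftrightarrow> (\<forall>w\<in>Poly_Mapping.keys f. set (letters w) \<subseteq> G)"
  by (simp add: free_algebra_def)

lemma free_algebra_simps [simp]:
  "f \<otimes>\<^bsub>free_algebra G\<^esub> g = f * g" "\<one>\<^bsub>free_algebra G\<^esub> = 1"
  "f \<oplus>\<^bsub>free_algebra G\<^esub> g = f + g" "\<zero>\<^bsub>free_algebra G\<^esub> = 0"
  by (simp_all add: free_algebra_def)

lemma keys_uminus: "Poly_Mapping.keys (- f) = Poly_Mapping.keys (f :: 'a \<Rightarrow>\<^sub>0 'b::ab_group_add)"
  by (auto simp: in_keys_iff)

lemma carrier_free_algebra_add:
  "f \<in> carrier (free_algebra G) \<Longrightarrow> g \<in> carrier (free_algebra G) \<Longrightarrow> f + g \<in> carrier (free_algebra G)"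
  using Poly_Mapping.keys_add[of f g] by (auto simp: carrier_free_algebra)

lemma carrier_free_algebra_uminus:
  "f \<in> carrier (free_algebra G) \<Longrightarrow> - f \<in> carrier (free_algebra G)"
  by (simp add: carrier_free_algebra keys_uminus)

lemma carrier_free_algebra_diff:
  "f \<in> carrier (free_algebra G) \<Longrightarrow> g \<in> carrier (free_algebra G) \<Longrightarrow> f - g \<in> carrier (free_algebra G)"
  using carrier_free_algebra_add[of f G "- g"] carrier_free_algebra_uminus[of g G] by simp

lemma carrier_free_algebra_mult:
  "f \<in> carrier (free_algebra G) \<Longrightarrow> g \<in> carrier (free_algebra G) \<Longrightarrow> f * g \<in> carrier (free_algebra G)"
  using Poly_Mapping.keys_mult[of f g] by (fastforce simp: carrier_free_algebra plus_word_def)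

lemma carrier_free_algebra_scal: "scal a \<in> carrier (free_algebra G)"
  by (auto simp: carrier_free_algebra scal_def zero_word_def)

lemma carrier_free_algebra_letter: "x \<in> G \<Longrightarrow> letter x \<in> carrier (free_algebra G)"
  by (auto simp: carrier_free_algebra letter_def)

lemma scal_one: "scal 1 = 1" and scal_zero: "scal 0 = 0"
  by (simp_all add: scal_def)

lemma scal_add: "scal (a + b) = scal a + scal b"
  by (simp add: scal_def Poly_Mapping.single_add)

lemma scal_mult: "scal a * scal b = scal (a * b)"
  by (simp add: scal_def Poly_Mapping.mult_single)

lemma carrier_free_algebra_zero: "0 \<in> carrier (free_algebra G)"
  by (simp add: carrier_free_algebra)

lemma carrier_free_algebra_one: "1 \<in> carrier (free_algebra G)"
  using carrier_free_algebra_scal[of 1 G] by (simp add: scal_one)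

lemma carrier_free_algebra_sum:
  "(\<And>i. i \<in> C \<Longrightarrow> f i \<in> carrier (free_algebra G)) \<Longrightarrow> (\<Sum>i\<in>C. f i) \<in> carrier (free_algebra G)"
  by (induction C rule: infinite_finite_induct) (auto simp: carrier_free_algebra_zero carrier_free_algebra_add)

lemmas free_algebra_closed = carrier_free_algebra_add carrier_free_algebra_uminus
  carrier_free_algebra_diff carrier_free_algebra_mult carrier_free_algebra_scal
  carrier_free_algebra_letter carrier_free_algebra_zero carrier_free_algebra_one carrier_free_algebra_sum

lemma ring_free_algebra: "ring (free_algebra G)"
proof (rule ringI)
  show "abelian_group (free_algebra G)"
  proof (rule abelian_groupI)
    fix x assume "x \<in> carrier (free_algebra G)"
    then show "\<exists>y\<in>carrier (free_algebra G). y \<oplus>\<^bsub>free_algebra G\<^esub> x = \<zero>\<^bsub>free_algebra G\<^esub>"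
      by (intro bexI[of _ "- x"]) (auto simp: free_algebra_closed)
  qed (auto simp: free_algebra_closed algebra_simps)
  show "Group.monoid (free_algebra G)"
    by (rule Group.monoidI) (auto simp: free_algebra_closed algebra_simps)
qed (auto simp: algebra_simps)

text \<open>The additive inverse of a ring record is described inside its carrier, so it is compared
  with the type class operation for elements of the carrier.\<close>

lemma a_minus_free_algebra:
  assumes "g \<in> carrier (free_algebra G)"
  shows "f \<ominus>\<^bsub>free_algebra G\<^esub> g = f - g"
proof -
  interpret ring "free_algebra G" by (rule ring_free_algebra)
  have "\<ominus>\<^bsub>free_algebra G\<^esub> g = - g"
    using minus_equality[of "- g" g] assms by (simp add: free_algebra_closed)
  then show ?thesis by (simp add: a_minus_def)
qed

locale presentation =
  fixes G :: "'g set" and R :: "'g free set"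
  assumes relations_closed: "R \<subseteq> carrier (free_algebra G)"
begin

abbreviation "Fr \<equiv> free_algebra G"
abbreviation "cl \<equiv> presented_class G R"
abbreviation "Q \<equiv> presented_algebra G R"

definition J :: "'g free set" where "J = Idl\<^bsub>Fr\<^esub> R"

sublocale Fr: ring Fr by (rule ring_free_algebra)

lemma ideal_J: "ideal J Fr"
  unfolding J_def by (rule Fr.genideal_ideal[OF relations_closed])

lemma relation_in_J: "r \<in> R \<Longrightarrow> r \<in> J"
  unfolding J_def using Fr.genideal_self[OF relations_closed] by blast

lemma Q_eq: "Q = Fr Quot J" and cl_eq: "cl f = J +>\<^bsub>Fr\<^esub> f"
  by (simp_all add: presented_algebra_def presented_class_def J_def)

lemma ring_Q: "ring Q"
  unfolding Q_eq by (rule ideal.quotient_is_ring[OF ideal_J])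

lemma cl_hom: "cl \<in> Ring.ring_hom Fr Q"
proof -
  have "cl = (\<lambda>f. J +>\<^bsub>Fr\<^esub> f)" by (rule ext) (rule cl_eq)
  then show ?thesis unfolding Q_eq using ideal.rcos_ring_hom[OF ideal_J] by simp
qed

lemma cl_closed: "f \<in> carrier Fr \<Longrightarrow> cl f \<in> carrier Q"
  by (rule ring_hom_closed[OF cl_hom])

lemma cl_mult: "f \<in> carrier Fr \<Longrightarrow> g \<in> carrier Fr \<Longrightarrow> cl (f * g) = cl f \<otimes>\<^bsub>Q\<^esub> cl g"
  using ring_hom_mult[OF cl_hom, of f g] by simp

lemma cl_add: "f \<in> carrier Fr \<Longrightarrow> g \<in> carrier Fr \<Longrightarrow> cl (f + g) = cl f \<oplus>\<^bsub>Q\<^esub> cl g"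
  using ring_hom_add[OF cl_hom, of f g] by simp

lemma cl_one: "cl 1 = \<one>\<^bsub>Q\<^esub>"
  using ring_hom_one[OF cl_hom] by simp

lemma cl_eq_iff:
  assumes "f \<in> carrier Fr" "g \<in> carrier Fr"
  shows "cl f = cl g \<longleftrightarrow> f - g \<in> J"
  using Fr.quotient_eq_iff_same_a_r_cos[OF ideal_J assms] assms
  by (simp add: cl_eq a_minus_free_algebra)

lemma cl_eq_if_relation:
  "f - g \<in> R \<Longrightarrow> f \<in> carrier Fr \<Longrightarrow> g \<in> carrier Fr \<Longrightarrow> cl f = cl g"
  using cl_eq_iff relation_in_J by blast

lemma J_minimal: "ideal I Fr \<Longrightarrow> R \<subseteq> I \<Longrightarrow> J \<subseteq> I"
  unfolding J_def by (rule Fr.genideal_minimal)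

lemma self_in_cl: "f \<in> carrier Fr \<Longrightarrow> f \<in> cl f"
  unfolding cl_eq by (rule abelian_subgroup.a_rcos_self[OF abelian_subgroupI3[OF ideal.axioms(1)[OF ideal_J] Fr.is_abelian_group]])

lemma mem_clD:
  assumes f: "f \<in> carrier Fr" and g: "g \<in> cl f" shows "g - f \<in> J" "g \<in> carrier Fr"
proof -
  obtain j where "j \<in> J" "g = j + f" using g by (auto simp: cl_eq a_r_coset_def r_coset_def)
  then show "g - f \<in> J" "g \<in> carrier Fr"
    using f ideal.Icarr[OF ideal_J] by (auto simp: free_algebra_closed)
qed

lemma carrier_Q_obtain:
  assumes "a \<in> carrier Q" obtains f where "f \<in> carrier Fr" "a = cl f"
  using assms unfolding Q_eq FactRing_def A_RCOSETS_def' cl_eq by auto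

text \<open>Calculations in the quotient are done with the congruence modulo \<open>J\<close>, where the operations
  are those of the type class.\<close>

definition cong_J (infix "\<doteq>" 50) where "f \<doteq> g \<longleftrightarrow> f - g \<in> J \<and> f \<in> carrier Fr \<and> g \<in> carrier Fr"

lemma J_zero: "0 \<in> J" and J_add: "f \<in> J \<Longrightarrow> g \<in> J \<Longrightarrow> f + g \<in> J" and J_uminus: "f \<in> J \<Longrightarrow> - f \<in> J"
  and J_mult_left: "h \<in> carrier Fr \<Longrightarrow> f \<in> J \<Longrightarrow> h * f \<in> J"
  and J_mult_right: "h \<in> carrier Fr \<Longrightarrow> f \<in> J \<Longrightarrow> f * h \<in> J"
proof -
  interpret ideal J Fr by (rule ideal_J)
  show "0 \<in> J" "f \<in> J \<Longrightarrow> g \<in> J \<Longrightarrow> f + g \<in> J" using zero_closed a_closed[of f g] by auto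
  show l: "h \<in> carrier Fr \<Longrightarrow> f \<in> J \<Longrightarrow> h * f \<in> J" for h using I_l_closed[of f h] by simp
  show "h \<in> carrier Fr \<Longrightarrow> f \<in> J \<Longrightarrow> f * h \<in> J" using I_r_closed[of f h] by simp
  show "f \<in> J \<Longrightarrow> - f \<in> J" using l[of "- 1"] by (simp add: free_algebra_closed)
qed

lemma cong_refl: "f \<in> carrier Fr \<Longrightarrow> f \<doteq> f"
  by (simp add: cong_J_def J_zero)

lemma cong_trans [trans]: "f \<doteq> g \<Longrightarrow> g \<doteq> h \<Longrightarrow> f \<doteq> h"
  using J_add[of "f - g" "g - h"] by (simp add: cong_J_def)

lemma cong_add: "f \<doteq> f' \<Longrightarrow> g \<doteq> g' \<Longrightarrow> f + g \<doteq> f' + g'"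
  using J_add[of "f - f'" "g - g'"] by (simp add: cong_J_def free_algebra_closed algebra_simps)

lemma cong_mult: "f \<doteq> f' \<Longrightarrow> g \<doteq> g' \<Longrightarrow> f * g \<doteq> f' * g'"
  using J_add[of "f * (g - g')" "(f - f') * g'"] J_mult_left[of f "g - g'"] J_mult_right[of g' "f - f'"]
  by (auto simp: cong_J_def free_algebra_closed algebra_simps)

lemma cong_sum: "(\<And>i. i \<in> C \<Longrightarrow> f i \<doteq> g i) \<Longrightarrow> (\<Sum>i\<in>C. f i) \<doteq> (\<Sum>i\<in>C. g i)"
  by (induction C rule: infinite_finite_induct) (auto intro!: cong_add cong_refl simp: free_algebra_closed)

lemma cl_eq_cong: "f \<doteq> g \<Longrightarrow> cl f = cl g"
  by (simp add: cong_J_def cl_eq_iff)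

end

section \<open>Exterior multiplication and contraction\<close>

lemma sum_fun_apply: "(\<Sum>i\<in>C. f i) x = (\<Sum>i\<in>C. f i x)"
  by (induction C rule: infinite_finite_induct) auto

lemma vector_space_tscale:
  assumes "vector_space sM" shows "vector_space (tscale sM)"
proof -
  interpret vector_space sM by fact
  show ?thesis
    by unfold_locales (auto simp: tscale_def fun_eq_iff scale_right_distrib scale_left_distrib)
qed

lemma vector_space_complex: "vector_space ((*) :: complex \<Rightarrow> complex \<Rightarrow> complex)"
  by unfold_locales (auto simp: algebra_simps)

abbreviation cscale :: "complex \<Rightarrow> (nat set \<Rightarrow> complex) \<Rightarrow> (nat set \<Rightarrow> complex)" where
  "cscale \<equiv> tscale (*)"

abbreviation spinor_linear :: "((nat set \<Rightarrow> complex) \<Rightarrow> nat set \<Rightarrow> complex) \<Rightarrow> bool" where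
  "spinor_linear \<equiv> Vector_Spaces.linear cscale cscale"

interpretation spinors: vector_space cscale
  by (rule vector_space_tscale[OF vector_space_complex])

interpretation spinor_pair: vector_space_pair cscale cscale ..

lemma cscale_apply [simp]: "cscale a s I = a * s I"
  by (simp add: tscale_def)

lemma spinor_linearI:
  assumes "\<And>s t. F (s + t) = F s + F t" "\<And>a s. F (cscale a s) = cscale a (F s)"
  shows "spinor_linear F"
  using assms by unfold_locales auto

lemma spinor_linearD:
  assumes "spinor_linear F"
  shows "F (s + t) = F s + F t" "F (cscale a s) = cscale a (F s)" "F 0 = 0" "F (- s) = - F s" "F (s - t) = F s - F t"
    "F (\<Sum>i\<in>C. f i) = (\<Sum>i\<in>C. F (f i))"
proof -
  interpret Vector_Spaces.linear cscale cscale F by fact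
  show "F (s + t) = F s + F t" "F (cscale a s) = cscale a (F s)" "F 0 = 0" "F (- s) = - F s" "F (s - t) = F s - F t"
    "F (\<Sum>i\<in>C. f i) = (\<Sum>i\<in>C. F (f i))"
    by (rule add scale zero neg diff sum)+
qed

lemma subspace_tensor_space:
  assumes "vector_space sM" shows "module.subspace (tscale sM) (tensor_space n)"
proof -
  interpret M: vector_space sM by fact
  interpret vector_space "tscale sM" by (rule vector_space_tscale) fact
  show ?thesis by (rule subspaceI) (auto simp: tensor_space_def tscale_def)
qed

lemmas subspace_spinors = subspace_tensor_space[OF vector_space_complex]

lemma ext_basis_in_tensor_space: "I \<subseteq> {..<n} \<Longrightarrow> ext_basis I \<in> tensor_space n"
  by (auto simp: tensor_space_def ext_basis_def)

lemma spinor_expansion: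
  assumes "s \<in> tensor_space n"
  shows "s = (\<Sum>I\<in>Pow {..<n}. cscale (s I) (ext_basis I))"
proof
  fix J
  have "(\<Sum>I\<in>Pow {..<n}. cscale (s I) (ext_basis I)) J = (\<Sum>I\<in>Pow {..<n}. if I = J then s J else 0)"
    unfolding sum_fun_apply by (rule sum.cong) (auto simp: ext_basis_def)
  then show "s J = (\<Sum>I\<in>Pow {..<n}. cscale (s I) (ext_basis I)) J"
    using assms by (auto simp: tensor_space_def)
qed

lemma spinor_linear_expansion:
  assumes "spinor_linear F" "s \<in> tensor_space n"
  shows "F s = (\<Sum>I\<in>Pow {..<n}. cscale (s I) (F (ext_basis I)))"
  by (subst spinor_expansion[OF assms(2)]) (simp add: spinor_linearD[OF assms(1)])

lemma spinor_linear_eqI: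
  assumes "spinor_linear F" "spinor_linear F'" "s \<in> tensor_space n"
    and "\<And>I. I \<subseteq> {..<n} \<Longrightarrow> F (ext_basis I) = F' (ext_basis I)"
  shows "F s = F' s"
  using assms by (simp add: spinor_linear_expansion[of _ s n])

lemma spinor_linear_stable:
  assumes "spinor_linear F" "s \<in> tensor_space n"
    and "\<And>I. I \<subseteq> {..<n} \<Longrightarrow> F (ext_basis I) \<in> tensor_space n"
  shows "F s \<in> tensor_space n"
  unfolding spinor_linear_expansion[OF assms(1,2)]
  using assms(3) by (intro spinors.subspace_sum[OF subspace_spinors] spinors.subspace_scale[OF subspace_spinors]) auto

lemma spinor_linear_compose:
  "spinor_linear F \<Longrightarrow> spinor_linear F' \<Longrightarrow> spinor_linear (\<lambda>s. F (F' s))"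
  using Vector_Spaces.linear_compose[of cscale cscale F' cscale F] by (simp add: o_def)

lemma spinor_linear_linear_extension: "spinor_linear (linear_extension n b)"
  by (rule spinor_linearI)
    (auto simp: linear_extension_def fun_eq_iff sum_fun_apply sum.distrib sum_distrib_left algebra_simps)

lemma linear_extension_basis:
  assumes "I \<subseteq> {..<n}" shows "linear_extension n b (ext_basis I) = b I"
proof
  fix J
  have "linear_extension n b (ext_basis I) J = (\<Sum>K\<in>Pow {..<n}. if K = I then b I J else 0)"
    unfolding linear_extension_def sum_fun_apply by (rule sum.cong) (auto simp: ext_basis_def)
  then show "linear_extension n b (ext_basis I) J = b I J" using assms by simp
qed

lemma spinor_double:
  fixes s :: "nat set \<Rightarrow> complex" assumes "s = - s" shows "s = 0"
proof
  fix I show "s I = 0 I" using fun_cong[OF assms, of I] by (simp add: eq_neg_iff_add_eq_0)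
qed

section \<open>Coefficient formulas and signs\<close>

definition koszul_sign :: "nat \<Rightarrow> nat set \<Rightarrow> complex" where
  "koszul_sign i I = (-1) ^ card {j \<in> I. j < i}"

lemma koszul_sign_insert:
  assumes "finite I" "j \<notin> I"
  shows "koszul_sign i (insert j I) = (if j < i then - koszul_sign i I else koszul_sign i I)"
proof -
  have "{k \<in> insert j I. k < i} = (if j < i then insert j {k \<in> I. k < i} else {k \<in> I. k < i})"
    by auto
  then show ?thesis using assms by (simp add: koszul_sign_def)
qed

lemma koszul_sign_square: "koszul_sign i I * koszul_sign i I = 1"
  by (simp add: koszul_sign_def power_mult_distrib[symmetric])

text \<open>The coefficient at \<open>J\<close> of the basis vector \<open>y\<^sub>i\<close> wedged
  with \<open>s\<close>; only \<open>J - {i}\<close> contributes. Working at one coefficient reduces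
  the exterior relations to comparisons of signs.\<close>

definition wedge_at :: "nat \<Rightarrow> nat \<Rightarrow> (nat set \<Rightarrow> complex) \<Rightarrow> (nat set \<Rightarrow> complex)" where
  "wedge_at n i s J = (if i \<in> J \<and> J \<subseteq> {..<n} then koszul_sign i J * s (J - {i}) else 0)"

text \<open>The minus sign reflects that positions are counted from 1: the removed index
  \<open>i\<close> is itself among the indices at most \<open>i\<close>.\<close>

definition contract_at :: "nat \<Rightarrow> nat \<Rightarrow> (nat set \<Rightarrow> complex) \<Rightarrow> (nat set \<Rightarrow> complex)" where
  "contract_at n i s J = (if i \<notin> J \<and> i < n \<and> J \<subseteq> {..<n} then - koszul_sign i J * s (insert i J) else 0)"

lemma wedge_apply: "wedge d v s J = (\<Sum>i<dim_h d. x_basis d i v * wedge_at (dim_h d) i s J)"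
proof -
  let ?n = "dim_h d"
  have "wedge d v s J = (\<Sum>I\<in>Pow {..<?n}. \<Sum>i<?n. if i \<in> I then 0 else
      (if J = insert i I then s I * (x_basis d i v * koszul_sign i I) else 0))"
    unfolding wedge_def linear_extension_def sum_fun_apply cscale_apply
  proof (rule sum.cong[OF refl])
    fix I assume "I \<in> Pow {..<?n}"
    show "s I * (\<Sum>i\<in>{..<?n} - I. x_basis d i v * (- 1) ^ card {j \<in> I. j < i} * ext_basis (insert i I) J)
      = (\<Sum>i<?n. if i \<in> I then 0 else if J = insert i I then s I * (x_basis d i v * koszul_sign i I) else 0)"
      unfolding sum_fun_apply sum_distrib_left
      by (rule sum.mono_neutral_cong_left) (auto simp: ext_basis_def koszul_sign_def)
  qed
  also have "\<dots> = (\<Sum>i<?n. \<Sum>I\<in>Pow {..<?n}. if i \<in> I then 0 else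
      (if J = insert i I then s I * (x_basis d i v * koszul_sign i I) else 0))"
    by (rule sum.swap)
  also have "\<dots> = (\<Sum>i<?n. x_basis d i v * wedge_at ?n i s J)"
  proof (rule sum.cong[OF refl])
    fix i assume i: "i \<in> {..<?n}"
    have "(\<Sum>I\<in>Pow {..<?n}. if i \<in> I then 0 else
        (if J = insert i I then s I * (x_basis d i v * koszul_sign i I) else 0))
      = (\<Sum>I\<in>Pow {..<?n}. if I = J - {i} then x_basis d i v * wedge_at ?n i s J else 0)"
    proof (rule sum.cong[OF refl])
      fix I assume I: "I \<in> Pow {..<?n}"
      \<comment> \<open>The sign counts indices strictly below \<open>i\<close>, so it does not see
        \<open>i\<close> itself and can be read off at \<open>J\<close> instead of
        \<open>I\<close>.\<close>
      have "koszul_sign i (insert i I) = koszul_sign i I"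
      proof -
        have "{j \<in> insert i I. j < i} = {j \<in> I. j < i}" by auto
        then show ?thesis by (simp only: koszul_sign_def)
      qed
      then show "(if i \<in> I then 0 else (if J = insert i I then s I * (x_basis d i v * koszul_sign i I) else 0))
        = (if I = J - {i} then x_basis d i v * wedge_at ?n i s J else 0)"
        using i I by (auto simp: wedge_at_def insert_absorb)
    qed
    also have "\<dots> = x_basis d i v * wedge_at ?n i s J"
      using i by (auto simp: wedge_at_def)
    finally show "(\<Sum>I\<in>Pow {..<?n}. if i \<in> I then 0 else
        (if J = insert i I then s I * (x_basis d i v * koszul_sign i I) else 0))
      = x_basis d i v * wedge_at ?n i s J" .
  qed
  finally show ?thesis .
qed

lemma contraction_apply:
  "contraction d \<xi> s J = (\<Sum>i<dim_h d. \<xi> (y_basis d i) * contract_at (dim_h d) i s J)"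
proof -
  let ?n = "dim_h d"
  let ?g = "\<lambda>i I. if i \<in> I then (if J = I - {i} then s I * (\<xi> (y_basis d i) * (-1) ^ card {j \<in> I. j \<le> i}) else 0) else 0"
  have "contraction d \<xi> s J = (\<Sum>I\<in>Pow {..<?n}. \<Sum>i<?n. ?g i I)"
    unfolding contraction_def linear_extension_def sum_fun_apply cscale_apply
  proof (rule sum.cong[OF refl])
    fix I assume "I \<in> Pow {..<?n}"
    then show "s I * (\<Sum>i\<in>I. (- 1) ^ card {j \<in> I. j \<le> i} * \<xi> (y_basis d i) * ext_basis (I - {i}) J)
      = (\<Sum>i<?n. ?g i I)"
      unfolding sum_fun_apply sum_distrib_left
      by (intro sum.mono_neutral_cong_left) (auto simp: ext_basis_def)
  qed
  also have "\<dots> = (\<Sum>i<?n. \<Sum>I\<in>Pow {..<?n}. ?g i I)"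
    by (rule sum.swap)
  also have "\<dots> = (\<Sum>i<?n. \<xi> (y_basis d i) * contract_at ?n i s J)"
  proof (rule sum.cong[OF refl])
    fix i assume i: "i \<in> {..<?n}"
    have "(\<Sum>I\<in>Pow {..<?n}. ?g i I)
      = (\<Sum>I\<in>Pow {..<?n}. if I = insert i J then \<xi> (y_basis d i) * contract_at ?n i s J else 0)"
    proof (rule sum.cong[OF refl])
      fix I assume I: "I \<in> Pow {..<?n}"
      show "?g i I = (if I = insert i J then \<xi> (y_basis d i) * contract_at ?n i s J else 0)"
      proof (cases "i \<in> I \<and> J = I - {i}")
        case True
        then have "{j \<in> I. j \<le> i} = insert i {j \<in> J. j < i}" by auto
        moreover have "finite J" using True I finite_subset[of J "{..<?n}"] by auto
        ultimately have "(-1) ^ card {j \<in> I. j \<le> i} = - koszul_sign i J"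
          by (simp add: koszul_sign_def)
        moreover have "J \<subseteq> {..<?n}" "I = insert i J" "i \<notin> J" using True I by auto
        ultimately show ?thesis using i by (simp add: contract_at_def)
      next
        case False
        then show ?thesis by (auto simp: contract_at_def)
      qed
    qed
    also have "\<dots> = \<xi> (y_basis d i) * contract_at ?n i s J"
      using i by (auto simp: contract_at_def)
    finally show "(\<Sum>I\<in>Pow {..<?n}. ?g i I) = \<xi> (y_basis d i) * contract_at ?n i s J" .
  qed
  finally show ?thesis .
qed

text \<open>Write \<open>J\<close> as \<open>T\<close> with \<open>i\<close> and \<open>j\<close>
  inserted. Only the larger of the two indices counts the smaller one among its predecessors, and it
  does so in just one of the two orders; this is the sign change. In all other cases both sides
  vanish.\<close>

lemma wedge_at_wedge_at:
  "wedge_at n i (wedge_at n j s) J = - wedge_at n j (wedge_at n i s) J"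
proof (cases "i \<in> J \<and> j \<in> J \<and> i \<noteq> j \<and> J \<subseteq> {..<n}")
  case True
  define T where "T = J - {i, j}"
  have T: "finite T" "i \<notin> T" "j \<notin> T" "J = insert i (insert j T)" "J - {i} = insert j T" "J - {j} = insert i T"
    "insert j T - {j} = T" "insert i T - {i} = T"
    using True finite_subset[of J "{..<n}"] by (auto simp: T_def)
  have "J - {i} - {j} = T" "J - {j} - {i} = T" by (auto simp: T_def)
  moreover have "koszul_sign i J = koszul_sign i (insert j T)" "koszul_sign j J = koszul_sign j (insert i T)"
    "koszul_sign j (insert j T) = koszul_sign j T" "koszul_sign i (insert i T) = koszul_sign i T"
    using T True by (auto simp: koszul_sign_insert)
  ultimately show ?thesis
    using True T(1-3,5,6) by (auto simp: wedge_at_def koszul_sign_insert)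
next
  case False
  then show ?thesis by (auto simp: wedge_at_def)
qed

lemma contract_at_contract_at:
  "contract_at n i (contract_at n j s) J = - contract_at n j (contract_at n i s) J"
proof (cases "i \<notin> J \<and> j \<notin> J \<and> i \<noteq> j \<and> J \<subseteq> {..<n} \<and> i < n \<and> j < n")
  case True
  then have "finite J" using finite_subset[of J "{..<n}"] by auto
  then show ?thesis
    using True by (auto simp: contract_at_def koszul_sign_insert insert_commute)
next
  case False
  then show ?thesis by (auto simp: contract_at_def)
qed

text \<open>For \<open>i = j\<close> one summand survives, according to whether \<open>j\<close>
  lies in \<open>J\<close>, and the sign squares to 1. For \<open>i \<noteq> j\<close> the summands
  can be nonzero only if \<open>j \<in> J\<close> and \<open>i \<notin> J\<close>; they cancel
  because the larger index sees the smaller one in one order only. The condition on \<open>s\<close>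
  covers sets \<open>J\<close> outside \<open>{..<n}\<close>, where the left side is zero.\<close>

lemma contract_at_wedge_at:
  assumes "s \<in> tensor_space n" "i < n" "j < n"
  shows "contract_at n i (wedge_at n j s) J + wedge_at n j (contract_at n i s) J = (if i = j then - s J else 0)"
proof (cases "J \<subseteq> {..<n}")
  case True
  then have fin: "finite J" using finite_subset[of J "{..<n}"] by auto
  show ?thesis
  proof (cases "i = j")
    case [simp]: True
    show ?thesis
    proof (cases "j \<in> J")
      case True
      then have "insert j J = J" "J - {j} \<subseteq> {..<n}" "insert j (J - {j}) = J"
        using \<open>J \<subseteq> _\<close> by auto
      moreover have "koszul_sign j (J - {j}) = koszul_sign j J"
        using koszul_sign_insert[of "J - {j}" j j] True fin by (simp add: insert_absorb)
      ultimately show ?thesis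
        using True assms \<open>J \<subseteq> _\<close> koszul_sign_square[of j J]
        by (simp add: contract_at_def wedge_at_def mult.assoc[symmetric])
    next
      case False
      then have "insert j J - {j} = J" by auto
      then show ?thesis using False assms \<open>J \<subseteq> _\<close> koszul_sign_square[of j J] fin
        by (simp add: contract_at_def wedge_at_def koszul_sign_insert mult.assoc[symmetric])
    qed
  next
    case False
    show ?thesis
    proof (cases "j \<in> J \<and> i \<notin> J")
      case True
      define T where "T = J - {j}"
      have T: "J = insert j T" "j \<notin> T" "i \<notin> T" "finite T" "T \<subseteq> {..<n}" using True fin \<open>J \<subseteq> _\<close> by (auto simp: T_def)
      have "insert i (insert j T) - {j} = insert i T" "insert j T - {j} = T" using T False by auto
      then show ?thesis
        using T assms False by (auto simp: contract_at_def wedge_at_def koszul_sign_insert)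
    next
      case False
      then show ?thesis using \<open>i \<noteq> j\<close> by (auto simp: contract_at_def wedge_at_def)
    qed
  qed
next
  case False
  then show ?thesis using assms(1) by (auto simp: contract_at_def wedge_at_def tensor_space_def)
qed

lemma wedge_at_sum: "wedge_at n i (\<lambda>J. \<Sum>j\<in>C. c j * f j J) K = (\<Sum>j\<in>C. c j * wedge_at n i (f j) K)"
proof (cases "i \<in> K \<and> K \<subseteq> {..<n}")
  case True
  then show ?thesis by (simp add: wedge_at_def sum_distrib_left algebra_simps)
next
  case False
  then have "wedge_at n i g K = 0" for g unfolding wedge_at_def by (rule if_not_P)
  then show ?thesis by simp
qed

lemma contract_at_sum: "contract_at n i (\<lambda>J. \<Sum>j\<in>C. c j * f j J) K = (\<Sum>j\<in>C. c j * contract_at n i (f j) K)"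
proof (cases "i \<notin> K \<and> i < n \<and> K \<subseteq> {..<n}")
  case True
  then show ?thesis by (simp add: contract_at_def sum_distrib_left algebra_simps sum_negf)
next
  case False
  then have "contract_at n i g K = 0" for g unfolding contract_at_def by (rule if_not_P)
  then show ?thesis by simp
qed

lemma wedge_alt: "wedge d v s = (\<lambda>J. \<Sum>i<dim_h d. x_basis d i v * wedge_at (dim_h d) i s J)"
  by (rule ext) (rule wedge_apply)

lemma contraction_alt: "contraction d \<xi> s = (\<lambda>J. \<Sum>i<dim_h d. \<xi> (y_basis d i) * contract_at (dim_h d) i s J)"
  by (rule ext) (rule contraction_apply)

lemma spinor_linear_wedge: "spinor_linear (wedge d v)"
  unfolding wedge_def by (rule spinor_linear_linear_extension)

lemma spinor_linear_contraction: "spinor_linear (contraction d \<xi>)"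
  unfolding contraction_def by (rule spinor_linear_linear_extension)

lemma spinor_linear_exterior_map: "spinor_linear (exterior_map d w)"
  unfolding exterior_map_def by (rule spinor_linear_linear_extension)

lemma wedge_stable: "wedge d v s \<in> tensor_space (dim_h d)"
  by (auto simp: tensor_space_def wedge_apply wedge_at_def)

lemma contraction_stable: "contraction d \<xi> s \<in> tensor_space (dim_h d)"
  by (auto simp: tensor_space_def contraction_apply contract_at_def)

lemma wedge_wedge: "wedge d v (wedge d w s) = - wedge d w (wedge d v s)"
proof
  fix J
  let ?n = "dim_h d"
  have *: "wedge d v (wedge d w s) J
    = (\<Sum>i<?n. \<Sum>j<?n. x_basis d i v * x_basis d j w * wedge_at ?n i (wedge_at ?n j s) J)" for v w
    by (simp add: wedge_alt[of d w] wedge_apply wedge_at_sum sum_distrib_left mult.assoc)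
  have "wedge d v (wedge d w s) J
    = (\<Sum>j<?n. \<Sum>i<?n. x_basis d i v * x_basis d j w * wedge_at ?n i (wedge_at ?n j s) J)"
    unfolding * by (rule sum.swap)
  also have "\<dots> = - wedge d w (wedge d v s) J"
    unfolding * by (subst wedge_at_wedge_at) (simp add: sum_negf algebra_simps)
  finally show "wedge d v (wedge d w s) J = (- wedge d w (wedge d v s)) J" by simp
qed

lemma contraction_contraction: "contraction d \<xi> (contraction d \<eta> s) = - contraction d \<eta> (contraction d \<xi> s)"
proof
  fix J
  let ?n = "dim_h d" and ?y = "y_basis d"
  have *: "contraction d \<xi> (contraction d \<eta> s) J
    = (\<Sum>i<?n. \<Sum>j<?n. \<xi> (?y i) * \<eta> (?y j) * contract_at ?n i (contract_at ?n j s) J)" for \<xi> \<eta>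
    by (simp add: contraction_alt[of d \<eta>] contraction_apply contract_at_sum sum_distrib_left mult.assoc)
  have "contraction d \<xi> (contraction d \<eta> s) J
    = (\<Sum>j<?n. \<Sum>i<?n. \<xi> (?y i) * \<eta> (?y j) * contract_at ?n i (contract_at ?n j s) J)"
    unfolding * by (rule sum.swap)
  also have "\<dots> = - contraction d \<eta> (contraction d \<xi> s) J"
    unfolding * by (subst contract_at_contract_at) (simp add: sum_negf algebra_simps)
  finally show "contraction d \<xi> (contraction d \<eta> s) J = (- contraction d \<eta> (contraction d \<xi> s)) J" by simp
qed

lemma wedge_self: "wedge d v (wedge d v s) = 0"
  by (rule spinor_double) (rule wedge_wedge)

context cherednik_data
begin

lemma dualD:
  assumes "\<xi> \<in> dual d"
  shows "\<xi> (u + v) = \<xi> u + \<xi> v" "\<xi> (h_scale d a v) = a * \<xi> v" "\<xi> 0 = 0"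
    "\<xi> (\<Sum>i\<in>C. f i) = (\<Sum>i\<in>C. \<xi> (f i))" "\<xi> (u - v) = \<xi> u - \<xi> v"
proof -
  interpret f: Vector_Spaces.linear "h_scale d" "(*)" \<xi> using assms by (simp add: dual_def)
  show "\<xi> (u + v) = \<xi> u + \<xi> v" "\<xi> (h_scale d a v) = a * \<xi> v" "\<xi> 0 = 0"
    "\<xi> (\<Sum>i\<in>C. f i) = (\<Sum>i\<in>C. \<xi> (f i))" "\<xi> (u - v) = \<xi> u - \<xi> v"
    by (rule f.add f.scale f.zero f.sum f.diff)+
qed

lemma y_expansion: "v = (\<Sum>i<dim_h d. h_scale d (x_basis d i v) (y_basis d i))"
proof -
  have "v \<in> span (y_basis d ` {..<dim_h d})" using y_span by simp
  then show ?thesis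
  proof (induction rule: span_induct_alt)
    case base
    then show ?case using dualD(3)[OF x_dual] by simp
  next
    case (step c b z)
    then obtain k where k: "k < dim_h d" "b = y_basis d k" by auto
    have "b = (\<Sum>i<dim_h d. h_scale d (if i = k then 1 else 0) (y_basis d i))"
      using k by (simp add: if_distrib[of "\<lambda>a. h_scale d a _"] if_distribR cong: if_cong)
    also have "\<dots> = (\<Sum>i<dim_h d. h_scale d (x_basis d i b) (y_basis d i))"
      using k by (intro sum.cong) (auto simp: x_y)
    finally have b: "(\<Sum>i<dim_h d. h_scale d (x_basis d i b) (y_basis d i)) = b" ..
    have "(\<Sum>i<dim_h d. h_scale d (x_basis d i (h_scale d c b + z)) (y_basis d i))
        = (\<Sum>i<dim_h d. h_scale d c (h_scale d (x_basis d i b) (y_basis d i)) + h_scale d (x_basis d i z) (y_basis d i))"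
      by (intro sum.cong) (auto simp: dualD[OF x_dual] scale_left_distrib)
    also have "\<dots> = h_scale d c b + z"
      by (simp only: sum.distrib scale_sum_right[symmetric] b step(2)[symmetric])
    finally show ?case ..
  qed
qed

lemma dual_expansion:
  assumes "\<xi> \<in> dual d" shows "\<xi> v = (\<Sum>i<dim_h d. x_basis d i v * \<xi> (y_basis d i))"
  by (subst y_expansion[of v]) (simp add: dualD[OF assms])

lemma wedge_add: "wedge d (u + v) s = wedge d u s + wedge d v s"
  by (rule ext) (simp add: wedge_apply dualD(1)[OF x_dual] distrib_right sum.distrib)

lemma wedge_scale: "wedge d (h_scale d a v) s = cscale a (wedge d v s)"
  by (rule ext) (simp add: wedge_apply dualD(2)[OF x_dual] mult.assoc sum_distrib_left)

lemma wedge_zero: "wedge d 0 s = 0"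
  by (rule ext) (simp add: wedge_apply dualD(3)[OF x_dual])

lemma wedge_sum: "wedge d (\<Sum>i\<in>C. f i) s = (\<Sum>i\<in>C. wedge d (f i) s)"
  by (induction C rule: infinite_finite_induct) (auto simp: wedge_zero wedge_add)

text \<open>Contracting a single vector \<open>v\<close> gives \<open>- \<xi> v\<close>, as its
  position is 1. Together with the factor 2 in \<open>spin_letter\<close> this produces the constant
  -2 of the Clifford relation.\<close>

lemma contraction_wedge:
  assumes s: "s \<in> tensor_space (dim_h d)" and \<xi>: "\<xi> \<in> dual d"
  shows "contraction d \<xi> (wedge d v s) + wedge d v (contraction d \<xi> s) = cscale (- \<xi> v) s"
proof
  fix J
  let ?n = "dim_h d" and ?y = "y_basis d"
  have 1: "contraction d \<xi> (wedge d v s) J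
    = (\<Sum>i<?n. \<Sum>j<?n. \<xi> (?y i) * x_basis d j v * contract_at ?n i (wedge_at ?n j s) J)"
    by (simp add: wedge_alt[of d v] contraction_apply contract_at_sum sum_distrib_left mult.assoc)
  have "wedge d v (contraction d \<xi> s) J
    = (\<Sum>j<?n. \<Sum>i<?n. \<xi> (?y i) * x_basis d j v * wedge_at ?n j (contract_at ?n i s) J)"
    by (simp add: contraction_alt[of d \<xi>] wedge_apply wedge_at_sum sum_distrib_left algebra_simps)
  also have "\<dots> = (\<Sum>i<?n. \<Sum>j<?n. \<xi> (?y i) * x_basis d j v * wedge_at ?n j (contract_at ?n i s) J)"
    by (rule sum.swap)
  finally have "(contraction d \<xi> (wedge d v s) + wedge d v (contraction d \<xi> s)) J
    = (\<Sum>i<?n. \<Sum>j<?n. \<xi> (?y i) * x_basis d j v *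
        (contract_at ?n i (wedge_at ?n j s) J + wedge_at ?n j (contract_at ?n i s) J))"
    by (simp add: 1 sum.distrib algebra_simps)
  also have "\<dots> = (\<Sum>i<?n. \<Sum>j<?n. if i = j then - (x_basis d i v * \<xi> (?y i) * s J) else 0)"
    by (intro sum.cong refl) (auto simp: contract_at_wedge_at[OF s])
  also have "\<dots> = - (\<Sum>i<?n. x_basis d i v * \<xi> (?y i)) * s J"
    by (simp add: sum_negf sum_distrib_right)
  also have "\<dots> = cscale (- \<xi> v) s J"
    by (simp add: dual_expansion[OF \<xi>, of v])
  finally show "(contraction d \<xi> (wedge d v s) + wedge d v (contraction d \<xi> s)) J = cscale (- \<xi> v) s J" .
qed

lemma wedge_y_basis:
  assumes "i < dim_h d" shows "wedge d (y_basis d i) s = wedge_at (dim_h d) i s"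
proof
  fix J
  have "wedge d (y_basis d i) s J = (\<Sum>k<dim_h d. if k = i then wedge_at (dim_h d) i s J else 0)"
    unfolding wedge_apply using assms by (intro sum.cong) (auto simp: x_y)
  then show "wedge d (y_basis d i) s J = wedge_at (dim_h d) i s J" using assms by simp
qed

lemma wedge_ext_basis:
  assumes "i < dim_h d" "I \<subseteq> {..<dim_h d}"
  shows "wedge d (y_basis d i) (ext_basis I) = (if i \<in> I then 0 else cscale (koszul_sign i I) (ext_basis (insert i I)))"
proof -
  have "finite I" using assms finite_subset by blast
  then show ?thesis
    using assms by (auto simp: wedge_y_basis fun_eq_iff wedge_at_def ext_basis_def koszul_sign_insert)
qed

lemma wedge_ext_basis_min:
  assumes "i < dim_h d" "I \<subseteq> {..<dim_h d}" "\<And>j. j \<in> I \<Longrightarrow> i < j"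
  shows "wedge d (y_basis d i) (ext_basis I) = ext_basis (insert i I)"
proof -
  have "{j \<in> I. j < i} = {}" and "i \<notin> I" using assms(3) by (auto dest: less_asym)
  then have "koszul_sign i I = 1" by (simp only: koszul_sign_def card.empty power_0)
  then show ?thesis using assms \<open>i \<notin> I\<close> by (simp add: wedge_ext_basis)
qed

text \<open>New elements are inserted below all old ones. This is the order in which
  \<open>foldr\<close> over the sorted list builds a basis element, so wedging with the new vector
  gives a basis element without a sign.\<close>

lemma subset_induct_min [consumes 1, case_names empty insert]:
  assumes "I \<subseteq> {..<n::nat}" "P {}"
    and "\<And>j I. j < n \<Longrightarrow> I \<subseteq> {..<n} \<Longrightarrow> (\<And>k. k \<in> I \<Longrightarrow> j < k) \<Longrightarrow> P I \<Longrightarrow> P (insert j I)"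
  shows "P I"
proof -
  have "finite I" using assms(1) finite_subset by blast
  then show ?thesis using assms(1)
    by (induction I rule: finite_linorder_min_induct) (use assms(2,3) in auto)
qed

section \<open>Exterior powers of linear maps\<close>

lemma exterior_map_empty: "exterior_map d w (ext_basis {}) = ext_basis {}"
  by (simp add: exterior_map_def linear_extension_basis)

lemma exterior_map_insert:
  assumes "j < dim_h d" "I \<subseteq> {..<dim_h d}" "\<And>k. k \<in> I \<Longrightarrow> j < k"
  shows "exterior_map d w (ext_basis (insert j I)) = wedge d (w (y_basis d j)) (exterior_map d w (ext_basis I))"
proof -
  have fin: "finite I" using assms finite_subset by blast
  have "sorted_list_of_set (insert j I) = j # sorted_list_of_set I"
    using fin assms(3) by (intro sorted_list_of_set_unique[THEN iffD1]) (auto intro: less_imp_le simp: card_insert_if dest: less_asym)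
  then show ?thesis using assms by (simp add: exterior_map_def linear_extension_basis)
qed

lemma exterior_map_stable:
  assumes "s \<in> tensor_space (dim_h d)" shows "exterior_map d w s \<in> tensor_space (dim_h d)"
proof (rule spinor_linear_stable[OF spinor_linear_exterior_map assms])
  fix I assume "I \<subseteq> {..<dim_h d}"
  then show "exterior_map d w (ext_basis I) \<in> tensor_space (dim_h d)"
    by (induction rule: subset_induct_min)
      (auto simp: exterior_map_empty exterior_map_insert wedge_stable ext_basis_in_tensor_space)
qed

lemma exterior_map_degree:
  assumes "I \<subseteq> {..<dim_h d}" "exterior_map d w (ext_basis I) J \<noteq> 0" shows "card J = card I"
  using assms
proof (induction arbitrary: J rule: subset_induct_min)
  case empty
  then show ?case unfolding exterior_map_empty by (auto simp: ext_basis_def split: if_splits)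
next
  case (insert j I)
  then obtain i where i: "wedge_at (dim_h d) i (exterior_map d w (ext_basis I)) J \<noteq> 0"
    by (force simp: exterior_map_insert wedge_apply dest: sum.not_neutral_contains_not_neutral)
  then have J: "i \<in> J" "J \<subseteq> {..<dim_h d}" "exterior_map d w (ext_basis I) (J - {i}) \<noteq> 0"
    by (auto simp: wedge_at_def split: if_splits)
  then have "card (J - {i}) = card I" using insert by blast
  moreover have "finite J" "finite I" "j \<notin> I" using J insert finite_subset by blast+
  ultimately show ?case using J(1) by (metis card_Suc_Diff1 card_insert_disjoint)
qed

lemma h_linearD:
  assumes "Vector_Spaces.linear (h_scale d) (h_scale d) w"
  shows "w (u + v) = w u + w v" "w (h_scale d a v) = h_scale d a (w v)" "w 0 = 0"
    "w (\<Sum>i\<in>C. f i) = (\<Sum>i\<in>C. w (f i))" "w (u - v) = w u - w v"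
proof -
  interpret f: Vector_Spaces.linear "h_scale d" "h_scale d" w by fact
  show "w (u + v) = w u + w v" "w (h_scale d a v) = h_scale d a (w v)" "w 0 = 0"
    "w (\<Sum>i\<in>C. f i) = (\<Sum>i\<in>C. w (f i))" "w (u - v) = w u - w v"
    by (rule f.add f.scale f.zero f.sum f.diff)+
qed

text \<open>The definition directly covers wedging with an index below all others. An equal index
  gives zero on both sides, and a larger one is first exchanged with the minimum
  \<open>y\<^sub>j\<close>, after which the induction hypothesis for \<open>I\<close>
  applies.\<close>

lemma exterior_map_wedge_basis:
  assumes "I \<subseteq> {..<dim_h d}" "i < dim_h d"
  shows "exterior_map d w (wedge d (y_basis d i) (ext_basis I))
    = wedge d (w (y_basis d i)) (exterior_map d w (ext_basis I))"
  using assms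
proof (induction arbitrary: i rule: subset_induct_min)
  case empty
  then show ?case
    using wedge_ext_basis_min[of i "{}"] exterior_map_insert[of i "{}" w] by simp
next
  case (insert j I)
  let ?L = "exterior_map d w"
  note L = spinor_linearD[OF spinor_linear_exterior_map]
  have eI: "ext_basis (insert j I) = wedge d (y_basis d j) (ext_basis I)"
    using insert by (simp add: wedge_ext_basis_min)
  have min: "?L (wedge d (y_basis d j) (ext_basis K)) = wedge d (w (y_basis d j)) (?L (ext_basis K))"
    if "K \<subseteq> {..<dim_h d}" "\<And>k. k \<in> K \<Longrightarrow> j < k" for K
    using insert that by (simp add: wedge_ext_basis_min exterior_map_insert)
  consider "i < j" | "i = j" | "j < i" by linarith
  then show ?case
  proof cases
    case 1
    then have K: "insert j I \<subseteq> {..<dim_h d}" "\<And>k. k \<in> insert j I \<Longrightarrow> i < k" using insert.hyps by force+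
    show ?thesis
      using wedge_ext_basis_min[OF insert.prems K] exterior_map_insert[OF insert.prems K, of w] by simp
  next
    case 2
    show ?thesis
      unfolding 2 eI wedge_self L(3) by (simp only: min[OF insert.hyps(2,3)] wedge_self)
  next
    case 3
    \<comment> \<open>After the exchange \<open>y\<^sub>j\<close> is outermost and lies below all of
      \<open>insert i I\<close>, so the unsigned rule \<open>min\<close> applies; if
      \<open>i \<in> I\<close>, everything is zero.\<close>
    have "?L (wedge d (y_basis d j) (wedge d (y_basis d i) (ext_basis I)))
      = wedge d (w (y_basis d j)) (?L (wedge d (y_basis d i) (ext_basis I)))"
    proof (cases "i \<in> I")
      case True
      then have "wedge d (y_basis d i) (ext_basis I) = 0"
        by (simp only: wedge_ext_basis[OF insert.prems insert.hyps(2)] if_True)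
      then show ?thesis by (simp only: L(3) spinor_linearD(3)[OF spinor_linear_wedge])
    next
      case False
      have K: "insert i I \<subseteq> {..<dim_h d}" "\<And>k. k \<in> insert i I \<Longrightarrow> j < k"
        using insert.hyps insert.prems 3 by auto
      show ?thesis using False
        by (simp only: wedge_ext_basis[OF insert.prems insert.hyps(2)] if_False L(2)
            spinor_linearD(2)[OF spinor_linear_wedge] min[OF K])
    qed
    note swap = this
    have "?L (wedge d (y_basis d i) (wedge d (y_basis d j) (ext_basis I)))
      = ?L (- wedge d (y_basis d j) (wedge d (y_basis d i) (ext_basis I)))"
      by (rule arg_cong[OF wedge_wedge])
    also have "\<dots> = - wedge d (w (y_basis d j)) (wedge d (w (y_basis d i)) (?L (ext_basis I)))"
      by (simp only: L(4) swap insert.IH[OF insert.prems])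
    also have "\<dots> = wedge d (w (y_basis d i)) (wedge d (w (y_basis d j)) (?L (ext_basis I)))"
      by (rule wedge_wedge[symmetric])
    finally show ?thesis by (simp only: eI min[OF insert.hyps(2,3)])
  qed
qed

lemma exterior_map_wedge:
  assumes w: "Vector_Spaces.linear (h_scale d) (h_scale d) w" and s: "s \<in> tensor_space (dim_h d)"
  shows "exterior_map d w (wedge d v s) = wedge d (w v) (exterior_map d w s)"
proof -
  note L = spinor_linearD[OF spinor_linear_exterior_map]
  have *: "exterior_map d w (wedge d (y_basis d i) s) = wedge d (w (y_basis d i)) (exterior_map d w s)"
    if "i < dim_h d" for i
    by (rule spinor_linear_eqI[OF spinor_linear_compose[OF spinor_linear_exterior_map spinor_linear_wedge]
          spinor_linear_compose[OF spinor_linear_wedge spinor_linear_exterior_map] s])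
      (rule exterior_map_wedge_basis[OF _ that])
  show ?thesis
    by (subst (1 2) y_expansion[of v])
      (simp add: wedge_sum wedge_scale L h_linearD[OF w] *)
qed

lemma exterior_map_comp:
  assumes w: "Vector_Spaces.linear (h_scale d) (h_scale d) w" and s: "s \<in> tensor_space (dim_h d)"
  shows "exterior_map d (w \<circ> w') s = exterior_map d w (exterior_map d w' s)"
proof (rule spinor_linear_eqI[OF spinor_linear_exterior_map
      spinor_linear_compose[OF spinor_linear_exterior_map spinor_linear_exterior_map] s])
  fix I assume "I \<subseteq> {..<dim_h d}"
  then show "exterior_map d (w \<circ> w') (ext_basis I) = exterior_map d w (exterior_map d w' (ext_basis I))"
    by (induction rule: subset_induct_min)
      (auto simp: exterior_map_empty exterior_map_insert exterior_map_wedge[OF w] exterior_map_stable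
        ext_basis_in_tensor_space)
qed

lemma exterior_map_id:
  assumes s: "s \<in> tensor_space (dim_h d)"
  shows "exterior_map d id s = s"
proof -
  have "spinor_linear (\<lambda>s. s)" by (rule spinor_linearI) auto
  then show ?thesis
  proof (rule spinor_linear_eqI[OF spinor_linear_exterior_map _ s])
    fix I assume "I \<subseteq> {..<dim_h d}"
    then show "exterior_map d id (ext_basis I) = ext_basis I"
      by (induction rule: subset_induct_min)
        (auto simp: exterior_map_empty exterior_map_insert wedge_ext_basis_min)
  qed
qed

lemma contraction_ext_basis_empty: "contraction d \<xi> (ext_basis {}) = 0"
proof
  fix J
  have "contract_at n i (ext_basis {}) J = 0" for n i
    by (auto simp: contract_at_def ext_basis_def)
  then show "contraction d \<xi> (ext_basis {}) J = 0 J" by (simp add: contraction_apply)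
qed

lemma GL_carrierD:
  assumes "g \<in> carrier (GL d)"
  shows "Vector_Spaces.linear (h_scale d) (h_scale d) g" "bij g"
  using assms by (auto simp: GL_def)

lemma inv_linear:
  assumes "g \<in> carrier (GL d)"
  shows "Vector_Spaces.linear (h_scale d) (h_scale d) (inv_into UNIV g)"
proof -
  note g = GL_carrierD[OF assms]
  have inv: "g (inv_into UNIV g v) = v" "inv_into UNIV g (g v) = v" for v
    using g(2) by (auto simp: bij_def surj_f_inv_f)
  show ?thesis
  proof unfold_locales
    show "inv_into UNIV g (u + v) = inv_into UNIV g u + inv_into UNIV g v" for u v
      by (metis inv h_linearD(1)[OF g(1)])
    show "inv_into UNIV g (h_scale d a v) = h_scale d a (inv_into UNIV g v)" for a v
      by (metis inv h_linearD(2)[OF g(1)])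
  qed
qed

lemma dual_action_dual:
  assumes w: "w \<in> carrier (GL d)" and \<xi>: "\<xi> \<in> dual d"
  shows "dual_action w \<xi> \<in> dual d"
  using Vector_Spaces.linear_compose[OF inv_linear[OF w]] \<xi>
  by (simp add: dual_def dual_action_def)

text \<open>Contraction is moved past the minimal vector \<open>y\<^sub>j\<close> by
  \<open>contraction_wedge\<close>. The scalar this produces is the same on both sides because the
  dual action preserves the pairing.\<close>

lemma exterior_map_contraction:
  assumes w: "w \<in> carrier (GL d)" and \<xi>: "\<xi> \<in> dual d" and s: "s \<in> tensor_space (dim_h d)"
  shows "exterior_map d w (contraction d \<xi> s) = contraction d (dual_action w \<xi>) (exterior_map d w s)"
proof (rule spinor_linear_eqI[OF spinor_linear_compose[OF spinor_linear_exterior_map spinor_linear_contraction]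
      spinor_linear_compose[OF spinor_linear_contraction spinor_linear_exterior_map] s])
  have lin: "Vector_Spaces.linear (h_scale d) (h_scale d) w" and bij: "bij w" using w by (auto simp: GL_def)
  note L = spinor_linearD[OF spinor_linear_exterior_map]
  fix I assume "I \<subseteq> {..<dim_h d}"
  then show "exterior_map d w (contraction d \<xi> (ext_basis I)) = contraction d (dual_action w \<xi>) (exterior_map d w (ext_basis I))"
  proof (induction rule: subset_induct_min)
    case empty
    show ?case unfolding exterior_map_empty contraction_ext_basis_empty by (rule L(3))
  next
    case (insert j I)
    have I: "ext_basis I \<in> tensor_space (dim_h d)" using insert by (simp add: ext_basis_in_tensor_space)
    have "dual_action w \<xi> (w v) = \<xi> v" for v using bij by (simp add: dual_action_def bij_def)
    then have 1: "contraction d (dual_action w \<xi>) (wedge d (w v) t) = cscale (- \<xi> v) t - wedge d (w v) (contraction d (dual_action w \<xi>) t)"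
      if "t \<in> tensor_space (dim_h d)" for t v
      using contraction_wedge[OF that dual_action_dual[OF w \<xi>], of "w v"] by (simp add: algebra_simps)
    have 2: "contraction d \<xi> (wedge d v t) = cscale (- \<xi> v) t - wedge d v (contraction d \<xi> t)"
      if "t \<in> tensor_space (dim_h d)" for t v
      using contraction_wedge[OF that \<xi>, of v] by (simp add: algebra_simps)
    have "exterior_map d w (contraction d \<xi> (wedge d (y_basis d j) (ext_basis I)))
      = contraction d (dual_action w \<xi>) (wedge d (w (y_basis d j)) (exterior_map d w (ext_basis I)))"
      by (simp only: 1[OF exterior_map_stable[OF I]] 2[OF I] L exterior_map_wedge[OF lin contraction_stable] insert.IH)
    then show ?case using insert by (simp add: wedge_ext_basis_min exterior_map_insert)
  qed
qed

end

section \<open>Operators on tensor products\<close>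

locale complex_vector_space = vector_space sM for sM :: "complex \<Rightarrow> 'm::ab_group_add \<Rightarrow> 'm"
begin

sublocale T: vector_space "tscale sM"
  by (rule vector_space_tscale) (rule vector_space_axioms)

lemma tscale_apply [simp]: "tscale sM a u I = sM a (u I)"
  by (simp add: tscale_def)

lemma M_linearD:
  assumes "Vector_Spaces.linear sM sM A"
  shows "A (u + v) = A u + A v" "A (sM a v) = sM a (A v)" "A 0 = 0"
    "A (\<Sum>i\<in>C. f i) = (\<Sum>i\<in>C. A (f i))"
proof -
  interpret f: Vector_Spaces.linear sM sM A by fact
  show "A (u + v) = A u + A v" "A (sM a v) = sM a (A v)" "A 0 = 0"
    "A (\<Sum>i\<in>C. f i) = (\<Sum>i\<in>C. A (f i))"
    by (rule f.add f.scale f.zero f.sum)+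
qed

lemma tensor_op_apply: "tensor_op n sM A B u J = (\<Sum>I\<in>Pow {..<n}. sM (B (ext_basis I) J) (A (u I)))"
  by (simp add: tensor_op_def sum_fun_apply pure_tensor_def)

lemma tensor_op_stable:
  assumes "\<And>I. I \<subseteq> {..<n} \<Longrightarrow> B (ext_basis I) \<in> tensor_space n"
  shows "tensor_op n sM A B u \<in> tensor_space n"
  using assms by (auto simp: tensor_space_def tensor_op_apply)

lemma tensor_op_linear:
  assumes "Vector_Spaces.linear sM sM A"
  shows "Vector_Spaces.linear (tscale sM) (tscale sM) (tensor_op n sM A B)"
proof unfold_locales
  show "tensor_op n sM A B (u + v) = tensor_op n sM A B u + tensor_op n sM A B v" for u v
    by (rule ext) (simp add: tensor_op_apply M_linearD[OF assms] scale_right_distrib sum.distrib)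
  show "tensor_op n sM A B (tscale sM c u) = tscale sM c (tensor_op n sM A B u)" for c u
    by (rule ext) (simp add: tensor_op_apply M_linearD[OF assms] scale_sum_right mult.commute)
qed

lemma tensor_op_cong:
  assumes "\<And>I. I \<subseteq> {..<n} \<Longrightarrow> B (ext_basis I) = B' (ext_basis I)"
  shows "tensor_op n sM A B = tensor_op n sM A B'"
proof
  fix u show "tensor_op n sM A B u = tensor_op n sM A B' u"
    unfolding tensor_op_def by (rule sum.cong) (use assms in auto)
qed

text \<open>Matrix multiplication in the basis of the exterior algebra; the condition on
  \<open>B'\<close> allows its values to be expanded in that basis.\<close>

lemma tensor_op_comp:
  assumes A: "Vector_Spaces.linear sM sM A" and B: "spinor_linear B"
    and B': "\<And>I. I \<subseteq> {..<n} \<Longrightarrow> B' (ext_basis I) \<in> tensor_space n"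
  shows "tensor_op n sM A B (tensor_op n sM A' B' u) = tensor_op n sM (\<lambda>m. A (A' m)) (\<lambda>s. B (B' s)) u"
proof
  fix J
  let ?P = "Pow {..<n}"
  have "tensor_op n sM A B (tensor_op n sM A' B' u) J
    = (\<Sum>I\<in>?P. \<Sum>K\<in>?P. sM (B (ext_basis I) J * B' (ext_basis K) I) (A (A' (u K))))"
    by (simp add: tensor_op_apply M_linearD[OF A] scale_sum_right)
  also have "\<dots> = (\<Sum>K\<in>?P. \<Sum>I\<in>?P. sM (B (ext_basis I) J * B' (ext_basis K) I) (A (A' (u K))))"
    by (rule sum.swap)
  also have "\<dots> = (\<Sum>K\<in>?P. sM (B (B' (ext_basis K)) J) (A (A' (u K))))"
  proof (rule sum.cong[OF refl])
    fix K assume "K \<in> ?P"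
    then have "B (B' (ext_basis K)) J = (\<Sum>I\<in>?P. B (ext_basis I) J * B' (ext_basis K) I)"
      using spinor_linear_expansion[OF B B', of K] by (simp add: sum_fun_apply mult.commute)
    then show "(\<Sum>I\<in>?P. sM (B (ext_basis I) J * B' (ext_basis K) I) (A (A' (u K))))
        = sM (B (B' (ext_basis K)) J) (A (A' (u K)))"
      by (simp add: scale_sum_left)
  qed
  finally show "tensor_op n sM A B (tensor_op n sM A' B' u) J
      = tensor_op n sM (\<lambda>m. A (A' m)) (\<lambda>s. B (B' s)) u J"
    by (simp add: tensor_op_apply)
qed

lemma tensor_op_sum_left:
  "tensor_op n sM (\<lambda>m. \<Sum>i\<in>C. sM (c i) (A i m)) B u = (\<Sum>i\<in>C. tscale sM (c i) (tensor_op n sM (A i) B u))"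
proof
  fix J
  have "tensor_op n sM (\<lambda>m. \<Sum>i\<in>C. sM (c i) (A i m)) B u J
    = (\<Sum>I\<in>Pow {..<n}. \<Sum>i\<in>C. sM (c i) (sM (B (ext_basis I) J) (A i (u I))))"
    by (simp add: tensor_op_apply scale_sum_right mult.commute)
  also have "\<dots> = (\<Sum>i\<in>C. \<Sum>I\<in>Pow {..<n}. sM (c i) (sM (B (ext_basis I) J) (A i (u I))))"
    by (rule sum.swap)
  finally show "tensor_op n sM (\<lambda>m. \<Sum>i\<in>C. sM (c i) (A i m)) B u J
    = (\<Sum>i\<in>C. tscale sM (c i) (tensor_op n sM (A i) B u)) J"
    by (simp add: sum_fun_apply tensor_op_apply scale_sum_right)
qed

lemma tensor_op_sum_right:
  "tensor_op n sM A (\<lambda>s. \<Sum>i\<in>C. cscale (c i) (B i s)) u = (\<Sum>i\<in>C. tscale sM (c i) (tensor_op n sM A (B i) u))"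
proof
  fix J
  have "tensor_op n sM A (\<lambda>s. \<Sum>i\<in>C. cscale (c i) (B i s)) u J
    = (\<Sum>I\<in>Pow {..<n}. \<Sum>i\<in>C. sM (c i) (sM (B i (ext_basis I) J) (A (u I))))"
    by (simp add: tensor_op_apply sum_fun_apply scale_sum_left)
  also have "\<dots> = (\<Sum>i\<in>C. \<Sum>I\<in>Pow {..<n}. sM (c i) (sM (B i (ext_basis I) J) (A (u I))))"
    by (rule sum.swap)
  finally show "tensor_op n sM A (\<lambda>s. \<Sum>i\<in>C. cscale (c i) (B i s)) u J
    = (\<Sum>i\<in>C. tscale sM (c i) (tensor_op n sM A (B i) u)) J"
    by (simp add: sum_fun_apply tensor_op_apply scale_sum_right)
qed

lemma tensor_op_scale_right:
  "tensor_op n sM A (\<lambda>s. cscale c (B s)) u = tscale sM c (tensor_op n sM A B u)"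
  by (rule ext) (simp add: tensor_op_apply scale_sum_right)

lemma tensor_op_id:
  assumes "\<And>I. I \<subseteq> {..<n} \<Longrightarrow> B (ext_basis I) = ext_basis I" and u: "u \<in> tensor_space n"
  shows "tensor_op n sM (\<lambda>m. m) B u = u"
proof
  fix J
  have "tensor_op n sM (\<lambda>m. m) B u J = (\<Sum>I\<in>Pow {..<n}. if I = J then u J else 0)"
    unfolding tensor_op_apply
  proof (rule sum.cong[OF refl])
    fix I assume "I \<in> Pow {..<n}"
    then have "B (ext_basis I) = ext_basis I" using assms(1) by simp
    then show "sM (B (ext_basis I) J) (u I) = (if I = J then u J else 0)"
      by (simp add: ext_basis_def)
  qed
  then show "tensor_op n sM (\<lambda>m. m) B u J = u J"
    using u by (auto simp: tensor_space_def)
qed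

section \<open>Degree components\<close>

definition degree_part :: "int \<Rightarrow> (nat set \<Rightarrow> 'm) \<Rightarrow> (nat set \<Rightarrow> 'm)" where
  "degree_part k u = (\<lambda>I. if int (card I) = k then u I else 0)"

lemma degree_part_linear: "Vector_Spaces.linear (tscale sM) (tscale sM) (degree_part k)"
  by unfold_locales (auto simp: degree_part_def fun_eq_iff)

lemma degree_part_stable: "u \<in> tensor_space n \<Longrightarrow> degree_part k u \<in> tensor_space n"
  by (auto simp: tensor_space_def degree_part_def)

lemma degree_part_degree_part: "degree_part k (degree_part l u) = (if k = l then degree_part k u else 0)"
  by (auto simp: degree_part_def fun_eq_iff)

lemma degree_part_eq_0:
  assumes "\<And>k. degree_part k u = 0" shows "u = 0"
proof
  fix I show "u I = 0 I" using fun_cong[OF assms[of "int (card I)"], of I] by (simp add: degree_part_def)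
qed

lemma degree_part_bounded:
  assumes "u \<in> tensor_space n" "k < 0 \<or> k > int n" shows "degree_part k u = 0"
proof
  fix I
  have "u I = 0" if "card I > n"
  proof -
    have "\<not> I \<subseteq> {..<n}" using that card_mono[of "{..<n}" I] by auto
    then show ?thesis using assms(1) by (simp add: tensor_space_def)
  qed
  then have "int (card I) = k \<Longrightarrow> u I = 0" using assms(2) by linarith
  then show "degree_part k u I = 0 I" by (simp add: degree_part_def)
qed

text \<open>Used with \<open>r = 1\<close> for wedging, \<open>r = -1\<close> for contraction and
  \<open>r = 0\<close> for exterior powers.\<close>

lemma degree_part_tensor_op:
  assumes A: "Vector_Spaces.linear sM sM A"
    and B: "\<And>I J. I \<subseteq> {..<n} \<Longrightarrow> B (ext_basis I) J \<noteq> 0 \<Longrightarrow> int (card J) = int (card I) + r"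
  shows "degree_part (k + r) (tensor_op n sM A B u) = tensor_op n sM A B (degree_part k u)"
proof
  fix J
  have "degree_part (k + r) (tensor_op n sM A B u) J
    = (\<Sum>I\<in>Pow {..<n}. if int (card J) = k + r then sM (B (ext_basis I) J) (A (u I)) else 0)"
    by (simp add: degree_part_def tensor_op_apply)
  also have "\<dots> = (\<Sum>I\<in>Pow {..<n}. sM (B (ext_basis I) J) (A (degree_part k u I)))"
  proof (rule sum.cong[OF refl])
    fix I assume "I \<in> Pow {..<n}"
    then show "(if int (card J) = k + r then sM (B (ext_basis I) J) (A (u I)) else 0)
        = sM (B (ext_basis I) J) (A (degree_part k u I))"
      using B[of I J] by (cases "B (ext_basis I) J = 0") (auto simp: degree_part_def M_linearD(3)[OF A])
  qed
  finally show "degree_part (k + r) (tensor_op n sM A B u) J = tensor_op n sM A B (degree_part k u) J"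
    by (simp add: tensor_op_apply)
qed

lemma M_double: "u = - u \<Longrightarrow> u = (0 :: nat set \<Rightarrow> 'm)"
proof -
  assume "u = - u"
  then have "u + u = 0" by (metis add.right_inverse)
  then have "tscale sM 2 u = 0" using T.scale_left_distrib[of 1 1 u] by simp
  then show "u = 0" by simp
qed

text \<open>Commuting operators on \<open>M\<close> paired with anticommuting ones on spinors make
  the double sum antisymmetric in \<open>i\<close> and \<open>j\<close>, so it equals its own
  negative. Both Koszul differentials have this form.\<close>

lemma koszul_square_zero:
  assumes A: "\<And>i. i \<in> C \<Longrightarrow> Vector_Spaces.linear sM sM (A i)" and B: "\<And>i. i \<in> C \<Longrightarrow> spinor_linear (B i)"
    and B': "\<And>i I. i \<in> C \<Longrightarrow> I \<subseteq> {..<n} \<Longrightarrow> B i (ext_basis I) \<in> tensor_space n"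
    and AA: "\<And>i j m. i \<in> C \<Longrightarrow> j \<in> C \<Longrightarrow> A i (A j m) = A j (A i m)"
    and BB: "\<And>i j I. i \<in> C \<Longrightarrow> j \<in> C \<Longrightarrow> I \<subseteq> {..<n} \<Longrightarrow> B i (B j (ext_basis I)) = - B j (B i (ext_basis I))"
  shows "(\<Sum>i\<in>C. tensor_op n sM (A i) (B i) (\<Sum>j\<in>C. tensor_op n sM (A j) (B j) u)) = 0"
proof -
  let ?t = "\<lambda>i j. tensor_op n sM (A i) (B i) (tensor_op n sM (A j) (B j) u)"
  have anti: "?t i j = - ?t j i" if "i \<in> C" "j \<in> C" for i j
  proof
    fix J
    have comp: "?t i j = tensor_op n sM (\<lambda>m. A i (A j m)) (\<lambda>s. B i (B j s)) u"
      if "i \<in> C" "j \<in> C" for i j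
      by (rule tensor_op_comp) (use that A B B' in auto)
    have "?t i j J = (\<Sum>I\<in>Pow {..<n}. - sM (B j (B i (ext_basis I)) J) (A j (A i (u I))))"
      unfolding comp[OF that] tensor_op_apply
      by (rule sum.cong) (use BB[OF that] AA[OF that] in auto)
    then show "?t i j J = (- ?t j i) J"
      unfolding comp[OF that(2,1)] by (simp add: tensor_op_apply sum_negf)
  qed
  have lin: "tensor_op n sM (A i) (B i) (\<Sum>j\<in>C. tensor_op n sM (A j) (B j) u) = (\<Sum>j\<in>C. ?t i j)" if "i \<in> C" for i
  proof -
    interpret t: Vector_Spaces.linear "tscale sM" "tscale sM" "tensor_op n sM (A i) (B i)"
      using tensor_op_linear[OF A[OF that]] .
    show ?thesis by (rule t.sum)
  qed
  have "(\<Sum>i\<in>C. \<Sum>j\<in>C. ?t i j) = (\<Sum>j\<in>C. \<Sum>i\<in>C. ?t i j)" by (rule sum.swap)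
  also have "\<dots> = - (\<Sum>i\<in>C. \<Sum>j\<in>C. ?t i j)"
    unfolding sum_negf[symmetric] by (intro sum.cong refl anti)
  finally have "(\<Sum>i\<in>C. \<Sum>j\<in>C. ?t i j) = 0" by (rule M_double)
  then show ?thesis by (simp add: lin)
qed

end

section \<open>Reflections\<close>

text \<open>Sylvester's identity. \<open>?L\<close> and \<open>?L'\<close> are unipotent and inverse
  to each other, and conjugation by them turns \<open>?K\<close> into \<open>?R\<close>; both of
  these are block triangular, with the two determinants in question on the diagonal.\<close>

lemma det_one_plus_mult:
  fixes A :: "complex mat"
  assumes A: "A \<in> carrier_mat m n" and B: "B \<in> carrier_mat n m"
  shows "Determinant.det (1\<^sub>m n + B * A) = Determinant.det (1\<^sub>m m + A * B)"
proof -
  let ?L = "four_block_mat (1\<^sub>m n) (0\<^sub>m n m) A (1\<^sub>m m)"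
  let ?K = "four_block_mat (1\<^sub>m n + B * A) B (0\<^sub>m m n) (1\<^sub>m m)"
  let ?L' = "four_block_mat (1\<^sub>m n) (0\<^sub>m n m) (- A) (1\<^sub>m m)"
  let ?R = "four_block_mat (1\<^sub>m n) B (0\<^sub>m m n) (1\<^sub>m m + A * B)"
  have c: "?L \<in> carrier_mat (n + m) (n + m)" "?K \<in> carrier_mat (n + m) (n + m)" "?L' \<in> carrier_mat (n + m) (n + m)"
    using A B by auto
  have "?K * ?L' = four_block_mat (1\<^sub>m n) B (- A) (1\<^sub>m m)"
  proof -
    have "?K * ?L' = four_block_mat ((1\<^sub>m n + B * A) * 1\<^sub>m n + B * (- A)) ((1\<^sub>m n + B * A) * 0\<^sub>m n m + B * 1\<^sub>m m)
      (0\<^sub>m m n * 1\<^sub>m n + 1\<^sub>m m * (- A)) (0\<^sub>m m n * 0\<^sub>m n m + 1\<^sub>m m * 1\<^sub>m m)"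
      using A B by (intro mult_four_block_mat) auto
    also have "(1\<^sub>m n + B * A) * 1\<^sub>m n + B * (- A) = 1\<^sub>m n"
    proof -
      have "B * (- A) = - (B * A)" using A B by (intro uminus_mult_right_mat) auto
      then show ?thesis using A B by (intro eq_matI) auto
    qed
    also have "(1\<^sub>m n + B * A) * 0\<^sub>m n m + B * 1\<^sub>m m = B" using A B by auto
    also have "0\<^sub>m m n * 1\<^sub>m n + 1\<^sub>m m * (- A) = - A" using A by auto
    also have "0\<^sub>m m n * 0\<^sub>m n m + 1\<^sub>m m * 1\<^sub>m m = (1\<^sub>m m :: complex mat)" by auto
    finally show ?thesis .
  qed
  moreover have "?L * four_block_mat (1\<^sub>m n) B (- A) (1\<^sub>m m) = ?R"
  proof -
    have "?L * four_block_mat (1\<^sub>m n) B (- A) (1\<^sub>m m)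
      = four_block_mat (1\<^sub>m n * 1\<^sub>m n + 0\<^sub>m n m * (- A)) (1\<^sub>m n * B + 0\<^sub>m n m * 1\<^sub>m m)
        (A * 1\<^sub>m n + 1\<^sub>m m * (- A)) (A * B + 1\<^sub>m m * 1\<^sub>m m)"
      using A B by (intro mult_four_block_mat) auto
    also have "1\<^sub>m n * 1\<^sub>m n + 0\<^sub>m n m * (- A) = 1\<^sub>m n" using A by auto
    also have "1\<^sub>m n * B + 0\<^sub>m n m * 1\<^sub>m m = B" using B by auto
    also have "A * 1\<^sub>m n + 1\<^sub>m m * (- A) = 0\<^sub>m m n" using A by (intro eq_matI) auto
    also have "A * B + 1\<^sub>m m * 1\<^sub>m m = 1\<^sub>m m + A * B" using A B by (intro eq_matI) auto
    finally show ?thesis .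
  qed
  ultimately have "Determinant.det (?L * (?K * ?L')) = Determinant.det ?R" by simp
  moreover have "Determinant.det (?L * (?K * ?L')) = Determinant.det ?L * (Determinant.det ?K * Determinant.det ?L')"
    using c by (simp add: Determinant.det_mult[of _ "n + m"])
  moreover have "Determinant.det ?L = 1" "Determinant.det ?L' = 1"
    using A by (subst det_four_block_mat_upper_right_zero[of _ n _ m]; auto)+
  moreover have "Determinant.det ?K = Determinant.det (1\<^sub>m n + B * A)"
    using A B by (subst det_four_block_mat_lower_left_zero[of _ n _ m]) auto
  moreover have "Determinant.det ?R = Determinant.det (1\<^sub>m m + A * B)"
    using A B by (subst det_four_block_mat_lower_left_zero[of _ n _ m]) auto
  ultimately show ?thesis by simp
qed

lemma det_one_plus_rank_one:
  fixes a b :: "nat \<Rightarrow> complex"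
  shows "Determinant.det (Matrix.mat n n (\<lambda>(i, j). (if i = j then 1 else 0) + b i * a j)) = 1 + (\<Sum>k<n. a k * b k)"
proof -
  let ?B = "Matrix.mat n 1 (\<lambda>(i, j). b i)" and ?A = "Matrix.mat 1 n (\<lambda>(i, j). a j)"
  have "Matrix.mat n n (\<lambda>(i, j). (if i = j then 1 else 0) + b i * a j) = 1\<^sub>m n + ?B * ?A"
    by (rule eq_matI) (auto simp: scalar_prod_def)
  moreover have "Determinant.det (1\<^sub>m 1 + ?A * ?B) = 1 + (\<Sum>k<n. a k * b k)"
    by (subst det_single) (auto simp: scalar_prod_def lessThan_atLeast0)
  ultimately show ?thesis using det_one_plus_mult[of ?A 1 n ?B] by simp
qed

context cherednik_data
begin

lemma GL_simps [simp]: "g \<otimes>\<^bsub>GL d\<^esub> h = g \<circ> h" "\<one>\<^bsub>GL d\<^esub> = id"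
  by (simp_all add: GL_def)

lemma group_GL: "group (GL d)"
proof (rule groupI)
  show "g \<otimes>\<^bsub>GL d\<^esub> h \<in> carrier (GL d)" if "g \<in> carrier (GL d)" "h \<in> carrier (GL d)" for g h
    using GL_carrierD[OF that(1)] GL_carrierD[OF that(2)]
    by (auto simp: GL_def intro: Vector_Spaces.linear_compose bij_comp)
  show "\<one>\<^bsub>GL d\<^esub> \<in> carrier (GL d)"
    using linear_id bij_id by (simp add: GL_def id_def)
  show "\<exists>h\<in>carrier (GL d). h \<otimes>\<^bsub>GL d\<^esub> g = \<one>\<^bsub>GL d\<^esub>" if "g \<in> carrier (GL d)" for g
    using GL_carrierD[OF that] inv_linear[OF that]
    by (intro bexI[of _ "inv_into UNIV g"]) (auto simp: GL_def bij_imp_bij_inv bij_is_inj)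
qed (auto simp: GL_def)

sublocale GL: group "GL d" by (rule group_GL)

abbreviation "W_group \<equiv> GL d\<lparr>carrier := refl_group d\<rparr>"

lemma group_W: "group W_group"
  by (rule GL.subgroup_imp_group[OF W_subgroup])

lemma W_closed:
  "g \<in> refl_group d \<Longrightarrow> h \<in> refl_group d \<Longrightarrow> g \<circ> h \<in> refl_group d" "id \<in> refl_group d"
  using subgroup.m_closed[OF W_subgroup, of g h] subgroup.one_closed[OF W_subgroup] by simp_all

lemma W_carrier: "g \<in> refl_group d \<Longrightarrow> g \<in> carrier (GL d)"
  using subgroup.mem_carrier[OF W_subgroup] .

lemmas W_linear = GL_carrierD(1)[OF W_carrier] and W_bij = GL_carrierD(2)[OF W_carrier]

lemma reflection_in_W: "s \<in> reflections d \<Longrightarrow> s \<in> refl_group d"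
  by (simp add: reflections_def)

lemma W_funpow: "g \<in> refl_group d \<Longrightarrow> g ^^ k \<in> refl_group d"
  by (induction k) (auto simp: W_closed)

text \<open>The data give only that the root vanishes on the fixed space. Equality follows from
  dimensions: the fixed space is a hyperplane, and the kernel of a nonzero functional is a proper
  subspace, hence no larger.\<close>

lemma reflection_fixed_space:
  assumes s: "s \<in> reflections d"
  shows "s v = v \<longleftrightarrow> root d s v = 0"
proof -
  interpret fin: finite_dimensional_vector_space "h_scale d" "y_basis d ` {..<dim_h d}"
    by unfold_locales (auto simp: y_independent y_span)
  have dimU: "dim UNIV = dim_h d" by (simp add: fin.dim_UNIV card_image y_inj)
  note lin = W_linear[OF reflection_in_W[OF s]]
  note dual = dualD[OF root_dual[OF s]]
  let ?H = "{v. s v = v}" and ?K = "{v. root d s v = 0}"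
  have H: "subspace ?H" by (rule subspaceI) (auto simp: h_linearD[OF lin])
  have K: "subspace ?K" by (rule subspaceI) (auto simp: dual)
  have HK: "?H \<subseteq> ?K" using root_vanishes[OF s] by auto
  obtain v0 where v0: "root d s v0 \<noteq> 0" using root_nonzero[OF s] by blast
  have "v0 \<notin> ?K" using v0 by simp
  then have "?K \<noteq> UNIV" by blast
  then have "dim ?K \<noteq> dim_h d"
    using fin.subspace_dim_equal[OF K subspace_UNIV subset_UNIV] dimU by fastforce
  moreover have "dim ?K \<le> dim_h d" using fin.dim_subset[OF subset_UNIV, of ?K] unfolding dimU .
  moreover have "dim ?H + 1 = dim_h d" using s by (simp add: reflections_def)
  ultimately have "dim ?K \<le> dim ?H" by simp
  then have "?H = ?K" using fin.subspace_dim_equal[OF H K HK] by blast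
  then show ?thesis by blast
qed

text \<open>A reflection differs from the identity by a rank one map along a vector \<open>u\<close>; the coroot is a
  multiple of \<open>u\<close>, and \<open>u\<close> is not fixed because a transvection has infinite order.\<close>

lemma reflection_formula:
  assumes s: "s \<in> reflections d"
  shows "root d s (coroot d s) \<noteq> 0" "det_h d s \<noteq> 0"
    "s v = v + h_scale d ((det_h d s - 1) / root d s (coroot d s) * root d s v) (coroot d s)"
proof -
  note W = reflection_in_W[OF s]
  note lin = h_linearD[OF W_linear[OF W]]
  note dual = dualD[OF root_dual[OF s]]
  let ?\<alpha> = "root d s"
  obtain v1 where v1: "?\<alpha> v1 \<noteq> 0" using root_nonzero[OF s] by blast
  \<comment> \<open>Normalized so that the root takes the value 1. The displacement \<open>u\<close>
    of \<open>v0\<close> then determines \<open>s\<close>, since subtracting the right multiple of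
    \<open>v0\<close> from any \<open>v\<close> gives a fixed vector.\<close>
  define v0 where "v0 = h_scale d (1 / ?\<alpha> v1) v1"
  have v0: "?\<alpha> v0 = 1" using v1 by (simp add: v0_def dual)
  define u where "u = s v0 - v0"
  have u0: "u \<noteq> 0"
  proof
    assume "u = 0"
    then have "s v0 = v0" by (simp add: u_def)
    then show False using root_vanishes[OF s] v0 by fastforce
  qed
  have su: "s v = v + h_scale d (?\<alpha> v) u" for v
  proof -
    have "?\<alpha> (v - h_scale d (?\<alpha> v) v0) = 0" by (simp add: dual v0)
    then have "s (v - h_scale d (?\<alpha> v) v0) = v - h_scale d (?\<alpha> v) v0"
      using reflection_fixed_space[OF s] by blast
    then have "s v - h_scale d (?\<alpha> v) (s v0) = v - h_scale d (?\<alpha> v) v0" by (simp add: lin)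
    then show ?thesis by (simp add: u_def scale_right_diff_distrib algebra_simps)
  qed
  \<comment> \<open>A functional killing \<open>u\<close> is fixed by \<open>s\<close>. If the
    coroot were independent of \<open>u\<close>, such a functional could take the value 1 on it,
    against \<open>coroot_vanishes\<close>.\<close>
  have "coroot d s \<in> span {u}"
  proof (rule ccontr)
    assume "coroot d s \<notin> span {u}"
    moreover have "independent {u}" using u0 by (simp add: dependent_single)
    ultimately have ind: "independent {coroot d s, u}" by (rule independent_insertI)
    interpret C: vector_space "(*) :: complex \<Rightarrow> complex \<Rightarrow> complex" by (rule vector_space_complex)
    interpret vp: vector_space_pair "h_scale d" "(*) :: complex \<Rightarrow> complex \<Rightarrow> complex" ..
    obtain \<xi> where \<xi>: "Vector_Spaces.linear (h_scale d) (*) \<xi>"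
      "\<forall>x\<in>{coroot d s, u}. \<xi> x = (if x = u then 0 else 1)"
      using vp.linear_independent_extend[OF ind, of "\<lambda>x. if x = u then 0 else 1"] by auto
    have ne: "coroot d s \<noteq> u" using \<open>coroot d s \<notin> span {u}\<close> span_base[of u "{u}"] by auto
    have \<xi>d: "\<xi> \<in> dual d" using \<xi>(1) by (simp add: dual_def)
    have "\<xi> (s v) = \<xi> v" for v using \<xi>(2) by (simp add: su dualD[OF \<xi>d])
    then have "\<xi> (inv_into UNIV s v) = \<xi> v" for v
      by (metis W_bij[OF W] bij_inv_eq_iff)
    then have "dual_action s \<xi> = \<xi>" by (simp add: dual_action_def fun_eq_iff)
    then have "\<xi> (coroot d s) = 0" by (rule coroot_vanishes[OF s \<xi>d])
    then show False using \<xi>(2) ne by simp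
  qed
  then obtain k where k: "coroot d s = h_scale d k u" by (auto simp: span_singleton)
  have k0: "k \<noteq> 0" using coroot_nonzero[OF s] k by auto
  have \<alpha>u: "?\<alpha> u \<noteq> 0"
  proof
    assume 0: "?\<alpha> u = 0"
    have pow: "(s ^^ m) v0 = v0 + h_scale d (of_nat m) u" for m
      by (induction m) (auto simp: su dual v0 0 lin scale_left_distrib)
    have "inj (\<lambda>m. s ^^ m)"
    proof (rule injI)
      fix m m' assume "s ^^ m = s ^^ m'"
      then have "(s ^^ m) v0 = (s ^^ m') v0" by (rule fun_cong)
      then have "h_scale d (of_nat m) u = h_scale d (of_nat m') u" by (simp only: pow add_left_cancel)
      then have "(of_nat m :: complex) = of_nat m'" using u0 by (simp only: scale_cancel_right simp_thms)
      then show "m = m'" by simp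
    qed
    moreover have "range (\<lambda>m. s ^^ m) \<subseteq> refl_group d" using W_funpow[OF W] by auto
    ultimately show False using range_inj_infinite finite_subset[OF _ W_finite] by metis
  qed
  have det: "det_h d s = 1 + ?\<alpha> u"
  proof -
    have "Matrix.mat (dim_h d) (dim_h d) (\<lambda>(i, j). x_basis d i (s (y_basis d j)))
      = Matrix.mat (dim_h d) (dim_h d) (\<lambda>(i, j). (if i = j then 1 else 0) + x_basis d i u * ?\<alpha> (y_basis d j))"
      by (rule eq_matI) (auto simp: su dualD[OF x_dual] x_y)
    then have "det_h d s = 1 + (\<Sum>k<dim_h d. ?\<alpha> (y_basis d k) * x_basis d k u)"
      by (simp only: det_h_def det_one_plus_rank_one)
    also have "\<dots> = 1 + ?\<alpha> u"
      by (subst dual_expansion[OF root_dual[OF s], of u]) (simp only: mult.commute)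
    finally show ?thesis .
  qed
  show a: "?\<alpha> (coroot d s) \<noteq> 0" using k k0 \<alpha>u by (simp add: dual)
  show "det_h d s \<noteq> 0"
  proof
    assume "det_h d s = 0"
    \<comment> \<open>\<open>u\<close> is an eigenvector of \<open>s\<close> whose eigenvalue
      \<open>1 + ?\<alpha> u\<close> is the determinant.\<close>
    then have "s u = h_scale d 0 u" using scale_left_distrib[of 1 "?\<alpha> u" u] by (simp add: su det)
    then have "s u = s 0" by (simp add: lin)
    then show False using u0 W_bij[OF W] by (metis bij_is_inj injD)
  qed
  show "s v = v + h_scale d ((det_h d s - 1) / root d s (coroot d s) * root d s v) (coroot d s)"
    using k0 \<alpha>u by (simp add: su[of v] k dual det)
qed

end

section \<open>The spin representation\<close>

lemma poly_mapping_expansion: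
  "(f :: 'a \<Rightarrow>\<^sub>0 'b::comm_monoid_add) = (\<Sum>w\<in>Poly_Mapping.keys f. Poly_Mapping.single w (Poly_Mapping.lookup f w))"
proof (rule poly_mapping_eqI)
  fix k
  have "Poly_Mapping.lookup (\<Sum>w\<in>Poly_Mapping.keys f. Poly_Mapping.single w (Poly_Mapping.lookup f w)) k
    = (\<Sum>w\<in>Poly_Mapping.keys f. if w = k then Poly_Mapping.lookup f k else 0)"
    unfolding Poly_Mapping.lookup_sum by (rule sum.cong) (auto simp: Poly_Mapping.lookup_single)
  also have "\<dots> = Poly_Mapping.lookup f k"
    by (simp add: in_keys_iff)
  finally show "Poly_Mapping.lookup f k
    = Poly_Mapping.lookup (\<Sum>w\<in>Poly_Mapping.keys f. Poly_Mapping.single w (Poly_Mapping.lookup f w)) k" ..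
qed

lemma scal_commute: "scal a * f = f * scal a"
proof -
  have *: "scal a * Poly_Mapping.single w c = Poly_Mapping.single w c * scal a" for w and c :: complex
    by (simp add: scal_def Poly_Mapping.mult_single mult.commute)
  show ?thesis
    by (subst (1 2) poly_mapping_expansion[of f]) (simp only: sum_distrib_left sum_distrib_right *)
qed

lemma scal_uminus: "scal (- a) = - scal a"
  by (simp add: scal_def Poly_Mapping.single_uminus)

lemma scal_sum: "scal (\<Sum>i\<in>C. f i) = (\<Sum>i\<in>C. scal (f i))"
  by (induction C rule: infinite_finite_induct) (auto simp: scal_zero scal_add)

context presentation
begin

lemma cong_uminus: "f \<doteq> g \<Longrightarrow> - f \<doteq> - g"
  using J_uminus[of "f - g"] by (simp add: cong_J_def free_algebra_closed)

lemma cong_scal: "f \<doteq> g \<Longrightarrow> scal a * f \<doteq> scal a * g"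
  by (intro cong_mult cong_refl free_algebra_closed)

lemma cong_half:
  assumes "f + f \<doteq> 0" shows "f \<doteq> 0"
proof -
  have "scal (1/2) * (f + f) = f"
    by (simp add: distrib_left distrib_right[symmetric] scal_add[symmetric] scal_one)
  then show ?thesis using cong_scal[OF assms, of "1/2"] by simp
qed

text \<open>The Clifford relations are imposed on basis vectors; bilinearity carries them over to
  linear combinations. Scalars are multiples of the empty word and have to be moved through the
  products.\<close>

lemma cong_anticommutator:
  assumes p: "p \<doteq> (\<Sum>i\<in>C. scal (a i) * P i)" and q: "q \<doteq> (\<Sum>j\<in>E. scal (b j) * S j)"
    and PS: "\<And>i j. i \<in> C \<Longrightarrow> j \<in> E \<Longrightarrow> P i * S j + S j * P i \<doteq> scal (c i j)"
  shows "p * q + q * p \<doteq> scal (\<Sum>i\<in>C. \<Sum>j\<in>E. a i * b j * c i j)"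
proof -
  let ?p = "\<Sum>i\<in>C. scal (a i) * P i" and ?q = "\<Sum>j\<in>E. scal (b j) * S j"
  have comm: "scal x * f * (scal y * g) = scal (x * y) * (f * g)" for x y :: complex and f g
    by (metis (no_types, lifting) mult.assoc scal_commute scal_mult)
  have "?p * ?q + ?q * ?p = (\<Sum>i\<in>C. \<Sum>j\<in>E. scal (a i * b j) * (P i * S j)) + (\<Sum>j\<in>E. \<Sum>i\<in>C. scal (b j * a i) * (S j * P i))"
    by (simp add: sum_product comm)
  also have "(\<Sum>j\<in>E. \<Sum>i\<in>C. scal (b j * a i) * (S j * P i)) = (\<Sum>i\<in>C. \<Sum>j\<in>E. scal (a i * b j) * (S j * P i))"
    by (subst sum.swap) (simp add: mult.commute[of "b _"])
  finally have "?p * ?q + ?q * ?p = (\<Sum>i\<in>C. \<Sum>j\<in>E. scal (a i * b j) * (P i * S j + S j * P i))"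
    by (simp add: sum.distrib distrib_left)
  moreover have "(\<Sum>i\<in>C. \<Sum>j\<in>E. scal (a i * b j) * (P i * S j + S j * P i))
      \<doteq> (\<Sum>i\<in>C. \<Sum>j\<in>E. scal (a i * b j) * scal (c i j))"
    by (intro cong_sum cong_scal PS)
  ultimately have "?p * ?q + ?q * ?p \<doteq> scal (\<Sum>i\<in>C. \<Sum>j\<in>E. a i * b j * c i j)"
    by (simp only: scal_sum scal_mult)
  moreover have "p * q + q * p \<doteq> ?p * ?q + ?q * ?p"
    using p q by (intro cong_add cong_mult)
  ultimately show ?thesis by (blast intro: cong_trans)
qed

end

section \<open>The action of the free algebra on spinors and its descent to the Clifford
  algebra\<close>

lemma spinor_linear_spin_letter: "spinor_linear (spin_letter d p)"
proof (rule spinor_linearI)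
  note L = spinor_linearD[OF spinor_linear_wedge] spinor_linearD[OF spinor_linear_contraction]
  show "spin_letter d p (s + t) = spin_letter d p s + spin_letter d p t" for s t
    by (rule ext) (simp add: spin_letter_def L algebra_simps)
  show "spin_letter d p (cscale a s) = cscale a (spin_letter d p s)" for a s
    by (rule ext) (simp add: spin_letter_def L algebra_simps)
qed

lemma spinor_linear_spin_word: "spinor_linear (foldr (spin_letter d) w)"
proof (induction w)
  case Nil
  show ?case by (rule spinor_linearI) auto
next
  case (Cons p w)
  show ?case
    unfolding foldr.simps o_def by (rule spinor_linear_compose[OF spinor_linear_spin_letter Cons])
qed

lemma spin_letter_stable: "spin_letter d p s \<in> tensor_space (dim_h d)"
  unfolding spin_letter_def
  by (intro spinors.subspace_add[OF subspace_spinors] spinors.subspace_scale[OF subspace_spinors]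
      wedge_stable contraction_stable)

lemma spin_word_stable:
  "s \<in> tensor_space (dim_h d) \<Longrightarrow> foldr (spin_letter d) w s \<in> tensor_space (dim_h d)"
  by (induction w) (auto simp: spin_letter_stable)

lemma spin_free_superset:
  assumes "finite K" "Poly_Mapping.keys f \<subseteq> K"
  shows "spin_free d f s = (\<Sum>w\<in>K. cscale (Poly_Mapping.lookup f w) (foldr (spin_letter d) (letters w) s))"
  unfolding spin_free_def
  by (rule sum.mono_neutral_left[OF assms]) (auto simp: in_keys_iff)

lemma spin_free_add: "spin_free d (f + g) s = spin_free d f s + spin_free d g s"
proof -
  let ?K = "Poly_Mapping.keys f \<union> Poly_Mapping.keys g"
  have "Poly_Mapping.keys (f + g) \<subseteq> ?K" by (rule Poly_Mapping.keys_add)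
  then show ?thesis
    by (simp add: spin_free_superset[of ?K] Poly_Mapping.lookup_add spinors.scale_left_distrib sum.distrib)
qed

lemma spin_free_zero: "spin_free d 0 s = 0"
  by (simp add: spin_free_def)

lemma spin_free_sum: "spin_free d (\<Sum>i\<in>C. f i) s = (\<Sum>i\<in>C. spin_free d (f i) s)"
  by (induction C rule: infinite_finite_induct) (auto simp: spin_free_zero spin_free_add)

lemma spin_free_single:
  "spin_free d (Poly_Mapping.single w c) s = cscale c (foldr (spin_letter d) (letters w) s)"
  by (cases "c = 0") (auto simp: spin_free_def)

lemma spin_free_letter: "spin_free d (letter p) s = spin_letter d p s"
  by (simp add: letter_def spin_free_single)

lemma spin_free_scal: "spin_free d (scal a) s = cscale a s"
  by (simp add: scal_def spin_free_single zero_word_def)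

lemma spin_free_one: "spin_free d 1 s = s"
  using spin_free_scal[of d 1 s] by (simp add: scal_one)

lemma spinor_linear_spin_free: "spinor_linear (spin_free d f)"
proof -
  have "spinor_linear (\<lambda>s. cscale c (foldr (spin_letter d) w s))" for c w
    using spinor_linear_spin_word by (rule spinor_pair.linear_compose_scale_right)
  then show ?thesis
    unfolding spin_free_def by (rule spinor_pair.linear_compose_sum[rule_format])
qed

lemma spin_free_mult: "spin_free d (f * g) s = spin_free d f (spin_free d g s)"
proof -
  note L = spinor_linearD[OF spinor_linear_spin_word]
  let ?m = "\<lambda>f w. Poly_Mapping.single w (Poly_Mapping.lookup f w)"
  have m: "spin_free d (?m f v * ?m g w) s = spin_free d (?m f v) (spin_free d (?m g w) s)" for v w
    by (simp add: Poly_Mapping.mult_single spin_free_single plus_word_def L)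
  have "f * g = (\<Sum>v\<in>Poly_Mapping.keys f. \<Sum>w\<in>Poly_Mapping.keys g. ?m f v * ?m g w)"
    by (subst (1) poly_mapping_expansion[of f], subst (1) poly_mapping_expansion[of g]) (rule sum_product)
  then have "spin_free d (f * g) s
    = (\<Sum>v\<in>Poly_Mapping.keys f. \<Sum>w\<in>Poly_Mapping.keys g. spin_free d (?m f v) (spin_free d (?m g w) s))"
    by (simp only: spin_free_sum m)
  also have "\<dots> = (\<Sum>v\<in>Poly_Mapping.keys f. spin_free d (?m f v) (spin_free d g s))"
    by (simp only: spinor_linearD(6)[OF spinor_linear_spin_free, symmetric] spin_free_sum[symmetric]
        poly_mapping_expansion[of g, symmetric])
  also have "\<dots> = spin_free d f (spin_free d g s)"
    by (simp only: spin_free_sum[symmetric] poly_mapping_expansion[of f, symmetric])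
  finally show ?thesis .
qed

lemma spin_free_uminus: "spin_free d (- f) s = - spin_free d f s"
  using spin_free_add[of d f "- f" s] by (simp add: spin_free_zero eq_neg_iff_add_eq_0 add.commute)

lemma spin_free_diff: "spin_free d (f - g) s = spin_free d f s - spin_free d g s"
  using spin_free_add[of d f "- g" s] by (simp add: spin_free_uminus)

lemma spin_free_stable:
  "s \<in> tensor_space (dim_h d) \<Longrightarrow> spin_free d f s \<in> tensor_space (dim_h d)"
  unfolding spin_free_def
  by (intro spinors.subspace_sum[OF subspace_spinors] spinors.subspace_scale[OF subspace_spinors] spin_word_stable)

context cherednik_data
begin

lemma contraction_zero_functional: "contraction d (\<lambda>_. 0) s = 0"
  by (rule ext) (simp add: contraction_apply)

lemma contraction_combination:
  "contraction d (\<lambda>z. a * \<xi> z + b * \<eta> z) s = cscale a (contraction d \<xi> s) + cscale b (contraction d \<eta> s)"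
  by (rule ext) (simp add: contraction_apply sum.distrib sum_distrib_left algebra_simps)

lemma spin_in_h: "spin_letter d (in_h y) s = wedge d y s"
  by (simp add: spin_letter_def in_h_def contraction_zero_functional)

lemma spin_in_dual: "spin_letter d (in_dual \<xi>) s = cscale 2 (contraction d \<xi> s)"
  by (simp add: spin_letter_def in_dual_def wedge_zero)

lemma spin_letter_combination:
  "spin_letter d (h_scale d a u + h_scale d b v, \<lambda>z. a * \<xi> z + b * \<eta> z) s
    = cscale a (spin_letter d (u, \<xi>) s) + cscale b (spin_letter d (v, \<eta>) s)"
  by (rule ext) (simp add: spin_letter_def contraction_combination wedge_add wedge_scale algebra_simps)

lemma zero_dual: "(\<lambda>_. 0) \<in> dual d"
  by (simp add: dual_def Vector_Spaces.linear_iff vector_space_axioms vector_space_complex)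

lemma dual_combination:
  "\<xi> \<in> dual d \<Longrightarrow> \<eta> \<in> dual d \<Longrightarrow> (\<lambda>z. a * \<xi> z + b * \<eta> z) \<in> dual d"
  by (auto simp: dual_def Vector_Spaces.linear_iff vector_space_axioms vector_space_complex algebra_simps)

lemma in_V_space: "in_h y \<in> V_space d" "\<xi> \<in> dual d \<Longrightarrow> in_dual \<xi> \<in> V_space d"
  "\<xi> \<in> dual d \<Longrightarrow> (y, \<xi>) \<in> V_space d"
  by (auto simp: in_h_def in_dual_def V_space_def zero_dual)

lemma linear_relations_closed:
  assumes "\<And>p. p \<in> V_space d \<Longrightarrow> j p \<in> G"
  shows "linear_relations d j \<subseteq> carrier (free_algebra G)"
  unfolding linear_relations_def
  by (auto intro!: free_algebra_closed assms in_V_space dual_combination)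

lemma clifford_relations_closed: "clifford_relations d \<subseteq> carrier (free_algebra (V_space d))"
  using linear_relations_closed[of id "V_space d"]
  by (auto simp: clifford_relations_def intro!: free_algebra_closed in_V_space x_dual)

sublocale Cl: presentation "V_space d" "clifford_relations d"
  by unfold_locales (rule clifford_relations_closed)

lemma clifford_algebra_eq: "clifford_algebra d = Cl.Q" and cliff_class_eq: "cliff_class d = Cl.cl"
  by (simp_all add: clifford_algebra_def cliff_class_def fun_eq_iff)

text \<open>The factor 2 in front of the contraction matches the constant of the mixed relation.
  Spinors are confined to \<open>tensor_space\<close> because outside it the identity
  \<open>contraction_wedge\<close> can fail.\<close>

lemma spin_relation:
  assumes "r \<in> clifford_relations d" and s: "s \<in> tensor_space (dim_h d)"
  shows "spin_free d r s = 0"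
proof -
  note simps = spin_free_diff spin_free_add spin_free_mult spin_free_letter spin_free_scal spin_in_h spin_in_dual
  consider a u b v \<xi> \<eta> where "r = letter (h_scale d a u + h_scale d b v, \<lambda>z. a * \<xi> z + b * \<eta> z)
        - scal a * letter (u, \<xi>) - scal b * letter (v, \<eta>)"
    | i j where "r = Xc (x_basis d i) * Xc (x_basis d j) + Xc (x_basis d j) * Xc (x_basis d i)"
    | i j where "r = Yc (y_basis d i) * Yc (y_basis d j) + Yc (y_basis d j) * Yc (y_basis d i)"
    | i j where "i < dim_h d" "j < dim_h d" "r = Xc (x_basis d i) * Yc (y_basis d j)
        + Yc (y_basis d j) * Xc (x_basis d i) + scal (if i = j then 2 else 0)"
    using assms(1) unfolding clifford_relations_def linear_relations_def id_apply by blast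
  then show ?thesis
  proof cases
    case 1
    show ?thesis unfolding 1 simps spin_letter_combination by (rule ext) simp
  next
    case 2
    show ?thesis unfolding 2 simps spinor_linearD(2)[OF spinor_linear_contraction]
      by (subst contraction_contraction) (rule ext, simp)
  next
    case 3
    show ?thesis unfolding 3 simps by (subst wedge_wedge) (rule ext, simp)
  next
    case 4
    have "contraction d (x_basis d i) (wedge d (y_basis d j) s) I
        = - x_basis d i (y_basis d j) * s I - wedge d (y_basis d j) (contraction d (x_basis d i) s) I" for I
      using fun_cong[OF contraction_wedge[OF s x_dual[OF 4(1)], of "y_basis d j"], of I]
      by (simp add: algebra_simps)
    then show ?thesis unfolding 4(3) simps spinor_linearD(2)[OF spinor_linear_wedge] fun_eq_iff
        plus_fun_apply cscale_apply
      by (simp only: x_y[OF 4(1,2)]) (simp add: algebra_simps)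
  qed
qed

text \<open>The elements acting as zero on spinors form a two-sided ideal, by multiplicativity of
  the action and stability of the spinor space. It contains the relations, hence the ideal generated
  by them.\<close>

lemma spin_free_ideal:
  assumes "f \<in> Cl.J" and s: "s \<in> tensor_space (dim_h d)"
  shows "spin_free d f s = 0"
proof -
  let ?K = "{f \<in> carrier Cl.Fr. \<forall>s\<in>tensor_space (dim_h d). spin_free d f s = 0}"
  have "ideal ?K Cl.Fr"
  proof (rule idealI)
    have "\<ominus>\<^bsub>Cl.Fr\<^esub> f = - f" if "f \<in> carrier Cl.Fr" for f
      using Cl.Fr.minus_equality[of "- f" f] that by (simp add: free_algebra_closed)
    then show "subgroup ?K (add_monoid Cl.Fr)"
      by (intro Cl.Fr.add.subgroupI)
        (auto simp: free_algebra_closed spin_free_zero spin_free_add spin_free_uminus a_inv_def[symmetric])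
  qed (auto simp: free_algebra_closed spin_free_mult spin_free_stable Cl.Fr.ring_axioms
        spinor_linearD(3)[OF spinor_linear_spin_free])
  moreover have "clifford_relations d \<subseteq> ?K"
    using spin_relation clifford_relations_closed by auto
  ultimately have "Cl.J \<subseteq> ?K" by (rule Cl.J_minimal)
  then show ?thesis using assms by auto
qed

text \<open>Two representatives of a class differ by an element of the ideal, so the choice made
  inside \<open>spin\<close> does not matter.\<close>

lemma spin_class:
  assumes "f \<in> carrier Cl.Fr" and s: "s \<in> tensor_space (dim_h d)"
  shows "spin d (cliff_class d f) s = spin_free d f s"
proof -
  define g where "g = (SOME g. g \<in> Cl.cl f)"
  have "g \<in> Cl.cl f" unfolding g_def by (rule someI) (rule Cl.self_in_cl[OF assms(1)])
  then have "spin_free d (g - f) s = 0"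
    using Cl.mem_clD[OF assms(1)] spin_free_ideal s by blast
  then show ?thesis by (simp add: spin_def cliff_class_eq g_def[symmetric] spin_free_diff)
qed

lemma spinor_linear_spin: "spinor_linear (spin d a)"
  unfolding spin_def by (rule spinor_linear_spin_free)

lemma spin_mult:
  assumes "a \<in> carrier (clifford_algebra d)" "b \<in> carrier (clifford_algebra d)" "s \<in> tensor_space (dim_h d)"
  shows "spin d (a \<otimes>\<^bsub>clifford_algebra d\<^esub> b) s = spin d a (spin d b s)"
proof -
  obtain f g where fg: "f \<in> carrier Cl.Fr" "a = Cl.cl f" "g \<in> carrier Cl.Fr" "b = Cl.cl g"
    using Cl.carrier_Q_obtain assms(1,2) unfolding clifford_algebra_eq by metis
  have "a \<otimes>\<^bsub>clifford_algebra d\<^esub> b = cliff_class d (f * g)"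
    using fg by (simp add: Cl.cl_mult clifford_algebra_eq cliff_class_eq)
  then show ?thesis
    using fg assms(3)
    by (simp add: spin_class free_algebra_closed spin_free_mult spin_free_stable cliff_class_eq[symmetric])
qed

lemma spin_one: "s \<in> tensor_space (dim_h d) \<Longrightarrow> spin d \<one>\<^bsub>clifford_algebra d\<^esub> s = s"
  using spin_class[of 1 s] by (simp add: Cl.cl_one clifford_algebra_eq cliff_class_eq free_algebra_closed spin_free_one)

end

section \<open>The double cover\<close>

context presentation
begin

lemma cong_relation: "r \<in> R \<Longrightarrow> r \<doteq> 0"
  using relation_in_J relations_closed by (auto simp: cong_J_def free_algebra_closed)

lemma cong_rearrange: "f + g \<doteq> h \<Longrightarrow> g \<in> carrier Fr \<Longrightarrow> f \<doteq> h - g"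
  using cong_add[of "f + g" h "- g" "- g"] by (simp add: cong_refl free_algebra_closed)

lemma cong_diff: "f \<doteq> f' \<Longrightarrow> g \<doteq> g' \<Longrightarrow> f - g \<doteq> f' - g'"
  using cong_add[OF _ cong_uminus, of f f' g g'] by simp

text \<open>The element \<open>e = A B\<close> satisfies \<open>e\<^sup>2 = - 2 a e\<close>.\<close>

lemma clifford_pair_product:
  assumes AA: "A * A \<doteq> 0" and BB: "B * B \<doteq> 0" and AB: "A * B + B * A \<doteq> scal (- 2 * a)"
    and carr: "A \<in> carrier Fr" "B \<in> carrier Fr"
  shows "(scal k * A * B + scal q) * (scal k' * A * B + scal q')
    \<doteq> scal (- 2 * a * k * k' + k * q' + q * k') * (A * B) + scal (q * q')"
proof -
  let ?e = "A * B"
  have "?e * ?e = A * (A * B + B * A) * B - (A * A) * (B * B)"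
    by (simp add: algebra_simps)
  moreover have "\<dots> \<doteq> A * scal (- 2 * a) * B - 0 * 0"
    by (intro cong_diff cong_mult cong_refl carr AA BB AB)
  moreover have "A * scal (- 2 * a) * B - 0 * 0 = scal (- 2 * a) * ?e"
    by (simp only: scal_commute[symmetric] mult.assoc) simp
  ultimately have ee: "?e * ?e \<doteq> scal (- 2 * a) * ?e" by simp
  have comm: "f * (scal x * g) = scal x * (f * g)" "scal x * (scal y * f) = scal (x * y) * f" for x y f g
    by (metis mult.assoc scal_commute, simp add: mult.assoc[symmetric] scal_mult)
  have "(scal k * A * B + scal q) * (scal k' * A * B + scal q')
    = scal (k * k') * (?e * ?e) + (scal (k * q') + scal (q * k')) * ?e + scal (q * q')"
  proof -
    have "(scal k * ?e) * (scal k' * ?e) = scal (k * k') * (?e * ?e)"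
      by (simp only: mult.assoc[of "scal k" ?e] comm(1)[of ?e] comm(2))
    moreover have "(scal k * ?e) * scal q' = scal (k * q') * ?e"
      by (simp only: scal_commute[of q' "scal k * ?e", symmetric] comm(2) mult.commute[of q' k])
    moreover have "scal q * (scal k' * ?e) = scal (q * k') * ?e" by (rule comm(2))
    ultimately show ?thesis
      by (simp only: distrib_left distrib_right mult.assoc[of "scal k" A B] mult.assoc[of "scal k'" A B]
          scal_mult add.assoc add.left_commute)
  qed
  also have "\<dots> \<doteq> scal (k * k') * (scal (- 2 * a) * ?e) + (scal (k * q') + scal (q * k')) * ?e + scal (q * q')"
    by (intro cong_add cong_mult ee cong_refl free_algebra_closed carr)
  also have "scal (k * k') * (scal (- 2 * a) * ?e) + (scal (k * q') + scal (q * k')) * ?e + scal (q * q')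
    = scal (- 2 * a * k * k' + k * q' + q * k') * ?e + scal (q * q')"
  proof -
    have "- 2 * a * k * k' + k * q' + q * k' = k * k' * (- 2 * a) + (k * q' + q * k')" by simp
    then show ?thesis by (simp only: comm(2) scal_add distrib_right)
  qed
  finally show ?thesis .
qed

text \<open>With \<open>e = A * B\<close>, the coefficient of \<open>e\<close> in the product of
  \<open>k e + q\<close> and \<open>- k e + 1 / q\<close> is \<open>k (2 a k + 1 / q - q)\<close>.
  The condition on \<open>k\<close> makes it vanish; for \<open>a\<close> the pairing of root and
  coroot it is the normalization in \<open>mu_rep\<close>.\<close>

lemma clifford_pair_inverse:
  assumes "A * A \<doteq> 0" "B * B \<doteq> 0" "A * B + B * A \<doteq> scal (- 2 * a)" "A \<in> carrier Fr" "B \<in> carrier Fr"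
    and q: "q \<noteq> 0" and k: "2 * a * k = q - 1 / q"
  shows "(scal k * A * B + scal q) * (scal (- k) * A * B + scal (1 / q)) \<doteq> 1"
    "(scal (- k) * A * B + scal (1 / q)) * (scal k * A * B + scal q) \<doteq> 1"
proof -
  have "- 2 * a * k * - k + k * (1 / q) + q * - k = k * (2 * a * k) + k * (1 / q) - q * k" by simp
  also have "\<dots> = 0" unfolding k by (simp add: algebra_simps)
  finally have 1: "- 2 * a * k * - k + k * (1 / q) + q * - k = 0" .
  then have 2: "- 2 * a * - k * k + - k * q + 1 / q * k = 0" by (simp add: algebra_simps)
  show "(scal k * A * B + scal q) * (scal (- k) * A * B + scal (1 / q)) \<doteq> 1"
    using clifford_pair_product[OF assms(1-5), of k q "- k" "1 / q"] q
    unfolding 1 by (simp add: scal_zero scal_one)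
  show "(scal (- k) * A * B + scal (1 / q)) * (scal k * A * B + scal q) \<doteq> 1"
    using clifford_pair_product[OF assms(1-5), of "- k" "1 / q" k q] q
    unfolding 2 by (simp add: scal_zero scal_one)
qed

lemma cl_Unit:
  assumes "f * g \<doteq> 1" "g * f \<doteq> 1" "f \<in> carrier Fr" "g \<in> carrier Fr"
  shows "cl f \<in> Units Q"
  unfolding Units_def
  using assms cl_eq_cong[OF assms(1)] cl_eq_cong[OF assms(2)]
  by (auto simp: cl_closed cl_mult cl_one intro!: bexI[of _ "cl g"])

end

context cherednik_data
begin

section \<open>Clifford relations for arbitrary vectors and functionals\<close>

lemma letter_combination_cong:
  assumes "\<xi> \<in> dual d" "\<eta> \<in> dual d"
  shows "Cl.cong_J (letter (h_scale d a u + h_scale d b v, \<lambda>z. a * \<xi> z + b * \<eta> z))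
    (scal a * letter (u, \<xi>) + scal b * letter (v, \<eta>))"
proof -
  have "letter (h_scale d a u + h_scale d b v, \<lambda>z. a * \<xi> z + b * \<eta> z)
      - scal a * letter (u, \<xi>) - scal b * letter (v, \<eta>) \<in> clifford_relations d"
    using assms unfolding clifford_relations_def linear_relations_def id_apply by blast
  then have "Cl.cong_J (letter (h_scale d a u + h_scale d b v, \<lambda>z. a * \<xi> z + b * \<eta> z)
      - scal a * letter (u, \<xi>) - scal b * letter (v, \<eta>) + (scal a * letter (u, \<xi>) + scal b * letter (v, \<eta>)))
      (0 + (scal a * letter (u, \<xi>) + scal b * letter (v, \<eta>)))"
    by (intro Cl.cong_add Cl.cong_relation Cl.cong_refl free_algebra_closed in_V_space assms)
  then show ?thesis by (simp add: algebra_simps)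
qed

lemma dual_sum: "(\<And>i. \<xi> i \<in> dual d) \<Longrightarrow> (\<lambda>z. \<Sum>i<(n::nat). c i * \<xi> i z) \<in> dual d"
proof (induction n)
  case (Suc n)
  then show ?case using dual_combination[of "\<lambda>z. \<Sum>i<n. c i * \<xi> i z" "\<xi> n" 1 "c n"] by simp
qed (simp add: zero_dual)

lemma letter_sum_cong:
  fixes n :: nat
  assumes "\<And>i. \<xi> i \<in> dual d"
  shows "Cl.cong_J (letter (\<Sum>i<n. h_scale d (c i) (u i), \<lambda>z. \<Sum>i<n. c i * \<xi> i z))
    (\<Sum>i<n. scal (c i) * letter (u i, \<xi> i))"
proof (induction n)
  case 0
  show ?case using letter_combination_cong[OF zero_dual zero_dual, of 0 0 0 0] by (simp add: scal_zero)
next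
  case (Suc n)
  note d = dual_sum[where \<xi> = \<xi> and n = n and c = c, OF assms]
  have "Cl.cong_J (letter (\<Sum>i<Suc n. h_scale d (c i) (u i), \<lambda>z. \<Sum>i<Suc n. c i * \<xi> i z))
    (letter (\<Sum>i<n. h_scale d (c i) (u i), \<lambda>z. \<Sum>i<n. c i * \<xi> i z) + scal (c n) * letter (u n, \<xi> n))"
    using letter_combination_cong[OF d assms[of n], of 1 "\<Sum>i<n. h_scale d (c i) (u i)" "c n" "u n"]
    by (simp add: scal_one)
  also have "Cl.cong_J \<dots> ((\<Sum>i<n. scal (c i) * letter (u i, \<xi> i)) + scal (c n) * letter (u n, \<xi> n))"
    by (intro Cl.cong_add Suc Cl.cong_refl free_algebra_closed in_V_space assms)
  finally show ?case by simp
qed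

text \<open>Padded by zero so that \<open>letter_sum_cong\<close>, whose hypothesis ranges over all
  natural indices, applies to the dual basis.\<close>

definition x_total :: "nat \<Rightarrow> 'v \<Rightarrow> complex" where
  "x_total i = (if i < dim_h d then x_basis d i else (\<lambda>_. 0))"

lemma Xc_expansion:
  assumes "\<xi> \<in> dual d"
  shows "Cl.cong_J (Xc \<xi>) (\<Sum>i<dim_h d. scal (\<xi> (y_basis d i)) * Xc (x_basis d i))"
proof -
  have "x_total i \<in> dual d" for i by (simp add: x_total_def x_dual zero_dual)
  from letter_sum_cong[where \<xi> = x_total and n = "dim_h d" and c = "\<lambda>i. \<xi> (y_basis d i)"
      and u = "\<lambda>_. 0", OF this]
  have "Cl.cong_J (letter (0, \<lambda>z. \<Sum>i<dim_h d. \<xi> (y_basis d i) * x_basis d i z))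
    (\<Sum>i<dim_h d. scal (\<xi> (y_basis d i)) * letter (0, x_basis d i))"
    by (simp add: x_total_def)
  moreover have "(\<lambda>z. \<Sum>i<dim_h d. \<xi> (y_basis d i) * x_basis d i z) = \<xi>"
    by (rule ext) (subst (2) dual_expansion[OF assms], simp add: mult.commute)
  ultimately show ?thesis by (simp add: in_dual_def)
qed

lemma Yc_expansion:
  "Cl.cong_J (Yc v) (\<Sum>i<dim_h d. scal (x_basis d i v) * Yc (y_basis d i))"
  using letter_sum_cong[where \<xi> = "\<lambda>_ _. 0" and n = "dim_h d" and c = "\<lambda>i. x_basis d i v"
      and u = "y_basis d", OF zero_dual]
  by (simp add: in_h_def y_expansion[of v, symmetric])

lemma Xc_carrier: "\<xi> \<in> dual d \<Longrightarrow> Xc \<xi> \<in> carrier Cl.Fr" and Yc_carrier: "Yc v \<in> carrier Cl.Fr"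
  by (simp_all add: free_algebra_closed in_V_space)

text \<open>The anticommutator of a functional with itself is twice its square, so 2 has to be
  inverted.\<close>

lemma Xc_square:
  assumes "\<xi> \<in> dual d" shows "Cl.cong_J (Xc \<xi> * Xc \<xi>) 0"
proof (rule Cl.cong_half)
  have "Cl.cong_J (Xc \<xi> * Xc \<xi> + Xc \<xi> * Xc \<xi>)
      (scal (\<Sum>i<dim_h d. \<Sum>j<dim_h d. \<xi> (y_basis d i) * \<xi> (y_basis d j) * 0))"
  proof (rule Cl.cong_anticommutator[OF Xc_expansion[OF assms] Xc_expansion[OF assms]])
    fix i j assume "i \<in> {..<dim_h d}" "j \<in> {..<dim_h d}"
    then show "Cl.cong_J (Xc (x_basis d i) * Xc (x_basis d j) + Xc (x_basis d j) * Xc (x_basis d i)) (scal 0)"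
      unfolding scal_zero by (intro Cl.cong_relation) (auto simp: clifford_relations_def)
  qed
  then show "Cl.cong_J (Xc \<xi> * Xc \<xi> + Xc \<xi> * Xc \<xi>) 0" by (simp add: scal_zero)
qed

lemma Yc_square: "Cl.cong_J (Yc v * Yc v) 0"
proof (rule Cl.cong_half)
  have "Cl.cong_J (Yc v * Yc v + Yc v * Yc v)
      (scal (\<Sum>i<dim_h d. \<Sum>j<dim_h d. x_basis d i v * x_basis d j v * 0))"
  proof (rule Cl.cong_anticommutator[OF Yc_expansion Yc_expansion])
    fix i j assume "i \<in> {..<dim_h d}" "j \<in> {..<dim_h d}"
    then show "Cl.cong_J (Yc (y_basis d i) * Yc (y_basis d j) + Yc (y_basis d j) * Yc (y_basis d i)) (scal 0)"
      unfolding scal_zero by (intro Cl.cong_relation) (auto simp: clifford_relations_def)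
  qed
  then show "Cl.cong_J (Yc v * Yc v + Yc v * Yc v) 0" by (simp add: scal_zero)
qed

lemma Xc_Yc:
  assumes "\<xi> \<in> dual d" shows "Cl.cong_J (Xc \<xi> * Yc v + Yc v * Xc \<xi>) (scal (- 2 * \<xi> v))"
proof -
  let ?c = "\<lambda>i j. - (if i = j then 2 else 0) :: complex"
  have "Cl.cong_J (Xc \<xi> * Yc v + Yc v * Xc \<xi>)
      (scal (\<Sum>i<dim_h d. \<Sum>j<dim_h d. \<xi> (y_basis d i) * x_basis d j v * ?c i j))"
  proof (rule Cl.cong_anticommutator[OF Xc_expansion[OF assms] Yc_expansion])
    fix i j assume "i \<in> {..<dim_h d}" "j \<in> {..<dim_h d}"
    then have "Xc (x_basis d i) * Yc (y_basis d j) + Yc (y_basis d j) * Xc (x_basis d i)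
          + scal (if i = j then 2 else 0) \<in> clifford_relations d"
      unfolding clifford_relations_def by blast
    from Cl.cong_rearrange[OF Cl.cong_relation[OF this] carrier_free_algebra_scal]
    show "Cl.cong_J (Xc (x_basis d i) * Yc (y_basis d j) + Yc (y_basis d j) * Xc (x_basis d i)) (scal (?c i j))"
      by (simp only: scal_uminus diff_0)
  qed
  moreover have "(\<Sum>i<dim_h d. \<Sum>j<dim_h d. \<xi> (y_basis d i) * x_basis d j v * ?c i j)
      = (\<Sum>i<dim_h d. - 2 * (x_basis d i v * \<xi> (y_basis d i)))"
  proof (rule sum.cong[OF refl])
    fix i assume i: "i \<in> {..<dim_h d}"
    have "(\<Sum>j<dim_h d. \<xi> (y_basis d i) * x_basis d j v * ?c i j)
        = (\<Sum>j<dim_h d. if j = i then - 2 * (x_basis d i v * \<xi> (y_basis d i)) else 0)"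
      by (rule sum.cong) auto
    then show "(\<Sum>j<dim_h d. \<xi> (y_basis d i) * x_basis d j v * ?c i j) = - 2 * (x_basis d i v * \<xi> (y_basis d i))"
      using i by simp
  qed
  ultimately show ?thesis
    unfolding sum_distrib_left[symmetric] dual_expansion[OF assms, symmetric] by simp
qed

section \<open>The elements lifting a reflection\<close>

context
  fixes s assumes s: "s \<in> reflections d"
begin

definition "mu_root = csqrt (det_h d s)"
definition "mu_coeff = (mu_root - 1 / mu_root) / (2 * root d s (coroot d s))"
text \<open>The expression for \<open>mu_rep\<close> with the square root replaced by its
  reciprocal, which changes the sign of \<open>mu_coeff\<close>.\<close>

definition "mu_inverse = scal (- mu_coeff) * Xc (root d s) * Yc (coroot d s) + scal (1 / mu_root)"

lemma mu_root: "mu_root * mu_root = det_h d s" "mu_root \<noteq> 0"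
  using reflection_formula(2)[OF s] power2_csqrt[of "det_h d s"]
  by (auto simp: mu_root_def power2_eq_square)

lemma mu_rep_eq: "mu_rep d s = scal mu_coeff * Xc (root d s) * Yc (coroot d s) + scal mu_root"
  by (simp add: mu_rep_def mu_coeff_def mu_root_def Let_def)

lemma mu_carrier: "mu_rep d s \<in> carrier Cl.Fr" "mu_inverse \<in> carrier Cl.Fr"
  unfolding mu_rep_eq mu_inverse_def
  by (intro free_algebra_closed(1,4,5) Xc_carrier Yc_carrier root_dual s)+

lemma mu_mult: "Cl.cong_J (mu_rep d s * mu_inverse) 1" "Cl.cong_J (mu_inverse * mu_rep d s) 1"
proof -
  have "2 * root d s (coroot d s) * mu_coeff = mu_root - 1 / mu_root"
    using reflection_formula(1)[OF s] by (simp add: mu_coeff_def)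
  note * = Cl.clifford_pair_inverse[OF Xc_square[OF root_dual[OF s]] Yc_square Xc_Yc[OF root_dual[OF s]]
      Xc_carrier[OF root_dual[OF s]] Yc_carrier mu_root(2) this]
  show "Cl.cong_J (mu_rep d s * mu_inverse) 1" "Cl.cong_J (mu_inverse * mu_rep d s) 1"
    using * by (simp_all add: mu_rep_eq mu_inverse_def)
qed

lemma mu_units: "cliff_class d (mu_rep d s) \<in> Units (clifford_algebra d)"
  "cliff_class d (- mu_rep d s) \<in> Units (clifford_algebra d)"
  unfolding clifford_algebra_eq cliff_class_eq
  using mu_mult mu_carrier
  by (auto intro!: Cl.cl_Unit[of "mu_rep d s" mu_inverse] Cl.cl_Unit[of "- mu_rep d s" "- mu_inverse"]
      free_algebra_closed(2))

lemma exterior_map_reflection: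
  assumes t: "t \<in> tensor_space (dim_h d)"
  defines "b \<equiv> (det_h d s - 1) / root d s (coroot d s)"
  shows "exterior_map d s t = t - cscale b (wedge d (coroot d s) (contraction d (root d s) t))"
proof -
  let ?E = "\<lambda>t. t - cscale b (wedge d (coroot d s) (contraction d (root d s) t))"
  note L = spinor_linearD[OF spinor_linear_wedge] spinor_linearD[OF spinor_linear_contraction]
  have "spinor_linear ?E"
  proof (rule spinor_linearI)
    show "?E (u + v) = ?E u + ?E v" for u v by (rule ext) (simp add: L algebra_simps)
    show "?E (cscale a u) = cscale a (?E u)" for a u by (rule ext) (simp add: L algebra_simps)
  qed
  with spinor_linear_exterior_map show ?thesis using t
  proof (rule spinor_linear_eqI[where F' = ?E])
    fix I assume "I \<subseteq> {..<dim_h d}"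
    then show "exterior_map d s (ext_basis I) = ?E (ext_basis I)"
    proof (induction rule: subset_induct_min)
      case empty
      show ?case unfolding exterior_map_empty contraction_ext_basis_empty L(3) by (rule ext) simp
    next
      case (insert j I)
      let ?e = "ext_basis I" and ?v = "y_basis d j" and ?i = "contraction d (root d s)"
      have e: "?e \<in> tensor_space (dim_h d)" using insert by (simp add: ext_basis_in_tensor_space)
      have i: "?i (wedge d ?v ?e) = cscale (- root d s ?v) ?e - wedge d ?v (?i ?e)"
        using contraction_wedge[OF e root_dual[OF s], of ?v] by (simp add: algebra_simps)
      have sv: "s ?v = ?v + h_scale d (b * root d s ?v) (coroot d s)"
        unfolding b_def by (rule reflection_formula(3)[OF s])
      have anti: "wedge d (coroot d s) (wedge d ?v (?i ?e)) J = - wedge d ?v (wedge d (coroot d s) (?i ?e)) J" for J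
        by (subst wedge_wedge) simp
      \<comment> \<open>Moving \<open>?v\<close> past the contraction yields the term with
        \<open>root d s ?v\<close>, which accounts for the difference between \<open>s ?v\<close>
        and \<open>?v\<close>. The term quadratic in \<open>b\<close> dies because the coroot wedged
        with itself is zero.\<close>
      have E: "wedge d (s ?v) (?E ?e) = ?E (wedge d ?v ?e)"
        unfolding sv i wedge_add wedge_scale L wedge_self
        by (rule ext) (simp add: anti algebra_simps)
      have "exterior_map d s (ext_basis (insert j I)) = wedge d (s ?v) (?E ?e)"
        by (simp only: exterior_map_insert[OF insert.hyps(1-3)] insert.IH)
      also have "\<dots> = ?E (ext_basis (insert j I))"
        by (simp only: E wedge_ext_basis_min[OF insert.hyps(1-3)])
      finally show ?case .
    qed
  qed
qed

text \<open>Write \<open>q\<close> for \<open>mu_root\<close>. Moving the contraction past the wedge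
  leaves \<open>q - (q - 1 / q) = 1 / q\<close> in front of \<open>t\<close>, and
  \<open>q\<^sup>2 = \<lambda>\<^sub>s\<close> brings the other coefficient into the form required
  by \<open>exterior_map_reflection\<close>. So \<chi> takes the value \<open>1 / q\<close>, whose
  square is the determinant of \<open>s\<close> on the dual space.\<close>

lemma spin_mu:
  assumes t: "t \<in> tensor_space (dim_h d)"
  shows "spin d (cliff_class d (mu_rep d s)) t = cscale (1 / mu_root) (exterior_map d s t)"
    "spin d (cliff_class d (- mu_rep d s)) t = cscale (- 1 / mu_root) (exterior_map d s t)"
proof -
  let ?a = "root d s (coroot d s)"
  define w where "w = wedge d (coroot d s) (contraction d (root d s) t)"
  have cw: "contraction d (root d s) (wedge d (coroot d s) t) = cscale (- ?a) t - w"
    using contraction_wedge[OF t root_dual[OF s], of "coroot d s"] by (simp add: w_def algebra_simps)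
  have "x / (2 * y) * 2 = x / y" for x y :: complex by simp
  then have k2: "mu_coeff * 2 = (mu_root - 1 / mu_root) / ?a"
    unfolding mu_coeff_def by blast
  have k1: "mu_coeff * 2 * ?a = mu_root - 1 / mu_root"
    unfolding k2 using reflection_formula(1)[OF s] by simp
  have "spin_free d (mu_rep d s) t = cscale (1 / mu_root) (exterior_map d s t)"
  proof
    fix J
    have "spin_free d (mu_rep d s) t J = mu_coeff * 2 * (- ?a * t J - w J) + mu_root * t J"
      by (simp add: mu_rep_eq spin_free_add spin_free_mult spin_free_scal spin_free_letter spin_in_h
          spin_in_dual cw)
    also have "\<dots> = - (mu_coeff * 2 * ?a) * t J - mu_coeff * 2 * w J + mu_root * t J"
      by (simp add: algebra_simps)
    also have "\<dots> = 1 / mu_root * (t J - (mu_root * mu_root - 1) / ?a * w J)"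
      unfolding k1 unfolding k2 using mu_root(2) reflection_formula(1)[OF s] by (simp add: field_simps)
    finally show "spin_free d (mu_rep d s) t J = cscale (1 / mu_root) (exterior_map d s t) J"
      by (simp add: exterior_map_reflection[OF t] mu_root(1) w_def)
  qed
  then show "spin d (cliff_class d (mu_rep d s)) t = cscale (1 / mu_root) (exterior_map d s t)"
    "spin d (cliff_class d (- mu_rep d s)) t = cscale (- 1 / mu_root) (exterior_map d s t)"
    by (simp_all add: spin_class[OF _ t] mu_carrier free_algebra_closed(2) spin_free_uminus)
qed

end

text \<open>This relation is compatible with products and inverses and determines both
  \<open>w\<close> and \<open>c\<close>, so it yields the covering map and the character
  together.\<close>

definition lifts :: "'v vdual free set \<Rightarrow> ('v \<Rightarrow> 'v) \<Rightarrow> complex \<Rightarrow> bool" where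
  "lifts g w c \<longleftrightarrow> w \<in> refl_group d \<and> c \<noteq> 0
     \<and> (\<forall>t\<in>tensor_space (dim_h d). spin d g t = cscale c (exterior_map d w t))"

lemma lifts_mu:
  assumes "s \<in> reflections d"
  shows "\<exists>c. lifts (cliff_class d (mu_rep d s)) s c" "\<exists>c. lifts (cliff_class d (- mu_rep d s)) s c"
  unfolding lifts_def using spin_mu[OF assms] mu_root(2)[OF assms] reflection_in_W[OF assms]
  by (intro exI[of _ "1 / mu_root s"], simp, intro exI[of _ "- 1 / mu_root s"], simp)

interpretation Q: ring "clifford_algebra d"
  unfolding clifford_algebra_eq by (rule Cl.ring_Q)

lemma lifts_one: "lifts \<one>\<^bsub>clifford_algebra d\<^esub> id 1"
  by (simp add: lifts_def W_closed spin_one exterior_map_id)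

lemma lifts_mult:
  assumes "g \<in> carrier (clifford_algebra d)" "h \<in> carrier (clifford_algebra d)" "lifts g w c" "lifts h w' c'"
  shows "lifts (g \<otimes>\<^bsub>clifford_algebra d\<^esub> h) (w \<circ> w') (c * c')"
  unfolding lifts_def
proof (intro conjI ballI)
  have w: "w \<in> refl_group d" "w' \<in> refl_group d" "c \<noteq> 0" "c' \<noteq> 0"
    and g: "\<And>t. t \<in> tensor_space (dim_h d) \<Longrightarrow> spin d g t = cscale c (exterior_map d w t)"
    and h: "\<And>t. t \<in> tensor_space (dim_h d) \<Longrightarrow> spin d h t = cscale c' (exterior_map d w' t)"
    using assms(3,4) by (auto simp: lifts_def)
  show "w \<circ> w' \<in> refl_group d" "c * c' \<noteq> 0" using w by (auto simp: W_closed)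
  fix t :: "nat set \<Rightarrow> complex" assume t: "t \<in> tensor_space (dim_h d)"
  have "spin d (g \<otimes>\<^bsub>clifford_algebra d\<^esub> h) t = spin d g (cscale c' (exterior_map d w' t))"
    by (simp add: spin_mult[OF assms(1,2) t] h t)
  also have "\<dots> = cscale c' (cscale c (exterior_map d w (exterior_map d w' t)))"
    by (simp add: spinor_linearD(2)[OF spinor_linear_spin] g exterior_map_stable t)
  also have "\<dots> = cscale (c * c') (exterior_map d (w \<circ> w') t)"
    using exterior_map_comp[OF W_linear[OF w(1)] t, of w'] by (simp add: mult.commute)
  finally show "spin d (g \<otimes>\<^bsub>clifford_algebra d\<^esub> h) t = cscale (c * c') (exterior_map d (w \<circ> w') t)" .
qed

lemma W_inverse:
  assumes "w \<in> refl_group d" obtains w' where "w' \<in> refl_group d" "w \<circ> w' = id" "w' \<circ> w = id"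
proof -
  have "inv\<^bsub>GL d\<^esub> w \<in> refl_group d" by (rule subgroup.m_inv_closed[OF W_subgroup assms])
  then show ?thesis
    using that[of "inv\<^bsub>GL d\<^esub> w"] GL.r_inv[OF W_carrier[OF assms]] GL.l_inv[OF W_carrier[OF assms]] by simp
qed

lemma lifts_inv:
  assumes g: "g \<in> Units (clifford_algebra d)" and lift: "lifts g w c"
  shows "\<exists>w' c'. lifts (inv\<^bsub>clifford_algebra d\<^esub> g) w' c'"
proof -
  have w: "w \<in> refl_group d" "c \<noteq> 0"
    and gs: "\<And>t. t \<in> tensor_space (dim_h d) \<Longrightarrow> spin d g t = cscale c (exterior_map d w t)"
    using lift by (auto simp: lifts_def)
  obtain w' where w': "w' \<in> refl_group d" "w \<circ> w' = id" using W_inverse[OF w(1)] by blast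
  have "spin d (inv\<^bsub>clifford_algebra d\<^esub> g) t = cscale (1 / c) (exterior_map d w' t)"
    if t: "t \<in> tensor_space (dim_h d)" for t
  proof -
    \<comment> \<open>The spinor that \<open>g\<close> maps to \<open>t\<close>; applying the
      inverse of \<open>g\<close> to \<open>t\<close> recovers it.\<close>
    let ?r = "cscale (1 / c) (exterior_map d w' t)"
    have r: "?r \<in> tensor_space (dim_h d)"
      by (intro spinors.subspace_scale[OF subspace_spinors] exterior_map_stable t)
    have "spin d g ?r = cscale c (cscale (1 / c) (exterior_map d w (exterior_map d w' t)))"
      by (simp only: gs[OF r] spinor_linearD(2)[OF spinor_linear_exterior_map])
    also have "\<dots> = t"
      using w(2) exterior_map_comp[OF W_linear[OF w(1)] t, of w'] w'(2) exterior_map_id[OF t] by simp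
    finally have "spin d (inv\<^bsub>clifford_algebra d\<^esub> g) t = spin d (inv\<^bsub>clifford_algebra d\<^esub> g) (spin d g ?r)" by simp
    also have "\<dots> = spin d (inv\<^bsub>clifford_algebra d\<^esub> g \<otimes>\<^bsub>clifford_algebra d\<^esub> g) ?r"
      by (rule spin_mult[symmetric]) (use g r in auto)
    also have "\<dots> = ?r" using g r by (simp add: spin_one)
    finally show ?thesis .
  qed
  then have "lifts (inv\<^bsub>clifford_algebra d\<^esub> g) w' (1 / c)" using w' w(2) by (simp add: lifts_def)
  then show ?thesis by blast
qed

lemma lifts_chi:
  assumes "lifts g w c" shows "chi d g = c"
proof -
  have "spin d g (ext_basis {}) = cscale c (ext_basis {})"
    using assms ext_basis_in_tensor_space[of "{}" "dim_h d"] by (simp add: lifts_def exterior_map_empty)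
  then show ?thesis by (simp add: chi_def ext_basis_def)
qed

text \<open>Degree 0 determines the scalar; after cancelling it, degree 1 determines the images of
  the basis vectors and hence the linear map.\<close>

lemma lifts_unique:
  assumes "lifts g w c" "lifts g w' c'" shows "w = w'"
proof
  have c: "c = c'" "c \<noteq> 0"
    using lifts_chi[OF assms(1)] lifts_chi[OF assms(2)] assms(1) by (simp, simp add: lifts_def)
  have y: "w (y_basis d i) = w' (y_basis d i)" if i: "i < dim_h d" for i
  proof -
    let ?e = "ext_basis {i}"
    have e: "?e \<in> tensor_space (dim_h d)" using i by (simp add: ext_basis_in_tensor_space)
    \<comment> \<open>On a single vector the exterior power is the map itself, so the coefficient at
      \<open>{k}\<close> is the \<open>k\<close>-th coordinate of the image.\<close>
    have ext: "exterior_map d w ?e {k} = x_basis d k (w (y_basis d i))" if "k < dim_h d" for k w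
    proof -
      have "exterior_map d w ?e = wedge d (w (y_basis d i)) (ext_basis {})"
        using exterior_map_insert[of i "{}" w] i by (simp add: exterior_map_empty)
      moreover have "{j \<in> {k}. j < k} = {}" by auto
      then have "koszul_sign k {k} = 1" by (simp only: koszul_sign_def card.empty power_0)
      then have "wedge_at (dim_h d) j (ext_basis {}) {k} = (if j = k then 1 else 0)" for j
        using that by (auto simp: wedge_at_def ext_basis_def)
      ultimately show ?thesis using that by (simp add: wedge_apply if_distrib[of "\<lambda>x. _ * x"] cong: if_cong)
    qed
    have "cscale c (exterior_map d w ?e) = cscale c' (exterior_map d w' ?e)"
      using assms e by (simp add: lifts_def)
    then have eq: "exterior_map d w ?e {k} = exterior_map d w' ?e {k}" for k
      using c fun_cong[of "cscale c (exterior_map d w ?e)" _ "{k}"] by simp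
    have "x_basis d k (w (y_basis d i)) = x_basis d k (w' (y_basis d i))" if "k < dim_h d" for k
      using eq[of k] unfolding ext[OF that] .
    then have "(\<Sum>k<dim_h d. h_scale d (x_basis d k (w (y_basis d i))) (y_basis d k))
      = (\<Sum>k<dim_h d. h_scale d (x_basis d k (w' (y_basis d i))) (y_basis d k))"
      by (intro sum.cong) auto
    then show ?thesis unfolding y_expansion[symmetric] .
  qed
  have W: "w \<in> refl_group d" "w' \<in> refl_group d" using assms by (auto simp: lifts_def)
  fix v
  show "w v = w' v"
    by (subst (1 2) y_expansion[of v])
      (simp add: h_linearD[OF W_linear[OF W(1)]] h_linearD[OF W_linear[OF W(2)]] y)
qed

section \<open>The covering homomorphism\<close>

abbreviation "cover_gens \<equiv> \<Union>s\<in>reflections d. {cliff_class d (mu_rep d s), cliff_class d (- mu_rep d s)}"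

lemma cover_gens_units: "cover_gens \<subseteq> Units (clifford_algebra d)"
  using mu_units by auto

interpretation Un: group "units_of (clifford_algebra d)"
  by (rule Q.units_group)

lemma carrier_W_tilde: "carrier (W_tilde d) = generate (units_of (clifford_algebra d)) cover_gens"
  unfolding W_tilde_def carrier_subgroup_generated
  using cover_gens_units by (simp add: units_of_carrier Int_absorb1)

lemma group_W_tilde: "group (W_tilde d)"
  unfolding W_tilde_def by (rule Un.group_subgroup_generated)

lemma W_tilde_units: "g \<in> carrier (W_tilde d) \<Longrightarrow> g \<in> Units (clifford_algebra d)"
  using Un.carrier_subgroup_generated_subset unfolding W_tilde_def by (auto simp: units_of_carrier)

lemma W_tilde_simps:
  "g \<otimes>\<^bsub>W_tilde d\<^esub> h = g \<otimes>\<^bsub>clifford_algebra d\<^esub> h" "\<one>\<^bsub>W_tilde d\<^esub> = \<one>\<^bsub>clifford_algebra d\<^esub>"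
  by (simp_all add: W_tilde_def units_of_mult units_of_one)

lemma lifts_exists: "g \<in> carrier (W_tilde d) \<Longrightarrow> \<exists>w c. lifts g w c"
  unfolding carrier_W_tilde
proof (induction rule: generate.induct)
  case one
  then show ?case using lifts_one by (auto simp: units_of_one)
next
  case (incl h)
  then show ?case using lifts_mu by blast
next
  case (inv h)
  then have "h \<in> Units (clifford_algebra d)" using cover_gens_units by blast
  moreover have "\<exists>w c. lifts h w c" using inv lifts_mu by blast
  ultimately show ?case using lifts_inv by (auto simp: Q.units_of_inv)
next
  case (eng g h)
  then have "g \<in> carrier (clifford_algebra d)" "h \<in> carrier (clifford_algebra d)"
    using W_tilde_units Q.Units_closed by (auto simp: carrier_W_tilde)
  moreover obtain w c w' c' where "lifts g w c" "lifts h w' c'" using eng.IH by blast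
  ultimately show ?case unfolding units_of_mult using lifts_mult by blast
qed

text \<open>Restricted to the carrier because \<open>cover\<close> is characterized among
  extensional functions.\<close>

definition cover_map :: "'v vdual free set \<Rightarrow> 'v \<Rightarrow> 'v" where
  "cover_map = restrict (\<lambda>g. THE w. \<exists>c. lifts g w c) (carrier (W_tilde d))"

lemma cover_map_eqI: "g \<in> carrier (W_tilde d) \<Longrightarrow> lifts g w c \<Longrightarrow> cover_map g = w"
  unfolding cover_map_def using lifts_unique by (auto intro!: the_equality)

lemma cover_gens_W_tilde: "g \<in> cover_gens \<Longrightarrow> g \<in> carrier (W_tilde d)"
  unfolding carrier_W_tilde by (rule generate.incl)

lemma cover_map_hom: "cover_map \<in> hom (W_tilde d) W_group"
proof (rule homI)
  fix g assume g: "g \<in> carrier (W_tilde d)"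
  then obtain w c where w: "lifts g w c" using lifts_exists by blast
  then show "cover_map g \<in> carrier W_group" using cover_map_eqI[OF g w] by (auto simp: lifts_def)
  fix h assume h: "h \<in> carrier (W_tilde d)"
  then obtain w' c' where w': "lifts h w' c'" using lifts_exists by blast
  have gh: "g \<otimes>\<^bsub>W_tilde d\<^esub> h \<in> carrier (W_tilde d)"
    using g h group_W_tilde by (simp add: group.is_monoid monoid.m_closed)
  have "lifts (g \<otimes>\<^bsub>W_tilde d\<^esub> h) (w \<circ> w') (c * c')"
    unfolding W_tilde_simps
    by (rule lifts_mult[OF Q.Units_closed[OF W_tilde_units[OF g]] Q.Units_closed[OF W_tilde_units[OF h]] w w'])
  then show "cover_map (g \<otimes>\<^bsub>W_tilde d\<^esub> h) = cover_map g \<otimes>\<^bsub>W_group\<^esub> cover_map h"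
    using cover_map_eqI[OF gh] cover_map_eqI[OF g w] cover_map_eqI[OF h w'] by (simp add: GL_def)
qed

lemma hom_W_tilde_unique:
  assumes p: "p \<in> hom (W_tilde d) W_group" and q: "q \<in> hom (W_tilde d) W_group"
    and gens: "\<And>g. g \<in> cover_gens \<Longrightarrow> p g = q g" and g: "g \<in> carrier (W_tilde d)"
  shows "p g = q g"
proof -
  interpret p: group_hom "W_tilde d" W_group p
    using group_W_tilde group_W p by (simp add: group_hom_def group_hom_axioms_def)
  interpret q: group_hom "W_tilde d" W_group q
    using group_W_tilde group_W q by (simp add: group_hom_def group_hom_axioms_def)
  show ?thesis using g unfolding carrier_W_tilde
  proof (induction rule: generate.induct)
    case one
    then show ?case using p.hom_one q.hom_one by (simp add: W_tilde_simps units_of_one)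
  next
    case (incl h)
    then show ?case by (rule gens)
  next
    case (inv h)
    have h: "h \<in> carrier (W_tilde d)" by (rule cover_gens_W_tilde[OF inv])
    \<comment> \<open>\<open>generate\<close> takes inverses in the group of units, whereas the
      homomorphism laws refer to the record \<open>W_tilde d\<close>.\<close>
    have "inv\<^bsub>units_of (clifford_algebra d)\<^esub> h = inv\<^bsub>W_tilde d\<^esub> h"
      using Un.inv_subgroup_generated h unfolding W_tilde_def by simp
    then show ?case using h gens[OF inv] by simp
  next
    case (eng g h)
    have "p (g \<otimes>\<^bsub>W_tilde d\<^esub> h) = q (g \<otimes>\<^bsub>W_tilde d\<^esub> h)"
      using eng by (simp add: carrier_W_tilde)
    then show ?case by (simp add: W_tilde_simps units_of_mult)
  qed
qed

text \<open>Discharges the definite description. Existence is given by \<open>cover_map\<close>;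
  homomorphisms agreeing on generators agree on the generated group, and extensionality fixes the
  values elsewhere.\<close>

lemma cover_eq: "cover d = cover_map"
  unfolding cover_def
proof (rule the_equality)
  have "cover_map (cliff_class d (mu_rep d s)) = s \<and> cover_map (cliff_class d (- mu_rep d s)) = s"
    if "s \<in> reflections d" for s
    using lifts_mu[OF that] cover_map_eqI cover_gens_W_tilde that by blast
  note gens = this
  then show "cover_map \<in> hom (W_tilde d) W_group \<and> cover_map \<in> extensional (carrier (W_tilde d))
    \<and> (\<forall>s\<in>reflections d. cover_map (cliff_class d (mu_rep d s)) = s \<and> cover_map (cliff_class d (- mu_rep d s)) = s)"
    using cover_map_hom by (auto simp: cover_map_def)
  fix p assume p: "p \<in> hom (W_tilde d) W_group \<and> p \<in> extensional (carrier (W_tilde d))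
    \<and> (\<forall>s\<in>reflections d. p (cliff_class d (mu_rep d s)) = s \<and> p (cliff_class d (- mu_rep d s)) = s)"
  show "p = cover_map"
  proof (rule extensionalityI)
    show "p \<in> extensional (carrier (W_tilde d))" using p by blast
    show "cover_map \<in> extensional (carrier (W_tilde d))" by (simp add: cover_map_def)
    show "p g = cover_map g" if "g \<in> carrier (W_tilde d)" for g
      using p gens by (intro hom_W_tilde_unique[OF _ cover_map_hom _ that]) auto
  qed
qed

theorem spin_eq_chi_exterior_map:
  assumes g: "g \<in> carrier (W_tilde d)"
  shows "cover d g \<in> refl_group d"
    and "t \<in> tensor_space (dim_h d) \<Longrightarrow> spin d g t = cscale (chi d g) (exterior_map d (cover d g) t)"
proof -
  obtain w c where w: "lifts g w c" using lifts_exists[OF g] by blast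
  have "cover d g = w" "chi d g = c" using cover_map_eqI[OF g w] lifts_chi[OF w] by (simp_all add: cover_eq)
  then show "cover d g \<in> refl_group d"
    "t \<in> tensor_space (dim_h d) \<Longrightarrow> spin d g t = cscale (chi d g) (exterior_map d (cover d g) t)"
    using w by (auto simp: lifts_def)
qed

end

section \<open>The Dirac operator\<close>

context cherednik_data
begin

lemma cherednik_relations_closed: "cherednik_relations d \<subseteq> carrier (free_algebra (cher_alphabet d))"
proof -
  let ?F = "free_algebra (cher_alphabet d)"
  have V: "letter (Inl p) \<in> carrier ?F" if "p \<in> V_space d" for p
    using that by (auto simp: cher_alphabet_def intro: free_algebra_closed)
  have W: "Wl w \<in> carrier ?F" if "w \<in> refl_group d" for w
    using that by (auto simp: cher_alphabet_def intro: free_algebra_closed)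
  have "linear_relations d Inl \<subseteq> carrier ?F"
    by (rule linear_relations_closed) (simp add: cher_alphabet_def)
  moreover have "smash_relations d \<subseteq> carrier ?F"
    unfolding smash_relations_def
    by (auto intro!: free_algebra_closed(1-5,7-9) V W W_closed in_V_space dual_action_dual W_carrier)
  moreover have "commutator_relations d \<subseteq> carrier ?F"
    unfolding commutator_relations_def
    by (auto intro!: free_algebra_closed(1-5,7-9) V W in_V_space reflection_in_W)
  ultimately show ?thesis by (simp add: cherednik_relations_def)
qed

sublocale Ch: presentation "cher_alphabet d" "cherednik_relations d"
  by unfold_locales (rule cherednik_relations_closed)

lemma cherednik_algebra_eq: "cherednik_algebra d = Ch.Q" and cher_class_eq: "cher_class d = Ch.cl"
  by (simp_all add: cherednik_algebra_def cher_class_def fun_eq_iff)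

lemma letter_V_closed: "p \<in> V_space d \<Longrightarrow> letter (Inl p) \<in> carrier Ch.Fr"
  and letter_W_closed: "w \<in> refl_group d \<Longrightarrow> Wl w \<in> carrier Ch.Fr"
  by (auto simp: cher_alphabet_def intro: free_algebra_closed)

lemma wedge_degree:
  assumes "wedge d v (ext_basis I) J \<noteq> 0" "I \<subseteq> {..<dim_h d}" shows "card J = card I + 1"
proof -
  obtain i where "wedge_at (dim_h d) i (ext_basis I) J \<noteq> 0"
    using assms(1) unfolding wedge_apply by (metis (no_types, lifting) mult_zero_right sum.neutral)
  then have J: "i \<in> J" "J - {i} = I" "J \<subseteq> {..<dim_h d}"
    by (auto simp: wedge_at_def ext_basis_def split: if_splits)
  then have "finite J" using finite_subset by blast
  then have "Suc (card (J - {i})) = card J" using J(1) by (rule card_Suc_Diff1)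
  then show ?thesis by (simp add: J(2))
qed

lemma contraction_degree:
  assumes "contraction d \<xi> (ext_basis I) J \<noteq> 0" "I \<subseteq> {..<dim_h d}" shows "card I = card J + 1"
proof -
  obtain i where "contract_at (dim_h d) i (ext_basis I) J \<noteq> 0"
    using assms(1) unfolding contraction_apply by (metis (no_types, lifting) mult_zero_right sum.neutral)
  then have J: "i \<notin> J" "insert i J = I" "J \<subseteq> {..<dim_h d}"
    by (auto simp: contract_at_def ext_basis_def split: if_splits)
  then have "finite J" using finite_subset by blast
  then show ?thesis using J(1) unfolding J(2)[symmetric] by simp
qed

end

sublocale cherednik_module \<subseteq> MT: complex_vector_space sM ..

context cherednik_module
begin

abbreviation "U \<equiv> tensor_space (dim_h d) :: (nat set \<Rightarrow> 'm) set"

text \<open>Acting through representatives in the free algebra keeps the type class operations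
  available; each relation becomes an equation between operators on \<open>M\<close>.\<close>

definition "H f = act (cher_class d f)"

lemma H_linear:
  assumes "f \<in> carrier Ch.Fr" shows "Vector_Spaces.linear sM sM (H f)"
  using ring_hom_closed[OF act_hom, of "cher_class d f"] Ch.cl_closed[OF assms]
  by (simp add: H_def cherednik_algebra_eq cher_class_eq End_ring_def)

lemma H_mult:
  assumes "f \<in> carrier Ch.Fr" "g \<in> carrier Ch.Fr" shows "H (f * g) m = H f (H g m)"
proof -
  have "act (cher_class d f \<otimes>\<^bsub>cherednik_algebra d\<^esub> cher_class d g) = H f \<circ> H g"
    using ring_hom_mult[OF act_hom, of "cher_class d f" "cher_class d g"]
      Ch.cl_closed[OF assms(1)] Ch.cl_closed[OF assms(2)]
    by (simp add: H_def cherednik_algebra_eq cher_class_eq End_ring_def)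
  moreover have "cher_class d f \<otimes>\<^bsub>cherednik_algebra d\<^esub> cher_class d g = cher_class d (f * g)"
    using Ch.cl_mult[OF assms] by (simp add: cherednik_algebra_eq cher_class_eq)
  ultimately show ?thesis by (simp add: H_def)
qed

lemma H_add:
  assumes "f \<in> carrier Ch.Fr" "g \<in> carrier Ch.Fr" shows "H (f + g) m = H f m + H g m"
proof -
  have "act (cher_class d f \<oplus>\<^bsub>cherednik_algebra d\<^esub> cher_class d g) = (\<lambda>m. H f m + H g m)"
    using ring_hom_add[OF act_hom, of "cher_class d f" "cher_class d g"]
      Ch.cl_closed[OF assms(1)] Ch.cl_closed[OF assms(2)]
    by (simp add: H_def cherednik_algebra_eq cher_class_eq End_ring_def)
  moreover have "cher_class d f \<oplus>\<^bsub>cherednik_algebra d\<^esub> cher_class d g = cher_class d (f + g)"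
    using Ch.cl_add[OF assms] by (simp add: cherednik_algebra_eq cher_class_eq)
  ultimately show ?thesis by (simp add: H_def)
qed

lemma H_scal: "H (scal a) m = sM a m"
  by (simp add: H_def act_scal)

lemma H_relation:
  assumes "f - g \<in> cherednik_relations d" "f \<in> carrier Ch.Fr" "g \<in> carrier Ch.Fr"
  shows "H f = H g"
  using Ch.cl_eq_if_relation[OF assms] by (simp add: H_def cher_class_eq)

lemma H_letter_combination:
  assumes "\<xi> \<in> dual d" "\<eta> \<in> dual d"
  shows "H (letter (Inl (h_scale d a u + h_scale d b v, \<lambda>z. a * \<xi> z + b * \<eta> z))) m
    = sM a (H (letter (Inl (u, \<xi>))) m) + sM b (H (letter (Inl (v, \<eta>))) m)"
proof -
  let ?r = "scal a * letter (Inl (u, \<xi>)) + scal b * letter (Inl (v, \<eta>))"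
  have c: "letter (Inl (u, \<xi>)) \<in> carrier Ch.Fr" "letter (Inl (v, \<eta>)) \<in> carrier Ch.Fr"
    using assms by (auto intro!: letter_V_closed in_V_space)
  have "letter (Inl (h_scale d a u + h_scale d b v, \<lambda>z. a * \<xi> z + b * \<eta> z)) - ?r \<in> cherednik_relations d"
    using assms unfolding cherednik_relations_def linear_relations_def diff_diff_eq[symmetric] by blast
  then have "H (letter (Inl (h_scale d a u + h_scale d b v, \<lambda>z. a * \<xi> z + b * \<eta> z))) = H ?r"
    using assms c
    by (intro H_relation free_algebra_closed(1,4,5) letter_V_closed in_V_space dual_combination)
  then show ?thesis
    by (simp add: H_add H_mult H_scal free_algebra_closed(4,5) c)
qed

lemma H_letter_sum:
  fixes n :: nat
  assumes "\<And>i. \<xi> i \<in> dual d"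
  shows "H (letter (Inl (\<Sum>i<n. h_scale d (c i) (u i), \<lambda>z. \<Sum>i<n. c i * \<xi> i z))) m
    = (\<Sum>i<n. sM (c i) (H (letter (Inl (u i, \<xi> i))) m))"
proof (induction n)
  case 0
  show ?case using H_letter_combination[OF zero_dual zero_dual, of 0 0 0 0] by simp
next
  case (Suc n)
  show ?case
    using H_letter_combination[OF dual_sum[where \<xi> = \<xi> and n = n and c = c, OF assms] assms[of n],
        of 1 "\<Sum>i<n. h_scale d (c i) (u i)" "c n" "u n"] Suc
    by simp
qed

section \<open>The operators of functionals, vectors and group elements on \<open>M\<close>\<close>

definition "XA \<xi> = H (Xl \<xi>)"
definition "YA v = H (Yl v)"
definition "WA w = H (Wl w)"

lemma x_act_eq: "x_act d act i = XA (x_basis d i)" and y_act_eq: "y_act d act i = YA (y_basis d i)"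
  and w_act_eq: "w_act d act w = WA w"
  by (simp_all add: x_act_def y_act_def w_act_def XA_def YA_def WA_def H_def)

lemma XA_sum:
  assumes "\<And>i. i < dim_h d \<Longrightarrow> \<xi> i \<in> dual d"
  shows "XA (\<lambda>z. \<Sum>i<dim_h d. c i * \<xi> i z) m = (\<Sum>i<dim_h d. sM (c i) (XA (\<xi> i) m))"
proof -
  define \<eta> where "\<eta> i = (if i < dim_h d then \<xi> i else (\<lambda>_. 0))" for i
  have "\<eta> i \<in> dual d" for i using assms by (simp add: \<eta>_def zero_dual)
  from H_letter_sum[where \<xi> = \<eta> and n = "dim_h d" and c = c and u = "\<lambda>_. 0", OF this]
  show ?thesis by (simp add: XA_def in_dual_def \<eta>_def)
qed

lemma YA_sum: "YA (\<Sum>i<dim_h d. h_scale d (c i) (u i)) m = (\<Sum>i<dim_h d. sM (c i) (YA (u i) m))"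
  using H_letter_sum[where \<xi> = "\<lambda>_ _. 0" and n = "dim_h d" and c = c and u = u, OF zero_dual]
  by (simp add: YA_def in_h_def)

lemma XA_linear: "\<xi> \<in> dual d \<Longrightarrow> Vector_Spaces.linear sM sM (XA \<xi>)"
  and YA_linear: "Vector_Spaces.linear sM sM (YA v)"
  and WA_linear: "w \<in> refl_group d \<Longrightarrow> Vector_Spaces.linear sM sM (WA w)"
  unfolding XA_def YA_def WA_def by (intro H_linear letter_V_closed letter_W_closed in_V_space; assumption)+

lemma XA_commute:
  assumes "\<xi> \<in> dual d" "\<eta> \<in> dual d" shows "XA \<xi> (XA \<eta> m) = XA \<eta> (XA \<xi> m)"
proof -
  have "Xl \<xi> * Xl \<eta> - Xl \<eta> * Xl \<xi> \<in> cherednik_relations d"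
    using assms unfolding cherednik_relations_def commutator_relations_def by blast
  then have "H (Xl \<xi> * Xl \<eta>) = H (Xl \<eta> * Xl \<xi>)"
    using assms by (intro H_relation free_algebra_closed(4) letter_V_closed in_V_space)
  then show ?thesis using assms by (simp add: fun_eq_iff H_mult letter_V_closed in_V_space XA_def)
qed

lemma YA_commute: "YA u (YA v m) = YA v (YA u m)"
proof -
  have "Yl u * Yl v - Yl v * Yl u \<in> cherednik_relations d"
    unfolding cherednik_relations_def commutator_relations_def by blast
  then have "H (Yl u * Yl v) = H (Yl v * Yl u)"
    by (intro H_relation free_algebra_closed(4) letter_V_closed in_V_space)
  then show ?thesis by (simp add: fun_eq_iff H_mult letter_V_closed in_V_space YA_def)
qed

lemma WA_id: "WA id m = m"
proof -
  have "Wl id - 1 \<in> cherednik_relations d"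
    unfolding cherednik_relations_def smash_relations_def by blast
  then have "H (Wl id) = H 1"
    by (intro H_relation free_algebra_closed(8) letter_W_closed W_closed)
  then show ?thesis using H_scal[of 1 m] by (simp add: WA_def scal_one)
qed

lemma WA_comp:
  assumes "w \<in> refl_group d" "w' \<in> refl_group d" shows "WA (w \<circ> w') m = WA w (WA w' m)"
proof -
  have "Wl w * Wl w' - Wl (w \<circ> w') \<in> cherednik_relations d"
    using assms unfolding cherednik_relations_def smash_relations_def by blast
  then have "H (Wl w * Wl w') = H (Wl (w \<circ> w'))"
    using assms by (intro H_relation free_algebra_closed(4) letter_W_closed W_closed)
  then show ?thesis using assms by (simp add: fun_eq_iff H_mult letter_W_closed WA_def)
qed

lemma WA_letter:
  assumes w: "w \<in> refl_group d" and \<xi>: "\<xi> \<in> dual d"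
  shows "WA w (H (letter (Inl (y, \<xi>))) m) = H (letter (Inl (w y, dual_action w \<xi>))) (WA w m)"
proof -
  have "Wl w * letter (Inl (y, \<xi>)) - letter (Inl (w y, dual_action w \<xi>)) * Wl w \<in> cherednik_relations d"
    using assms unfolding cherednik_relations_def smash_relations_def by blast
  then have "H (Wl w * letter (Inl (y, \<xi>))) = H (letter (Inl (w y, dual_action w \<xi>)) * Wl w)"
    using assms by (intro H_relation free_algebra_closed(4) letter_V_closed letter_W_closed in_V_space
        dual_action_dual W_carrier)
  then show ?thesis
    using assms by (simp add: fun_eq_iff H_mult letter_V_closed letter_W_closed in_V_space
        dual_action_dual W_carrier WA_def)
qed

lemma WA_XA:
  assumes "w \<in> refl_group d" "\<xi> \<in> dual d" shows "WA w (XA \<xi> m) = XA (dual_action w \<xi>) (WA w m)"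
  using WA_letter[OF assms, of 0] by (simp add: XA_def in_dual_def h_linearD(3)[OF W_linear[OF assms(1)]])

lemma WA_YA: "w \<in> refl_group d \<Longrightarrow> WA w (YA v m) = YA (w v) (WA w m)"
  using WA_letter[OF _ zero_dual, of w v] by (simp add: YA_def in_h_def dual_action_def o_def)

section \<open>The two differentials and the group action on the tensor space\<close>

abbreviation "coh \<equiv> coh_diff d sM act"
abbreviation "hom' \<equiv> hom_diff d sM act"
abbreviation "Top \<equiv> tensor_op (dim_h d) sM"

definition "W_op w = Top (WA w) (exterior_map d w)"

lemma coh_eq: "coh u = (\<Sum>i<dim_h d. Top (XA (x_basis d i)) (wedge d (y_basis d i)) u)"
  by (simp add: coh_diff_def x_act_eq)

lemma hom_eq: "hom' u = (\<Sum>i<dim_h d. Top (YA (y_basis d i)) (contraction d (x_basis d i)) u)"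
  by (simp add: hom_diff_def y_act_eq)

lemma dirac_x_eq: "dirac_x d sM act = coh"
proof
  fix u
  have "Top A (spin d (cliff_class d (Yc (y_basis d i)))) = Top A (wedge d (y_basis d i))" for A i
    by (rule MT.tensor_op_cong)
      (simp add: spin_class Yc_carrier ext_basis_in_tensor_space spin_free_letter spin_in_h)
  then show "dirac_x d sM act u = coh u" by (simp add: dirac_x_def coh_diff_def)
qed

text \<open>On spinors a functional acts by twice its contraction, hence the factor 2 against the
  homology differential.\<close>

lemma dirac_y_eq: "dirac_y d sM act u = tscale sM 2 (hom' u)"
proof -
  have "Top A (spin d (cliff_class d (Xc (x_basis d i)))) = Top A (\<lambda>s. cscale 2 (contraction d (x_basis d i) s))"
    if "i < dim_h d" for A i
    by (rule MT.tensor_op_cong)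
      (simp add: spin_class Xc_carrier x_dual that ext_basis_in_tensor_space spin_free_letter spin_in_dual)
  then show ?thesis
    by (simp add: dirac_y_def hom_diff_def MT.tensor_op_scale_right MT.T.scale_sum_right)
qed

lemma coh_linear: "Vector_Spaces.linear (tscale sM) (tscale sM) coh"
  and hom_linear: "Vector_Spaces.linear (tscale sM) (tscale sM) hom'"
proof -
  interpret vp: vector_space_pair "tscale sM" "tscale sM" ..
  have "Vector_Spaces.linear (tscale sM) (tscale sM) (\<lambda>u. \<Sum>i<dim_h d. Top (XA (x_basis d i)) (wedge d (y_basis d i)) u)"
    by (intro vp.linear_compose_sum ballI MT.tensor_op_linear XA_linear x_dual) simp
  then show "Vector_Spaces.linear (tscale sM) (tscale sM) coh" by (simp add: coh_eq[abs_def])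
  have "Vector_Spaces.linear (tscale sM) (tscale sM) (\<lambda>u. \<Sum>i<dim_h d. Top (YA (y_basis d i)) (contraction d (x_basis d i)) u)"
    by (intro vp.linear_compose_sum ballI MT.tensor_op_linear YA_linear)
  then show "Vector_Spaces.linear (tscale sM) (tscale sM) hom'" by (simp add: hom_eq[abs_def])
qed

lemma W_op_linear: "w \<in> refl_group d \<Longrightarrow> Vector_Spaces.linear (tscale sM) (tscale sM) (W_op w)"
  unfolding W_op_def by (intro MT.tensor_op_linear WA_linear)

lemma coh_U: "coh u \<in> U" and hom_U: "hom' u \<in> U" and W_op_U: "W_op w u \<in> U"
  unfolding coh_eq hom_eq W_op_def
  by (intro MT.T.subspace_sum[OF subspace_tensor_space[OF M.vector_space_axioms]] MT.tensor_op_stable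
      wedge_stable contraction_stable exterior_map_stable ext_basis_in_tensor_space; assumption)+

lemma coh_coh: "coh (coh u) = 0"
  unfolding coh_eq
  by (rule MT.koszul_square_zero)
    (auto intro: XA_linear XA_commute x_dual spinor_linear_wedge wedge_stable wedge_wedge)

lemma hom_hom: "hom' (hom' u) = 0"
  unfolding hom_eq
  by (rule MT.koszul_square_zero)
    (auto intro: YA_linear YA_commute spinor_linear_contraction contraction_stable contraction_contraction)

lemma W_op_id: "u \<in> U \<Longrightarrow> W_op id u = u"
  using MT.tensor_op_id[of "dim_h d" "exterior_map d id" u]
  by (simp add: W_op_def WA_id[abs_def] exterior_map_id ext_basis_in_tensor_space)

lemma W_op_comp:
  assumes "w \<in> refl_group d" "w' \<in> refl_group d" shows "W_op (w \<circ> w') u = W_op w (W_op w' u)"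
proof -
  have "W_op w (W_op w' u) = Top (\<lambda>m. WA w (WA w' m)) (\<lambda>s. exterior_map d w (exterior_map d w' s)) u"
    unfolding W_op_def
    by (intro MT.tensor_op_comp WA_linear assms spinor_linear_exterior_map exterior_map_stable
        ext_basis_in_tensor_space)
  also have "\<dots> = Top (WA (w \<circ> w')) (exterior_map d (w \<circ> w')) u"
    using MT.tensor_op_cong[of "dim_h d" "exterior_map d (w \<circ> w')" "\<lambda>s. exterior_map d w (exterior_map d w' s)"]
    by (simp add: WA_comp[OF assms, abs_def] exterior_map_comp[OF W_linear[OF assms(1)]] ext_basis_in_tensor_space)
  finally show ?thesis by (simp add: W_op_def)
qed

lemma coh_degree: "MT.degree_part (k + 1) (coh u) = coh (MT.degree_part k u)"
proof -
  interpret p: Vector_Spaces.linear "tscale sM" "tscale sM" "MT.degree_part (k + 1)" by (rule MT.degree_part_linear)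
  show ?thesis
    unfolding coh_eq p.sum
    by (intro sum.cong refl MT.degree_part_tensor_op XA_linear x_dual) (auto dest: wedge_degree)
qed

lemma hom_degree: "MT.degree_part (k - 1) (hom' u) = hom' (MT.degree_part k u)"
proof -
  interpret p: Vector_Spaces.linear "tscale sM" "tscale sM" "MT.degree_part (k + - 1)" by (rule MT.degree_part_linear)
  have "MT.degree_part (k + - 1) (hom' u) = hom' (MT.degree_part k u)"
    unfolding hom_eq p.sum
    by (intro sum.cong refl MT.degree_part_tensor_op YA_linear) (auto dest: contraction_degree)
  then show ?thesis by simp
qed

lemma W_op_degree: "w \<in> refl_group d \<Longrightarrow> W_op w (MT.degree_part k u) = MT.degree_part k (W_op w u)"
  using MT.degree_part_tensor_op[OF WA_linear, of w "dim_h d" "exterior_map d w" 0 k u] exterior_map_degree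
  by (simp add: W_op_def)

text \<open>The transformed functionals form the basis dual to the vectors
  \<open>w (y_basis d i)\<close>, so the coefficients of \<xi> are its values on these
  vectors.\<close>

lemma dual_action_inverse_pairing:
  assumes w: "w \<in> refl_group d" and \<xi>: "\<xi> \<in> dual d"
  shows "\<xi> = (\<lambda>z. \<Sum>i<dim_h d. \<xi> (w (y_basis d i)) * dual_action w (x_basis d i) z)"
proof
  fix z
  note lin = h_linearD[OF W_linear[OF w]]
  have "\<xi> (w (inv_into UNIV w z)) = \<xi> (w (\<Sum>i<dim_h d. h_scale d (x_basis d i (inv_into UNIV w z)) (y_basis d i)))"
    by (subst (1) y_expansion[of "inv_into UNIV w z"]) (rule refl)
  also have "\<dots> = (\<Sum>i<dim_h d. \<xi> (w (y_basis d i)) * dual_action w (x_basis d i) z)"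
    by (simp add: lin dualD[OF \<xi>] dual_action_def mult.commute)
  finally show "\<xi> z = (\<Sum>i<dim_h d. \<xi> (w (y_basis d i)) * dual_action w (x_basis d i) z)"
    using W_bij[OF w] by (simp add: bij_is_surj surj_f_inv_f)
qed

text \<open>The tensor \<open>\<Sum>\<^sub>i x\<^sub>i \<otimes> y\<^sub>i\<close> is invariant under \<open>W\<close>.\<close>

lemma W_op_coh:
  assumes w: "w \<in> refl_group d" shows "W_op w (coh u) = coh (W_op w u)"
proof -
  interpret o: Vector_Spaces.linear "tscale sM" "tscale sM" "W_op w" by (rule W_op_linear[OF w])
  let ?n = "dim_h d" and ?x = "x_basis d" and ?y = "y_basis d" and ?L = "exterior_map d w"
  let ?T = "\<lambda>i j. Top (\<lambda>m. XA (dual_action w (?x i)) (WA w m)) (\<lambda>s. wedge d (?y j) (?L s)) u"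
  have "W_op w (Top (XA (?x i)) (wedge d (?y i)) u) = (\<Sum>j<?n. tscale sM (?x j (w (?y i))) (?T i j))"
    if i: "i < ?n" for i
  proof -
    have "W_op w (Top (XA (?x i)) (wedge d (?y i)) u)
      = Top (\<lambda>m. WA w (XA (?x i) m)) (\<lambda>s. ?L (wedge d (?y i) s)) u"
      unfolding W_op_def
      by (intro MT.tensor_op_comp WA_linear w spinor_linear_exterior_map wedge_stable)
    also have "\<dots> = Top (\<lambda>m. XA (dual_action w (?x i)) (WA w m))
        (\<lambda>s. \<Sum>j<?n. cscale (?x j (w (?y i))) (wedge d (?y j) (?L s))) u"
    proof -
      have "wedge d (w (?y i)) t = (\<Sum>j<?n. cscale (?x j (w (?y i))) (wedge d (?y j) t))" for t
        by (subst y_expansion[of "w (?y i)"]) (simp add: wedge_sum wedge_scale)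
      then show ?thesis
        using MT.tensor_op_cong[of ?n "\<lambda>s. ?L (wedge d (?y i) s)"
            "\<lambda>s. \<Sum>j<?n. cscale (?x j (w (?y i))) (wedge d (?y j) (?L s))"]
        by (simp add: WA_XA[OF w x_dual[OF i]] exterior_map_wedge[OF W_linear[OF w]] ext_basis_in_tensor_space)
    qed
    also have "\<dots> = (\<Sum>j<?n. tscale sM (?x j (w (?y i))) (?T i j))"
      by (rule MT.tensor_op_sum_right)
    finally show ?thesis .
  qed
  then have "W_op w (coh u) = (\<Sum>i<?n. \<Sum>j<?n. tscale sM (?x j (w (?y i))) (?T i j))"
    unfolding coh_eq o.sum by (intro sum.cong) auto
  also have "\<dots> = (\<Sum>j<?n. \<Sum>i<?n. tscale sM (?x j (w (?y i))) (?T i j))"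
    by (rule sum.swap)
  also have "\<dots> = (\<Sum>j<?n. Top (XA (?x j)) (wedge d (?y j)) (W_op w u))"
  proof (rule sum.cong[OF refl])
    fix j assume "j \<in> {..<?n}"
    then have j: "?x j \<in> dual d" by (simp add: x_dual)
    have "(\<Sum>i<?n. tscale sM (?x j (w (?y i))) (?T i j))
      = Top (\<lambda>m. \<Sum>i<?n. sM (?x j (w (?y i))) (XA (dual_action w (?x i)) (WA w m))) (\<lambda>s. wedge d (?y j) (?L s)) u"
      by (rule MT.tensor_op_sum_left[symmetric])
    \<comment> \<open>For fixed \<open>j\<close> the sum over \<open>i\<close> is the expansion of
      \<open>?x j\<close> in the transformed dual basis.\<close>
    also have "(\<lambda>m. \<Sum>i<?n. sM (?x j (w (?y i))) (XA (dual_action w (?x i)) (WA w m))) = (\<lambda>m. XA (?x j) (WA w m))"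
    proof
      fix m
      have "XA (?x j) (WA w m) = XA (\<lambda>z. \<Sum>i<?n. ?x j (w (?y i)) * dual_action w (?x i) z) (WA w m)"
        by (rule arg_cong[OF dual_action_inverse_pairing[OF w j], where f = "\<lambda>\<xi>. XA \<xi> (WA w m)"])
      also have "\<dots> = (\<Sum>i<?n. sM (?x j (w (?y i))) (XA (dual_action w (?x i)) (WA w m)))"
        by (rule XA_sum) (simp add: dual_action_dual W_carrier w x_dual)
      finally show "(\<Sum>i<?n. sM (?x j (w (?y i))) (XA (dual_action w (?x i)) (WA w m))) = XA (?x j) (WA w m)"
        by (rule sym)
    qed
    also have "Top (\<lambda>m. XA (?x j) (WA w m)) (\<lambda>s. wedge d (?y j) (?L s)) u = Top (XA (?x j)) (wedge d (?y j)) (W_op w u)"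
      unfolding W_op_def
      by (intro MT.tensor_op_comp[symmetric] XA_linear j spinor_linear_wedge exterior_map_stable ext_basis_in_tensor_space)
    finally show "(\<Sum>i<?n. tscale sM (?x j (w (?y i))) (?T i j)) = Top (XA (?x j)) (wedge d (?y j)) (W_op w u)" .
  qed
  finally show ?thesis by (simp add: coh_eq)
qed

text \<open>The same invariance with the factors exchanged: \<open>w (?y i)\<close> is expanded on
  the side of \<open>M\<close>, and the sum over \<open>i\<close> recombines to \<open>?x j\<close>
  inside the contraction.\<close>

lemma W_op_hom:
  assumes w: "w \<in> refl_group d" shows "W_op w (hom' u) = hom' (W_op w u)"
proof -
  interpret o: Vector_Spaces.linear "tscale sM" "tscale sM" "W_op w" by (rule W_op_linear[OF w])
  let ?n = "dim_h d" and ?x = "x_basis d" and ?y = "y_basis d" and ?L = "exterior_map d w"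
  let ?T = "\<lambda>i j. Top (\<lambda>m. YA (?y j) (WA w m)) (\<lambda>s. contraction d (dual_action w (?x i)) (?L s)) u"
  have "W_op w (Top (YA (?y i)) (contraction d (?x i)) u) = (\<Sum>j<?n. tscale sM (?x j (w (?y i))) (?T i j))"
    if i: "i < ?n" for i
  proof -
    have "W_op w (Top (YA (?y i)) (contraction d (?x i)) u)
      = Top (\<lambda>m. WA w (YA (?y i) m)) (\<lambda>s. ?L (contraction d (?x i) s)) u"
      unfolding W_op_def
      by (intro MT.tensor_op_comp WA_linear w spinor_linear_exterior_map contraction_stable)
    also have "\<dots> = Top (\<lambda>m. \<Sum>j<?n. sM (?x j (w (?y i))) (YA (?y j) (WA w m)))
        (\<lambda>s. contraction d (dual_action w (?x i)) (?L s)) u"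
    proof -
      have "YA (w (?y i)) m = (\<Sum>j<?n. sM (?x j (w (?y i))) (YA (?y j) m))" for m
        by (subst (1) y_expansion[of "w (?y i)"]) (rule YA_sum)
      then show ?thesis
        using MT.tensor_op_cong[of ?n "\<lambda>s. ?L (contraction d (?x i) s)"
            "\<lambda>s. contraction d (dual_action w (?x i)) (?L s)"]
        by (simp add: WA_YA[OF w] exterior_map_contraction[OF W_carrier[OF w] x_dual[OF i]] ext_basis_in_tensor_space)
    qed
    also have "\<dots> = (\<Sum>j<?n. tscale sM (?x j (w (?y i))) (?T i j))"
      by (rule MT.tensor_op_sum_left)
    finally show ?thesis .
  qed
  then have "W_op w (hom' u) = (\<Sum>i<?n. \<Sum>j<?n. tscale sM (?x j (w (?y i))) (?T i j))"
    unfolding hom_eq o.sum by (intro sum.cong) auto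
  also have "\<dots> = (\<Sum>j<?n. \<Sum>i<?n. tscale sM (?x j (w (?y i))) (?T i j))"
    by (rule sum.swap)
  also have "\<dots> = (\<Sum>j<?n. Top (YA (?y j)) (contraction d (?x j)) (W_op w u))"
  proof (rule sum.cong[OF refl])
    fix j assume "j \<in> {..<?n}"
    then have j: "?x j \<in> dual d" by (simp add: x_dual)
    have "(\<Sum>i<?n. tscale sM (?x j (w (?y i))) (?T i j))
      = Top (\<lambda>m. YA (?y j) (WA w m)) (\<lambda>s. \<Sum>i<?n. cscale (?x j (w (?y i))) (contraction d (dual_action w (?x i)) (?L s))) u"
      by (rule MT.tensor_op_sum_right[symmetric])
    also have "(\<lambda>s. \<Sum>i<?n. cscale (?x j (w (?y i))) (contraction d (dual_action w (?x i)) (?L s)))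
        = (\<lambda>s. contraction d (?x j) (?L s))"
    proof (intro ext)
      fix s I
      have "contraction d (\<lambda>z. \<Sum>i<?n. ?x j (w (?y i)) * dual_action w (?x i) z) (?L s) I
        = (\<Sum>k<?n. \<Sum>i<?n. ?x j (w (?y i)) * (dual_action w (?x i) (?y k) * contract_at ?n k (?L s) I))"
        by (simp add: contraction_apply sum_distrib_right mult.assoc)
      also have "\<dots> = (\<Sum>i<?n. \<Sum>k<?n. ?x j (w (?y i)) * (dual_action w (?x i) (?y k) * contract_at ?n k (?L s) I))"
        by (rule sum.swap)
      also have "\<dots> = (\<Sum>i<?n. cscale (?x j (w (?y i))) (contraction d (dual_action w (?x i)) (?L s))) I"
        by (simp add: sum_fun_apply contraction_apply sum_distrib_left)
      finally show "(\<Sum>i<?n. cscale (?x j (w (?y i))) (contraction d (dual_action w (?x i)) (?L s))) I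
          = contraction d (?x j) (?L s) I"
        unfolding dual_action_inverse_pairing[OF w j, symmetric] ..
    qed
    also have "Top (\<lambda>m. YA (?y j) (WA w m)) (\<lambda>s. contraction d (?x j) (?L s)) u
        = Top (YA (?y j)) (contraction d (?x j)) (W_op w u)"
      unfolding W_op_def
      by (intro MT.tensor_op_comp[symmetric] YA_linear spinor_linear_contraction exterior_map_stable ext_basis_in_tensor_space)
    finally show "(\<Sum>i<?n. tscale sM (?x j (w (?y i))) (?T i j)) = Top (YA (?y j)) (contraction d (?x j)) (W_op w u)" .
  qed
  finally show ?thesis by (simp add: hom_eq)
qed

text \<open>Turns equivariance under the finite group \<open>W\<close> into equivariance under the
  double cover; the scalar is absorbed by the twist.\<close>

lemma dirac_action:
  assumes "g \<in> carrier (W_tilde d)"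
  shows "Top (w_act d act (cover d g)) (spin d g) u = tscale sM (chi d g) (W_op (cover d g) u)"
proof -
  have "Top A (spin d g) = Top A (\<lambda>s. cscale (chi d g) (exterior_map d (cover d g) s))" for A
    by (rule MT.tensor_op_cong)
      (rule spin_eq_chi_exterior_map(2)[OF assms ext_basis_in_tensor_space])
  then show ?thesis by (simp add: w_act_eq W_op_def MT.tensor_op_scale_right)
qed

abbreviation "hom2 u \<equiv> tscale sM 2 (hom' u)"

lemma hom2_linear: "Vector_Spaces.linear (tscale sM) (tscale sM) hom2"
proof -
  interpret vp: vector_space_pair "tscale sM" "tscale sM" ..
  show ?thesis by (rule vp.linear_compose_scale_right[OF hom_linear])
qed

lemma finite_group_rep_W: "finite_group_rep (tscale sM) W_group U W_op"
proof (intro finite_group_rep.intro finite_group_rep_axioms.intro group_W MT.T.vector_space_axioms)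
  show "MT.T.subspace U" by (rule subspace_tensor_space[OF M.vector_space_axioms])
qed (auto simp: W_finite W_op_linear W_op_U W_op_id W_op_comp)

lemma dirac_eq: "dirac d sM act = (\<lambda>u. coh u + hom2 u)"
  by (rule ext) (simp only: dirac_def dirac_x_eq dirac_y_eq)

lemma hom2_simps:
  "hom2 (hom2 u) = 0" "MT.degree_part (k - 1) (hom2 u) = hom2 (MT.degree_part k u)"
  "w \<in> refl_group d \<Longrightarrow> W_op w (hom2 u) = hom2 (W_op w u)" "hom2 u \<in> U"
proof -
  interpret h: Vector_Spaces.linear "tscale sM" "tscale sM" hom' by (rule hom_linear)
  interpret p: Vector_Spaces.linear "tscale sM" "tscale sM" "MT.degree_part k" for k by (rule MT.degree_part_linear)
  show "hom2 (hom2 u) = 0" by (simp only: h.scale hom_hom MT.T.scale_zero_right)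
  show "MT.degree_part (k - 1) (hom2 u) = hom2 (MT.degree_part k u)" by (simp only: p.scale hom_degree)
  show "hom2 u \<in> U" by (rule MT.T.subspace_scale[OF subspace_tensor_space[OF M.vector_space_axioms] hom_U])
  assume w: "w \<in> refl_group d"
  interpret o: Vector_Spaces.linear "tscale sM" "tscale sM" "W_op w" by (rule W_op_linear[OF w])
  show "W_op w (hom2 u) = hom2 (W_op w u)" by (simp only: o.scale W_op_hom[OF w])
qed

section \<open>The two gradings and the resulting embeddings\<close>

context
  assumes ss: "acts_semisimply U (tscale sM) (dirac d sM act \<circ> dirac d sM act)"
begin

text \<open>With \<open>n = dim_h d\<close>, the exterior degrees \<open>0, ..., n\<close> are the
  integers above \<open>- 1\<close> and at most \<open>- 1 + (n + 1)\<close>.\<close>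

lemma graded_dirac_coh: "graded_dirac (tscale sM) W_group U W_op coh hom2 MT.degree_part (- 1) (dim_h d + 1)"
proof (intro graded_dirac.intro graded_dirac_axioms.intro finite_group_rep_W)
  show "u = 0" if "\<And>k. MT.degree_part k u = 0" for u by (rule MT.degree_part_eq_0[OF that])
  show "MT.degree_part k u = 0" if "u \<in> U" "k \<le> - 1 \<or> k > - 1 + int (dim_h d + 1)" for u k
    by (rule MT.degree_part_bounded[OF that(1)]) (use that(2) in auto)
  show "acts_semisimply U (tscale sM) ((\<lambda>u. coh u + hom2 u) \<circ> (\<lambda>u. coh u + hom2 u))"
    using ss unfolding dirac_eq .
  show "MT.degree_part k (hom2 u) = hom2 (MT.degree_part (k + 1) u)" for k u
    using hom2_simps(2)[of "k + 1" u] by simp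
qed (auto simp: coh_linear hom2_linear MT.degree_part_linear coh_U hom2_simps(1,3,4) MT.degree_part_stable coh_coh
    MT.degree_part_degree_part coh_degree W_op_coh W_op_degree)

text \<open>Negated degrees run through \<open>- n, ..., 0\<close> for \<open>n = dim_h d\<close>,
  so the exclusive lower bound is \<open>- n - 1\<close>. In this grading contraction raises the
  degree and wedging lowers it.\<close>

lemma graded_dirac_hom:
  "graded_dirac (tscale sM) W_group U W_op hom2 coh (\<lambda>k. MT.degree_part (- k)) (- int (dim_h d) - 1) (dim_h d + 1)"
proof (intro graded_dirac.intro graded_dirac_axioms.intro finite_group_rep_W)
  show "u = 0" if "\<And>k. MT.degree_part (- k) u = 0" for u
    using that[of "- k" for k] MT.degree_part_eq_0[of u] by simp
  show "MT.degree_part (- k) u = 0"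
    if "u \<in> U" "k \<le> - int (dim_h d) - 1 \<or> k > - int (dim_h d) - 1 + int (dim_h d + 1)" for u k
    by (rule MT.degree_part_bounded[OF that(1)]) (use that(2) in auto)
  show "acts_semisimply U (tscale sM) ((\<lambda>u. hom2 u + coh u) \<circ> (\<lambda>u. hom2 u + coh u))"
    using ss unfolding dirac_eq by (simp only: add.commute[of "hom2 _"])
  show "MT.degree_part (- (k + 1)) (hom2 u) = hom2 (MT.degree_part (- k) u)" for k u
    using hom2_simps(2)[of "- k" u] by simp
  show "MT.degree_part (- k) (coh u) = coh (MT.degree_part (- (k + 1)) u)" for k u
    using coh_degree[of "- k - 1" u] by simp
qed (auto simp: coh_linear hom2_linear MT.degree_part_linear coh_U hom2_simps(1,3,4) MT.degree_part_stable coh_coh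
    MT.degree_part_degree_part W_op_coh W_op_degree)

lemma dirac_embeddings:
  "\<exists>f. injective_rep_hom (W_tilde d) (dirac_cohomology d sM act) (twist (chi d) (cohomology_dual d sM act)) f"
  "\<exists>f. injective_rep_hom (W_tilde d) (dirac_cohomology d sM act) (twist (chi d) (homology_h d sM act)) f"
proof -
  let ?ac = "\<lambda>g. Top (w_act d act (cover d g)) (spin d g)"
  interpret c: graded_dirac "tscale sM" W_group U W_op coh hom2 MT.degree_part "- 1" "dim_h d + 1"
    by (rule graded_dirac_coh)
  interpret h: graded_dirac "tscale sM" W_group U W_op hom2 coh "\<lambda>k. MT.degree_part (- k)"
      "- int (dim_h d) - 1" "dim_h d + 1"
    by (rule graded_dirac_hom)
  have D: "c.D = dirac d sM act" "h.D = dirac d sM act"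
    by (simp_all add: fun_eq_iff c.D_def h.D_def dirac_eq add.commute)
  have H: "dirac_cohomology d sM act = quotient_rep (tscale sM) ?ac c.cycles c.bounds"
    "dirac_cohomology d sM act = quotient_rep (tscale sM) ?ac h.cycles h.bounds"
    unfolding dirac_cohomology_def Let_def c.cycles_def c.bounds_def h.cycles_def h.bounds_def D kernel_on_def
    by (rule refl)+
  have W: "(\<lambda>g. Top (w_act d act (cover d g)) (exterior_map d (cover d g))) = (\<lambda>g. W_op (cover d g))"
    by (simp add: W_op_def w_act_eq)
  have cover: "cover d g \<in> carrier W_group" if "g \<in> carrier (W_tilde d)" for g
    using spin_eq_chi_exterior_map(1)[OF that] by simp
  show "\<exists>f. injective_rep_hom (W_tilde d) (dirac_cohomology d sM act) (twist (chi d) (cohomology_dual d sM act)) f"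
    unfolding H(1) total_homology_def Let_def W kernel_on_def
    by (rule c.quotient_embedding[OF cover dirac_action])
  \<comment> \<open>Scaling by 2 changes neither kernel nor image, so the homology of
    \<open>hom2\<close> is that of the differential in \<open>homology_h\<close>.\<close>
  have hom2: "hom2 u = 0 \<longleftrightarrow> hom' u = 0" for u by (simp add: MT.T.scale_eq_0_iff)
  have "hom2 ` U = hom' ` U"
  proof -
    interpret l: Vector_Spaces.linear "tscale sM" "tscale sM" hom' by (rule hom_linear)
    have "hom2 u \<in> hom' ` U" if "u \<in> U" for u
      using MT.T.subspace_scale[OF c.U that, of 2] by (auto simp: l.scale[symmetric])
    moreover have "hom' u \<in> hom2 ` U" if "u \<in> U" for u
      using MT.T.subspace_scale[OF c.U that, of "1/2"]
      by (intro image_eqI[of _ _ "tscale sM (1/2) u"]) (simp_all only: l.scale MT.T.scale_scale, simp)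
    ultimately show ?thesis by blast
  qed
  then have im: "hom' ` U = hom2 ` U" ..
  show "\<exists>f. injective_rep_hom (W_tilde d) (dirac_cohomology d sM act) (twist (chi d) (homology_h d sM act)) f"
    unfolding H(2) total_homology_def Let_def W kernel_on_def im hom2[symmetric]
    by (rule h.quotient_embedding[OF cover dirac_action])
qed

end

end

theorem theoremB:
  fixes d :: "'v::ab_group_add cherednik"
    and sM :: "complex \<Rightarrow> 'm::ab_group_add \<Rightarrow> 'm"
    and act :: "'v cher_letter free set \<Rightarrow> 'm \<Rightarrow> 'm"
  assumes "cherednik_module d sM act"
    and "acts_semisimply (tensor_space (dim_h d)) (tscale sM) (dirac d sM act \<circ> dirac d sM act)"
  shows "(\<exists>f. injective_rep_hom (W_tilde d) (dirac_cohomology d sM act)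
                (twist (chi d) (cohomology_dual d sM act)) f)
       \<and> (\<exists>f. injective_rep_hom (W_tilde d) (dirac_cohomology d sM act)
                (twist (chi d) (homology_h d sM act)) f)"
  using cherednik_module.dirac_embeddings[OF assms] by blast

end
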